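(* Let $0<p\le1$ and let $W\ge0$ be locally integrable on $\mathbb D$. Then the mapping $$\frac{d}{dz}:\mathcal Q_p\longrightarrow L^2(W\,dA),\qquad f\mapsto f',$$ is compact if and only if $$\lim_{\rho\to1^-}\ \sup_{\mathcal D}\ \big\|h_{W^\rho}\big\|_{\mathcal B_p(\mathcal D)}=0,$$ where the supremum is taken over all dyadic systems $\mathcal D$ on $\mathbb T$, and for $0<\rho<1$ and an arc $I\subseteq\mathbb T$ $$W^\rho(z):=\mathbf 1_{\{|z|>\rho\}}(z)\,W(z),\qquad h_{W^\rho}(I):=\frac{1}{|I|^{p+2}}\int_{Q_I^{\mathrm{up}}}W^\rho(z)\,dA(z).$$
   Context: $\mathbb D$ is the open unit disc, $\mathbb T$ the unit circle, $dA$ is normalized area measure on $\mathbb D$, and $H(\mathbb D)$ is the space of holomorphic functions on $\mathbb D$. For $a\in\mathbb D$, $\sigma_a(z)=\frac{a-z}{1-\overline a z}$ and $g(z,a)=\log\frac{1}{|\sigma_a(z)|}$. $\mathcal Q_p$ is the space of $f\in H(\mathbb D)$ with $\|f\|_{\mathcal Q_p,*}^2:=\sup_{a\in\mathbb D}\int_{\mathbb D}|f'(z)|^2g(z,a)^p\,dA(z)<\infty$, normed by $\|f\|_{\mathcal Q_p}:=|f(0)|+\|f\|_{\mathcal Q_p,*}$. Compactness of the mapping includes that it is well defined, i.e. $f'\in L^2(W\,dA)$ for all $f\in\mathcal Q_p$. $|I|$ denotes arc length normalized so that $|\mathbb T|=1$; arcs include $\mathbb T$ itself. For an arc $I$, $Q_I^{\mathrm{up}}:=\{re^{it}: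 e^{it}\in I,\ 1-|I|\le r<1-\frac{|I|}{2}\}$. A dyadic system on $\mathbb T$ is a family $\mathcal D=\bigcup_{k\ge0}\mathcal D_k$ of half-open arcs where $\mathcal D_0=\{\mathbb T\}$, each $\mathcal D_k$ is a partition of $\mathbb T$ into $2^k$ arcs of length $2^{-k}$, and each arc of $\mathcal D_{k+1}$ is contained in an arc of $\mathcal D_k$. For a nonnegative sequence $h=\{h(I)\}_{I\in\mathcal D}$, the dyadic $p$-capacity gauge is $$\|h\|_{\mathcal B_p(\mathcal D)}:=\inf\Big\{\sum_{J\in\mathcal D}\lambda_J|J|^p:\ \lambda_J\ge0,\ \sum_{J\in\mathcal D,\,J\supseteq I}\lambda_J\ge h(I)\ \text{for all }I\in\mathcal D\Big\}\in[0,\infty],$$ with $\inf\emptyset=+\infty$; in $\|h_{W^\rho}\|_{\mathcal B_p(\mathcal D)}$ the sequence is $\{h_{W^\rho}(I)\}_{I\in\mathcal D}$. *)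

theory Defs
  imports "HOL-Analysis.Analysis"
begin

section \<open>Normalized area measure on the disc and weighted \<open>L\<^sup>2\<close>\<close>

abbreviation unit_disc :: "complex set"
  where "unit_disc \<equiv> ball 0 1"

abbreviation unit_circle :: "complex set"
  where "unit_circle \<equiv> sphere 0 1"

definition dA :: "complex measure"
  where "dA = scale_measure (ennreal (1 / pi)) (lebesgue_on unit_disc)"

definition weighted_area :: "(complex \<Rightarrow> real) \<Rightarrow> complex measure"
  where "weighted_area W = density dA (\<lambda>z. ennreal (W z))"

definition locally_integrable_on_disc :: "(complex \<Rightarrow> real) \<Rightarrow> bool"
  where "locally_integrable_on_disc W \<longleftrightarrow>
    (\<forall>K. compact K \<and> K \<subseteq> unit_disc \<longrightarrow> set_integrable lebesgue K W)"

text \<open>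
  Elements of \<open>L\<^sup>2\<close> are represented by functions rather than by classes modulo null sets, so
  \<open>L2_norm\<close> is a seminorm on this set. It is meaningful only on members of \<open>L2_space\<close>
  (\<open>enn2real\<close> sends \<open>\<infinity>\<close> to \<open>0\<close>); this set is closed under differences.
\<close>

definition L2_space :: "'a measure \<Rightarrow> ('a \<Rightarrow> complex) set"
  where "L2_space M =
    {f \<in> borel_measurable M. (\<integral>\<^sup>+z. ennreal ((cmod (f z))\<^sup>2) \<partial>M) < \<infinity>}"

definition L2_norm :: "'a measure \<Rightarrow> ('a \<Rightarrow> complex) \<Rightarrow> real"
  where "L2_norm M f = sqrt (enn2real (\<integral>\<^sup>+z. ennreal ((cmod (f z))\<^sup>2) \<partial>M))"


section \<open>The spaces \<open>\<Q>\<^sub>p\<close>\<close>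

definition moebius_disc :: "complex \<Rightarrow> complex \<Rightarrow> complex"
  where "moebius_disc a z = (a - z) / (1 - cnj a * z)"

text \<open>The junk value \<open>green_disc a a = 0\<close> affects only a null set.\<close>

definition green_disc :: "complex \<Rightarrow> complex \<Rightarrow> real"
  where "green_disc z a = ln (1 / cmod (moebius_disc a z))"

definition Qp_seminorm_sq :: "real \<Rightarrow> (complex \<Rightarrow> complex) \<Rightarrow> ennreal"
  where "Qp_seminorm_sq p f =
    (SUP a\<in>unit_disc. \<integral>\<^sup>+z. ennreal ((cmod (deriv f z))\<^sup>2 * green_disc z a powr p) \<partial>dA)"

definition Qp_space :: "real \<Rightarrow> (complex \<Rightarrow> complex) set"
  where "Qp_space p = {f. f holomorphic_on unit_disc \<and> Qp_seminorm_sq p f < \<infinity>}"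

definition Qp_norm :: "real \<Rightarrow> (complex \<Rightarrow> complex) \<Rightarrow> real"
  where "Qp_norm p f = cmod (f 0) + sqrt (enn2real (Qp_seminorm_sq p f))"


section \<open>Compact mappings\<close>

text \<open>
  \<open>T\<close> maps the (semi)normed space \<open>X\<close> into \<open>Y\<close> and the image of every bounded sequence
  has a subsequence that converges in \<open>Y\<close>.
\<close>

definition compact_mapping ::
    "'a set \<Rightarrow> ('a \<Rightarrow> real) \<Rightarrow> 'b::minus set \<Rightarrow> ('b \<Rightarrow> real) \<Rightarrow> ('a \<Rightarrow> 'b) \<Rightarrow> bool"
  where "compact_mapping X norm_X Y norm_Y T \<longleftrightarrow>
    (\<forall>x\<in>X. T x \<in> Y) \<and>
    (\<forall>x :: nat \<Rightarrow> 'a. (\<forall>n. x n \<in> X) \<and> (\<exists>B. \<forall>n. norm_X (x n) \<le> B) \<longrightarrow>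
      (\<exists>r. strict_mono (r :: nat \<Rightarrow> nat) \<and>
        (\<exists>y\<in>Y. (\<lambda>n. norm_Y (T (x (r n)) - y)) \<longlonglongrightarrow> 0)))"


section \<open>Arcs and dyadic systems\<close>

definition arc_len :: "complex set \<Rightarrow> real"
  where "arc_len I = measure lebesgue {t \<in> {0..<1}. cis (2 * pi * t) \<in> I}"

text \<open>Either endpoint may be the included one; \<open>b = a + 2 * pi\<close> gives the whole circle.\<close>

definition half_open_arc :: "complex set \<Rightarrow> bool"
  where "half_open_arc I \<longleftrightarrow>
    (\<exists>a b. a < b \<and> b \<le> a + 2 * pi \<and> (I = cis ` {a..<b} \<or> I = cis ` {a<..b}))"

definition upper_half_box :: "complex set \<Rightarrow> complex set"
  where "upper_half_box I =
    {of_real r * u | r u. u \<in> I \<and> 1 - arc_len I \<le> r \<and> r < 1 - arc_len I / 2}"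

definition dyadic_system :: "complex set set \<Rightarrow> bool"
  where "dyadic_system \<D> \<longleftrightarrow>
    (\<exists>G :: nat \<Rightarrow> complex set set.
      \<D> = (\<Union>k. G k) \<and> G 0 = {unit_circle} \<and>
      (\<forall>k. partition_on unit_circle (G k) \<and> card (G k) = 2 ^ k \<and>
        (\<forall>I\<in>G k. half_open_arc I \<and> arc_len I = 1 / 2 ^ k) \<and>
        (\<forall>I\<in>G (Suc k). \<exists>J\<in>G k. I \<subseteq> J)))"


section \<open>The dyadic capacity gauge\<close>

definition dyadic_gauge :: "real \<Rightarrow> complex set set \<Rightarrow> (complex set \<Rightarrow> ennreal) \<Rightarrow> ennreal"
  where "dyadic_gauge p \<D> h =
    (INF l \<in> {l :: complex set \<Rightarrow> real. (\<forall>J\<in>\<D>. 0 \<le> l J) \<and>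
        (\<forall>I\<in>\<D>. h I \<le> (\<Sum>\<^sub>\<infinity>J\<in>{J\<in>\<D>. I \<subseteq> J}. ennreal (l J)))}.
      \<Sum>\<^sub>\<infinity>J\<in>\<D>. ennreal (l J * arc_len J powr p))"

definition tail_weight :: "(complex \<Rightarrow> real) \<Rightarrow> real \<Rightarrow> complex \<Rightarrow> real"
  where "tail_weight W \<rho> z = indicator {z. cmod z > \<rho>} z * W z"

definition box_average :: "real \<Rightarrow> (complex \<Rightarrow> real) \<Rightarrow> complex set \<Rightarrow> ennreal"
  where "box_average p W I =
    (\<integral>\<^sup>+z\<in>upper_half_box I. ennreal (W z) \<partial>dA) / ennreal (arc_len I powr (p + 2))"

end

theory Submission
  imports Defs "HOL-Complex_Analysis.Complex_Analysis"
begin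

text \<open>
  Write \<open>Q\<^sub>I\<close> for the upper half box of a dyadic arc \<open>I\<close> and \<open>w\<^sub>I\<close> for its centre. The boxes of one dyadic
  system tile the disc, and \<open>Q\<^sub>I\<close> has diameter and distance to the circle comparable with \<open>|I|\<close>.

  From the gauge to the embedding. For \<open>f \<in> \<Q>\<^sub>p\<close> let \<open>a\<^sub>I\<close> be the integral of
  \<open>|f'|\<^sup>2 (1 - |z|)\<^sup>p\<close> over a small enlargement of \<open>Q\<^sub>I\<close>. The mean value property gives
  \<open>|f'|\<^sup>2 \<le> C a\<^sub>I / |I|\<^bsup>p+2\<^esup>\<close> on \<open>Q\<^sub>I\<close>, and testing the \<open>\<Q>\<^sub>p\<close> seminorm at the centre \<open>w\<^sub>J\<close> gives the Carleson
  condition \<open>\<Sum>\<^bsub>I \<subseteq> J\<^esub> a\<^sub>I \<le> C |J|\<^sup>p \<parallel>f\<parallel>\<^sup>2\<close>. Hence the integral of \<open>|f'|\<^sup>2 V\<close> is at most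
  \<open>C \<Sum> a\<^sub>I h\<^sub>V(I)\<close>, and if \<open>h\<^sub>V(I) \<le> \<Sum>\<^bsub>J \<supseteq> I\<^esub> \<lambda>\<^sub>J\<close>, summing over \<open>I\<close> first bounds it by
  \<open>C \<parallel>f\<parallel>\<^sup>2 \<Sum> \<lambda>\<^sub>J |J|\<^sup>p\<close> (lemma \<open>weighted_embedding\<close>). So a vanishing gauge makes the tails of the embedding
  uniformly small; on a smaller disc Montel's theorem gives uniform convergence of derivatives, and
  compactness follows.

  From the embedding to the gauge. The gauge is the value of a linear program. Its dual maximises
  \<open>\<Sum> \<alpha>\<^sub>I h(I)\<close> over \<open>\<alpha> \<ge> 0\<close> with \<open>\<Sum>\<^bsub>I \<subseteq> J\<^esub> \<alpha>\<^sub>I \<le> |J|\<^sup>p\<close>, and on a tree there is no duality gap because a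
  greedy choice is optimal (\<open>finite_tree_duality\<close>, \<open>dyadic_gauge_le\<close>). For such an \<open>\<alpha>\<close>, with finite support,
  take \<open>f\<close> with \<open>f' = \<Sum> \<plusminus> (\<alpha>\<^sub>I / |I|\<^sup>p)\<^bsup>1/2\<^esup> |I|\<^sup>2 (1 - cnj w\<^sub>I z)\<^bsup>-3\<^esup>\<close>. For every choice of signs \<open>f\<close> lies in a fixed ball of \<open>\<Q>\<^sub>p\<close>
  (\<open>test_function\<close>). On average over the signs \<open>|f'|\<^sup>2\<close> is the sum of the squares of the terms, which on
  \<open>Q\<^sub>I\<close> is at least \<open>c \<alpha>\<^sub>I / |I|\<^bsup>p+2\<^esup>\<close>; so some choice of signs has \<open>\<integral> |f'|\<^sup>2 V \<ge> c \<Sum> \<alpha>\<^sub>I h\<^sub>V(I)\<close>. Therefore the gauge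
  of every dyadic system is bounded, with one constant, by the supremum of \<open>\<integral> |f'|\<^sup>2 V\<close> over a ball of \<open>\<Q>\<^sub>p\<close>
  (\<open>gauge_le_test_functions\<close>). For the tail weights this supremum tends to \<open>0\<close> when the embedding is compact.

  The bound on the test functions rests on the quantity \<open>|1 - cnj a z|\<close>. It satisfies the triangle
  inequality and dominates \<open>|z - a|\<close>, \<open>1 - |a|\<close> and \<open>1 - |z|\<close>. All integrals and sums involving its negative powers are
  estimated over the shells where it is comparable with \<open>2\<^sup>j r\<close> (\<open>shell_integral\<close>), and the boxes in
  a shell are counted by comparing areas of disjoint discs (\<open>packing\<close>).
\<close>

section \<open>Area integrals and mean values on the disc\<close>

text \<open>
  Orthogonal maps of \<open>real^2\<close> preserve Lebesgue measure; this identification transports that fact to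
  the complex plane.
\<close>

lemma distr_lborel_vec2_complex:
  "distr lborel borel (\<lambda>v::real^2. Complex (vec_nth v 1) (vec_nth v 2)) = lborel"
proof (rule lborel_eqI[symmetric])
  let ?f = "\<lambda>v::real^2. Complex (vec_nth v 1) (vec_nth v 2)"
  have cont: "continuous_on UNIV ?f"
    unfolding Complex_eq by (intro continuous_intros)
  have meas[measurable]: "?f \<in> borel_measurable borel"
    by (rule borel_measurable_continuous_onI[OF cont])
  fix l u :: complex assume le: "\<And>b. b \<in> Basis \<Longrightarrow> l \<bullet> b \<le> u \<bullet> b"
  have le': "Re l \<le> Re u" "Im l \<le> Im u"
    using le[of 1] le[of \<i>] by (auto simp: Basis_complex_def)
  have eq: "?f -` box l u = box (vector [Re l, Im l]) (vector [Re u, Im u])"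
    by (auto simp: box_def Basis_complex_def Basis_vec_def inner_axis axis_eq_axis forall_2)
  have B: "(Basis :: (real^2) set) = {axis 1 1, axis 2 1}"
    by (auto simp: Basis_vec_def UNIV_2)
  show "emeasure (distr lborel borel ?f) (box l u) = (\<Prod>b\<in>Basis. (u - l) \<bullet> b)"
    using le'
    by (simp add: emeasure_distr eq emeasure_lborel_box_eq B Basis_complex_def inner_axis axis_eq_axis
        inner_diff_left)
qed simp

lemma distr_lborel_rotation:
  "distr lborel borel (\<lambda>z. cis t * z) = (lborel :: complex measure)"
proof (rule lborel_eqI[symmetric])
  let ?f = "\<lambda>v::real^2. Complex (vec_nth v 1) (vec_nth v 2)"
  let ?g = "\<lambda>z. vector [Re z, Im z] :: real^2"
  let ?R = "\<lambda>v. ?g (cis (-t) * ?f v)"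
  have cont: "continuous_on UNIV ?f"
    unfolding Complex_eq by (intro continuous_intros)
  have meas[measurable]: "?f \<in> borel_measurable borel"
    by (rule borel_measurable_continuous_onI[OF cont])
  have fg[simp]: "?f (?g z) = z" for z by simp
  have gf[simp]: "?g (?f v) = v" for v by (simp add: vec_eq_iff forall_2)
  have norm_f: "norm (?f v) = norm v" for v
    by (simp add: cmod_def norm_vec_def L2_set_def sum_2)
  have norm_g: "norm (?g z) = norm z" for z
    using norm_f[of "?g z"] by simp
  have "linear ?R"
    by (rule linearI) (auto simp: vec_eq_iff forall_2 algebra_simps)
  moreover have "norm (?R v) = norm v" for v
    by (simp only: norm_g norm_mult norm_cis norm_f)
  ultimately have orth: "orthogonal_transformation ?R"
    by (simp add: orthogonal_transformation)
  fix l u :: complex assume le: "\<And>b. b \<in> Basis \<Longrightarrow> l \<bullet> b \<le> u \<bullet> b"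
  let ?B = "?f -` box l u"
  have eq: "?B = box (vector [Re l, Im l]) (vector [Re u, Im u])"
    by (auto simp: box_def Basis_complex_def Basis_vec_def inner_axis axis_eq_axis forall_2)
  have Bm: "?B \<in> lmeasurable" by (simp add: eq)
  have im: "?R ` ?B = ?f -` ((\<lambda>z. cis t * z) -` box l u)"
  proof (intro equalityI subsetI)
    fix v assume "v \<in> ?R ` ?B"
    then obtain x where x: "?f x \<in> box l u" "v = ?R x" by auto
    have "cis t * ?f v = ?f x"
      by (simp only: x(2) fg mult.assoc[symmetric] cis_mult) simp
    with x show "v \<in> ?f -` ((\<lambda>z. cis t * z) -` box l u)" by simp
  next
    fix v assume v: "v \<in> ?f -` ((\<lambda>z. cis t * z) -` box l u)"
    have "v = ?R (?g (cis t * ?f v))"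
      by (simp only: fg mult.assoc[symmetric] cis_mult) (simp add: vec_eq_iff forall_2)
    with v show "v \<in> ?R ` ?B"
      by (intro image_eqI[of _ _ "?g (cis t * ?f v)"]) (simp_all only: vimage_eq fg)
  qed
  have fin: "?R ` ?B \<in> lmeasurable" by (rule measurable_orthogonal_image[OF orth Bm])
  have borelS: "(\<lambda>z. cis t * z) -` box l u \<in> sets borel"
    by (rule measurable_sets_borel[of "(\<lambda>z. cis t * z)" borel]) (auto intro!: borel_measurable_continuous_onI continuous_intros)
  have "emeasure (distr lborel borel (\<lambda>z. cis t * z)) (box l u)
      = emeasure lborel ((\<lambda>z. cis t * z) -` box l u)"
    by (subst emeasure_distr) auto
  also have "\<dots> = emeasure (distr lborel borel ?f) ((\<lambda>z. cis t * z) -` box l u)"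
    by (simp add: distr_lborel_vec2_complex)
  also have "\<dots> = emeasure lborel (?f -` ((\<lambda>z. cis t * z) -` box l u))"
    using borelS by (subst emeasure_distr) auto
  also have "\<dots> = emeasure lebesgue (?R ` ?B)"
    unfolding im using measurable_sets_borel[OF meas borelS] by (simp add: emeasure_completion)
  also have "\<dots> = emeasure lebesgue ?B"
    using measure_orthogonal_image[OF orth Bm] fin Bm
    by (simp add: emeasure_eq_measure2 fmeasurableD2)
  also have "\<dots> = emeasure lborel ?B"
    by (simp add: eq)
  also have "\<dots> = emeasure (distr lborel borel ?f) (box l u)"
    by (subst emeasure_distr) auto
  also have "\<dots> = (\<Prod>b\<in>Basis. (u - l) \<bullet> b)"
    using le by (simp add: distr_lborel_vec2_complex emeasure_lborel_box_eq)
  finally show "emeasure (distr lborel borel (\<lambda>z. cis t * z)) (box l u) = (\<Prod>b\<in>Basis. (u - l) \<bullet> b)" .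
qed simp


text \<open>
  Cauchy's formula on the unit circle for \<open>v \<mapsto> G (v * u)\<close>. Scaling the argument instead of the circle
  avoids a separate treatment of \<open>u = 0\<close>.
\<close>

lemma circle_submean:
  assumes "G holomorphic_on ball 0 r" "u \<in> ball 0 r"
  shows "ennreal (2 * pi) * ennreal (norm (G 0)) \<le> (\<integral>\<^sup>+t\<in>{0..2*pi}. ennreal (norm (G (cis t * u))) \<partial>lborel)"
proof -
  let ?H = "\<lambda>v. G (v * u)"
  have sub: "v * u \<in> ball 0 r" if "v \<in> cball 0 1" for v
  proof -
    have "norm v * norm u \<le> 1 * norm u" using that by (intro mult_right_mono) auto
    with assms(2) show ?thesis by (auto simp: norm_mult)
  qed
  have contG: "continuous_on (ball 0 r) G"
    using assms(1) by (rule holomorphic_on_imp_continuous_on)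
  have cont: "continuous_on (cball 0 1) ?H"
    by (rule continuous_on_compose2[OF contG]) (use sub in \<open>auto intro!: continuous_intros\<close>)
  have hol: "?H holomorphic_on ball 0 1"
    by (rule holomorphic_on_compose_gen[OF _ assms(1), unfolded o_def])
       (use sub in \<open>auto intro!: holomorphic_intros\<close>)
  have "((\<lambda>v. ?H v / (v - 0)) has_contour_integral (2 * of_real pi * \<i> * ?H 0)) (circlepath 0 1)"
    by (rule Cauchy_integral_circlepath[OF cont hol]) auto
  then have "((\<lambda>t. ?H (cis t) * \<i>) has_integral (2 * of_real pi * G 0 * \<i>)) {0..2*pi}"
    unfolding circlepath_def
    by (subst (asm) has_contour_integral_part_circlepath_iff) (auto simp: mult_ac)
  then have "((\<lambda>t. (?H (cis t) * \<i>) * (-\<i>)) has_integral (2 * of_real pi * G 0 * \<i>) * (-\<i>)) {0..2*pi}"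
    by (rule has_integral_mult_left)
  then have int: "((\<lambda>t. G (cis t * u)) has_integral (2 * of_real pi * G 0)) {0..2*pi}"
    by (simp add: mult.assoc)
  have cont': "continuous_on {0..2*pi} (\<lambda>t. G (cis t * u))"
    by (rule continuous_on_compose2[OF cont]) (auto intro!: continuous_intros)
  have si: "set_integrable lborel {0..2*pi} (\<lambda>t. G (cis t * u))"
    by (rule borel_integrable_atLeastAtMost'[OF cont'])
  have "(LINT t:{0..2*pi}|lborel. G (cis t * u)) = 2 * of_real pi * G 0"
    using set_borel_integral_eq_integral(2)[OF si] int by (simp add: integral_unique)
  then have "ennreal (2 * pi) * ennreal (norm (G 0)) = ennreal (norm (LINT t:{0..2*pi}|lborel. G (cis t * u)))"
    by (simp add: norm_mult ennreal_mult)
  also have "\<dots> \<le> (\<integral>\<^sup>+t. ennreal (norm (indicator {0..2*pi} t *\<^sub>R G (cis t * u))) \<partial>lborel)"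
    unfolding set_lebesgue_integral_def
    by (rule integral_norm_bound_ennreal) (use si in \<open>simp add: set_integrable_def\<close>)
  also have "\<dots> = (\<integral>\<^sup>+t\<in>{0..2*pi}. ennreal (norm (G (cis t * u))) \<partial>lborel)"
    by (intro nn_integral_cong) (auto split: split_indicator)
  finally show ?thesis .
qed

text \<open>
  Integrate the circle inequality over \<open>u\<close> and exchange the integrals: by rotation invariance the
  integral over \<open>u\<close> is the same for every angle.
\<close>

lemma disc_submean_0:
  assumes "G holomorphic_on ball 0 r"
  shows "ennreal (norm (G 0)) * emeasure lborel (ball (0::complex) r) \<le> (\<integral>\<^sup>+u\<in>ball 0 r. ennreal (norm (G u)) \<partial>lborel)"
proof -
  define h where "h u = ennreal (norm (G u)) * indicator (ball 0 r) u" for u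
  have contG: "continuous_on (ball 0 r) G"
    using assms(1) by (rule holomorphic_on_imp_continuous_on)
  have "(\<lambda>u. indicator (ball 0 r) u *\<^sub>R G u) \<in> borel_measurable borel"
    using borel_measurable_continuous_on_indicator[OF _ contG] by simp
  then have "(\<lambda>u. ennreal (norm (indicator (ball 0 r) u *\<^sub>R G u))) \<in> borel_measurable borel"
    by measurable
  also have "(\<lambda>u. ennreal (norm (indicator (ball 0 r) u *\<^sub>R G u))) = h"
    by (auto simp: h_def split: split_indicator)
  finally have h[measurable]: "h \<in> borel_measurable borel" .
  have [measurable]: "cis \<in> borel_measurable borel"
    by (intro borel_measurable_continuous_onI continuous_intros)
  have rot: "h (cis t * u) = ennreal (norm (G (cis t * u))) * indicator (ball 0 r) u" for t u
    by (auto simp: h_def norm_mult split: split_indicator)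
  have "ennreal (2 * pi) * (ennreal (norm (G 0)) * emeasure lborel (ball (0::complex) r))
      = (\<integral>\<^sup>+u. ennreal (2 * pi) * ennreal (norm (G 0)) * indicator (ball 0 r) (u::complex) \<partial>lborel)"
    by (simp add: nn_integral_cmult_indicator mult.assoc[symmetric])
  also have "\<dots> \<le> (\<integral>\<^sup>+u. (\<integral>\<^sup>+t. h (cis t * u) * indicator {0..2*pi} t \<partial>lborel) \<partial>lborel)"
    using circle_submean[OF assms(1)]
    by (intro nn_integral_mono) (auto simp: rot split: split_indicator)
  also have "\<dots> = (\<integral>\<^sup>+t. (\<integral>\<^sup>+u. h (cis t * u) * indicator {0..2*pi} t \<partial>lborel) \<partial>lborel)"
    by (rule lborel_pair.Fubini') measurable
  also have "\<dots> = (\<integral>\<^sup>+t. (\<integral>\<^sup>+u. h u \<partial>lborel) * indicator {0..2*pi} t \<partial>lborel)"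
  proof (rule nn_integral_cong)
    fix t
    have "(\<integral>\<^sup>+u. h (cis t * u) \<partial>lborel) = (\<integral>\<^sup>+u. h u \<partial>distr lborel borel (\<lambda>z. cis t * z))"
      by (subst nn_integral_distr) auto
    then show "(\<integral>\<^sup>+u. h (cis t * u) * indicator {0..2*pi} t \<partial>lborel)
        = (\<integral>\<^sup>+u. h u \<partial>lborel) * indicator {0..2*pi} t"
      by (simp add: distr_lborel_rotation nn_integral_multc)
  qed
  also have "\<dots> = ennreal (2 * pi) * (\<integral>\<^sup>+u. h u \<partial>lborel)"
    by (simp add: nn_integral_cmult mult.commute)
  finally show ?thesis
    by (subst (asm) ennreal_mult_le_mult_iff) (auto simp: h_def[abs_def])
qed

lemma disc_submean:
  assumes "F holomorphic_on ball z r"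
  shows "ennreal (norm (F z)) * emeasure lborel (ball z r) \<le> (\<integral>\<^sup>+u\<in>ball z r. ennreal (norm (F u)) \<partial>lborel)"
proof -
  have im: "(\<lambda>u. z + u) ` ball 0 r = ball z r" by simp
  have hol: "(\<lambda>u. F (z + u)) holomorphic_on ball 0 r"
    by (rule holomorphic_on_compose_gen[OF _ assms(1), unfolded o_def])
       (auto intro!: holomorphic_intros simp: dist_norm)
  have contG: "continuous_on (ball z r) F"
    using assms(1) by (rule holomorphic_on_imp_continuous_on)
  have "(\<lambda>u. indicator (ball z r) u *\<^sub>R F u) \<in> borel_measurable borel"
    using borel_measurable_continuous_on_indicator[OF _ contG] by simp
  then have "(\<lambda>u. ennreal (norm (indicator (ball z r) u *\<^sub>R F u))) \<in> borel_measurable borel"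
    by measurable
  also have "(\<lambda>u. ennreal (norm (indicator (ball z r) u *\<^sub>R F u))) = (\<lambda>u. ennreal (norm (F u)) * indicator (ball z r) u)"
    by (auto split: split_indicator)
  finally have h[measurable]: "(\<lambda>u. ennreal (norm (F u)) * indicator (ball z r) u) \<in> borel_measurable borel" .
  have "(\<integral>\<^sup>+u\<in>ball z r. ennreal (norm (F u)) \<partial>lborel)
      = (\<integral>\<^sup>+u\<in>ball z r. ennreal (norm (F u)) \<partial>distr lborel borel ((+) z))"
    by (simp add: lborel_distr_plus)
  also have "\<dots> = (\<integral>\<^sup>+u. ennreal (norm (F (z + u))) * indicator (ball z r) (z + u) \<partial>lborel)"
    by (subst nn_integral_distr) auto
  also have "\<dots> = (\<integral>\<^sup>+u\<in>ball 0 r. ennreal (norm (F (z + u))) \<partial>lborel)"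
    by (intro nn_integral_cong) (auto simp: dist_norm split: split_indicator)
  finally show ?thesis
    using disc_submean_0[OF hol] by (cases "r \<ge> 0") (simp_all add: emeasure_ball ball_empty)
qed


lemma space_dA [simp]: "space dA = unit_disc"
  by (simp add: dA_def space_scale_measure)

lemma sets_dA [measurable_cong]: "sets dA = sets (restrict_space lebesgue unit_disc)"
  by (simp add: dA_def)

lemma sets_dA_borel: "A \<in> sets borel \<Longrightarrow> A \<subseteq> unit_disc \<Longrightarrow> A \<in> sets dA"
  by (auto simp: sets_dA sets_restrict_space_iff)

lemma emeasure_dA_borel:
  assumes "A \<in> sets borel" "A \<subseteq> unit_disc"
  shows "emeasure dA A = ennreal (1 / pi) * emeasure lborel A"
  using assms by (simp add: dA_def emeasure_restrict_space emeasure_completion)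

lemma emeasure_lborel_disc: "r \<ge> 0 \<Longrightarrow> emeasure lborel (ball (z::complex) r) = ennreal (pi * r\<^sup>2)"
  by (simp add: emeasure_ball unit_ball_vol_2)

lemma emeasure_dA_ball:
  assumes "r \<ge> 0" "ball z r \<subseteq> unit_disc"
  shows "emeasure dA (ball z r) = ennreal (r\<^sup>2)"
  using assms by (simp add: emeasure_dA_borel emeasure_lborel_disc flip: ennreal_mult')

lemma emeasure_dA_le_ball:
  assumes "A \<in> sets dA" "A \<subseteq> ball z r" "r \<ge> 0"
  shows "emeasure dA A \<le> ennreal (r\<^sup>2)"
proof -
  have "A \<subseteq> unit_disc" using sets.sets_into_space[OF assms(1)] by simp
  then have "emeasure dA A \<le> emeasure dA (ball z r \<inter> unit_disc)"
    using assms by (intro emeasure_mono sets_dA_borel) auto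
  also have "\<dots> = ennreal (1 / pi) * emeasure lborel (ball z r \<inter> unit_disc)"
    by (intro emeasure_dA_borel) auto
  also have "\<dots> \<le> ennreal (1 / pi) * emeasure lborel (ball z r)"
    by (intro mult_left_mono emeasure_mono) auto
  also have "\<dots> = ennreal (r\<^sup>2)"
    using assms(3) by (simp add: emeasure_lborel_disc flip: ennreal_mult')
  finally show ?thesis .
qed

lemma borel_measurable_dA: "f \<in> borel_measurable borel \<Longrightarrow> f \<in> borel_measurable dA"
  by (subst measurable_cong_sets[OF sets_dA refl])
     (auto intro!: measurable_restrict_space1 measurable_completion)

lemma borel_measurable_dA_continuous:
  fixes f :: "complex \<Rightarrow> 'b::real_normed_vector"
  assumes "continuous_on unit_disc f"
  shows "f \<in> borel_measurable dA"
proof -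
  have "(\<lambda>z. indicator unit_disc z *\<^sub>R f z) \<in> borel_measurable borel"
    using borel_measurable_continuous_on_indicator[OF _ assms] by simp
  then have "(\<lambda>z. indicator unit_disc z *\<^sub>R f z) \<in> borel_measurable dA"
    by (rule borel_measurable_dA)
  then show ?thesis
    by (subst measurable_cong[where g = "\<lambda>z. indicator unit_disc z *\<^sub>R f z"]) auto
qed

text \<open>
  Applied to \<open>F = g\<^sup>2\<close>, this bounds \<open>|g z|\<^sup>2\<close> by the local \<open>L\<^sup>2\<close> mass of \<open>g\<close>.
\<close>

lemma area_submean:
  assumes "F holomorphic_on unit_disc" "ball z r \<subseteq> unit_disc" "r > 0"
  shows "ennreal (norm (F z)) * ennreal (r\<^sup>2) \<le> (\<integral>\<^sup>+u\<in>ball z r. ennreal (norm (F u)) \<partial>dA)"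
proof -
  have cont: "continuous_on unit_disc F"
    using assms(1) by (rule holomorphic_on_imp_continuous_on)
  have "(\<lambda>u. indicator (ball z r) u *\<^sub>R F u) \<in> borel_measurable borel"
    using borel_measurable_continuous_on_indicator[OF _ continuous_on_subset[OF cont assms(2)]] by simp
  then have "(\<lambda>u. ennreal (norm (indicator (ball z r) u *\<^sub>R F u))) \<in> borel_measurable borel"
    by measurable
  also have "(\<lambda>u. ennreal (norm (indicator (ball z r) u *\<^sub>R F u))) = (\<lambda>u. ennreal (norm (F u)) * indicator (ball z r) u)"
    by (auto split: split_indicator)
  finally have h: "(\<lambda>u. ennreal (norm (F u)) * indicator (ball z r) u) \<in> borel_measurable borel" .
  have "ennreal (norm (F z)) * ennreal (r\<^sup>2) = ennreal (1/pi) * (ennreal (norm (F z)) * emeasure lborel (ball z r))"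
    using assms(3) by (simp add: emeasure_lborel_disc flip: ennreal_mult')
  also have "\<dots> \<le> ennreal (1/pi) * (\<integral>\<^sup>+u\<in>ball z r. ennreal (norm (F u)) \<partial>lborel)"
    by (intro mult_left_mono disc_submean holomorphic_on_subset[OF assms(1,2)]) auto
  also have "\<dots> = ennreal (1/pi) * (\<integral>\<^sup>+u\<in>ball z r. ennreal (norm (F u)) \<partial>lebesgue)"
    by (simp add: nn_integral_completion)
  also have "\<dots> = ennreal (1/pi) * (\<integral>\<^sup>+u. ennreal (norm (F u)) * indicator (ball z r) u * indicator unit_disc u \<partial>lebesgue)"
    using assms(2) by (intro arg_cong[where f = "\<lambda>x. ennreal (1/pi) * x"] nn_integral_cong) (auto split: split_indicator)
  also have "\<dots> = ennreal (1/pi) * (\<integral>\<^sup>+u\<in>ball z r. ennreal (norm (F u)) \<partial>lebesgue_on unit_disc)"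
    by (subst nn_integral_restrict_space) auto
  also have "\<dots> = (\<integral>\<^sup>+u\<in>ball z r. ennreal (norm (F u)) \<partial>dA)"
    unfolding dA_def
    by (rule nn_integral_scale_measure[symmetric])
       (intro measurable_restrict_space1 measurable_completion, use h in simp)
  finally show ?thesis .
qed

lemma indicator_dA_measurable:
  assumes "{z \<in> space dA. P z} \<in> sets dA"
  shows "(indicator {z. P z} :: complex \<Rightarrow> ennreal) \<in> borel_measurable dA"
proof -
  have "(indicator {z \<in> space dA. P z} :: complex \<Rightarrow> ennreal) \<in> borel_measurable dA"
    using assms by simp
  moreover have "(indicator {z. P z} :: complex \<Rightarrow> ennreal) z = indicator {z \<in> space dA. P z} z"
    if "z \<in> space dA" for z using that by (simp add: indicator_def)
  ultimately show ?thesis by (subst measurable_cong) auto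
qed

section \<open>Arcs and polar boxes\<close>

text \<open>
  Write \<open>a = 2\<pi> (\<alpha> + n)\<close> with \<open>0 \<le> \<alpha> < 1\<close>. The parameters of the arc fill \<open>(\<alpha>, \<alpha> + l)\<close>, and the part beyond \<open>1\<close>
  reappears at the beginning of the unit interval. End points change the parameter set by finitely many points, so
  a sandwich between the open and the closed arc treats both kinds of half-open arcs at once.
\<close>

lemma arc_preimage_sandwich:
  assumes "a < b" "b \<le> a + 2 * pi" and I: "cis ` {a<..<b} \<subseteq> I" "I \<subseteq> cis ` {a..b}"
  shows "arc_len I = (b - a) / (2 * pi)"
proof -
  define n where "n = \<lfloor>a / (2 * pi)\<rfloor>"
  define \<alpha> where "\<alpha> = a / (2 * pi) - of_int n"
  define l where "l = (b - a) / (2 * pi)"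
  have a: "a = 2 * pi * (\<alpha> + of_int n)" and b: "b = 2 * pi * (\<alpha> + of_int n + l)"
    by (simp_all add: \<alpha>_def l_def field_simps)
  have \<alpha>: "0 \<le> \<alpha>" "\<alpha> < 1" unfolding \<alpha>_def n_def by linarith+
  have l: "0 < l" "l \<le> 1" using assms(1,2) by (simp_all add: l_def field_simps)
  let ?S = "{t \<in> {0..<1}. cis (2 * pi * t) \<in> I}"
  define U where "U = (if \<alpha> + l \<le> 1 then {\<alpha><..<\<alpha> + l} else {\<alpha><..<1} \<union> {0<..<\<alpha> + l - 1})"
  have U: "U \<subseteq> ?S"
  proof
    fix t assume t: "t \<in> U"
    have 1: "cis (2 * pi * t) = cis (2 * pi * (t + of_int n))" "cis (2 * pi * t) = cis (2 * pi * (t + 1 + of_int n))"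
      by (simp_all add: distrib_left cis_mult[symmetric])
    have "2 * pi * (t + of_int n) \<in> {a<..<b} \<or> 2 * pi * (t + 1 + of_int n) \<in> {a<..<b}"
      using t l \<alpha> unfolding a b by (auto simp: U_def split: if_splits)
    then have "cis (2 * pi * t) \<in> I" using I(1) 1 by blast
    then show "t \<in> ?S" using t l \<alpha> by (auto simp: U_def split: if_splits)
  qed
  have S: "?S - U \<subseteq> {0, \<alpha>, \<alpha> + l, \<alpha> + l - 1}"
  proof
    fix t assume t: "t \<in> ?S - U"
    then obtain s where s: "s \<in> {a..b}" "cis (2 * pi * t) = cis s" using I(2) by auto
    then have "cis (2 * pi * t - s) = 1" by (simp add: cis_divide[symmetric])
    then obtain m :: int where "2 * pi * t - s = 2 * pi * of_int m"
      unfolding cis_conv_exp exp_eq_1 by auto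
    then have s': "s = 2 * pi * (t - of_int m)" by (simp add: algebra_simps)
    have "\<alpha> + of_int n \<le> t - of_int m" "t - of_int m \<le> \<alpha> + of_int n + l"
      using s(1) unfolding s' a b by simp_all
    then have 2: "\<alpha> \<le> t - of_int (m + n)" "t - of_int (m + n) \<le> \<alpha> + l" by simp_all
    have "of_int (m + n) < (1::real)" "of_int (m + n) > (-2::real)" using 2 t \<alpha> l by auto
    then have "m + n = 0 \<or> m + n = -1" by linarith
    then have "of_int (m + n) = (0::real) \<or> of_int (m + n) = (-1::real)" by auto
    then have "\<alpha> \<le> t \<and> t \<le> \<alpha> + l \<or> \<alpha> \<le> t + 1 \<and> t + 1 \<le> \<alpha> + l" using 2 by auto
    then show "t \<in> {0, \<alpha>, \<alpha> + l, \<alpha> + l - 1}"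
      using t \<alpha> l by (auto simp: U_def split: if_splits)
  qed
  have Um: "U \<in> lmeasurable" by (auto simp: U_def)
  have "measure lebesgue ?S = measure lebesgue U"
  proof (rule measure_negligible_symdiff[OF Um])
    have "U - ?S \<union> (?S - U) \<subseteq> {0, \<alpha>, \<alpha> + l, \<alpha> + l - 1}" using U S by blast
    then show "negligible (U - ?S \<union> (?S - U))"
      by (meson negligible_finite finite.intros negligible_subset)
  qed
  also have "\<dots> = l"
  proof (cases "\<alpha> + l \<le> 1")
    case True then show ?thesis using l by (simp add: U_def)
  next
    case False
    then have "measure lebesgue U = measure lebesgue {\<alpha><..<1} + measure lebesgue {0<..<\<alpha> + l - 1}"
    proof -
      have "{0<..<\<alpha> + l - 1} - {\<alpha><..<1} = {0<..<\<alpha> + l - 1}" using l by auto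
      moreover have "measure lebesgue ({\<alpha><..<1} \<union> {0<..<\<alpha> + l - 1})
          = measure lebesgue {\<alpha><..<1} + measure lebesgue ({0<..<\<alpha> + l - 1} - {\<alpha><..<1})"
        by (rule measure_Un2) auto
      ultimately show ?thesis using False by (simp add: U_def)
    qed
    then show ?thesis using False \<alpha> by simp
  qed
  finally show ?thesis by (simp add: arc_len_def l_def)
qed

lemma half_open_arcE:
  assumes "half_open_arc I"
  obtains a b where "a < b" "b \<le> a + 2 * pi" "b - a = 2 * pi * arc_len I"
    "I = cis ` {a..<b} \<or> I = cis ` {a<..b}"
proof -
  obtain a b where ab: "a < b" "b \<le> a + 2 * pi" "I = cis ` {a..<b} \<or> I = cis ` {a<..b}"
    using assms by (auto simp: half_open_arc_def)
  then have "arc_len I = (b - a) / (2 * pi)"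
    by (intro arc_preimage_sandwich) auto
  then show ?thesis using ab by (intro that[of a b]) (simp_all add: field_simps)
qed


text \<open>
  The box is the image of a half-open rectangle under polar coordinates. Such a rectangle is a
  countable union of compact rectangles, and their images are compact.
\<close>

lemma upper_half_box_borel:
  assumes "half_open_arc I"
  shows "upper_half_box I \<in> sets borel"
proof -
  obtain a b where ab: "a < b" and I: "I = cis ` {a..<b} \<or> I = cis ` {a<..b}"
    using half_open_arcE[OF assms] by metis
  define s where "s n = inverse (real (Suc n))" for n
  have s0: "s n > 0" for n by (simp add: s_def)
  have ex: "\<exists>n. x \<le> y - s n" if xy: "x < y" for x y
  proof -
    obtain n where "s n < y - x" using reals_Archimedean[of "y - x"] xy by (auto simp: s_def)
    then show ?thesis by (intro exI[of _ n]) simp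
  qed
  let ?l = "1 - arc_len I" and ?u = "1 - arc_len I / 2"
  let ?P = "\<lambda>(r, t). of_real r * cis t"
  define A where "A n = (if I = cis ` {a..<b} then {a..b - s n} else {a + s n..b})" for n
  have A: "(\<Union>n. cis ` A n) = I"
  proof (cases "I = cis ` {a..<b}")
    case True
    have "(\<Union>n. {a..b - s n}) = {a..<b}"
    proof (intro equalityI subsetI)
      fix x assume x: "x \<in> {a..<b}"
      then obtain n where "x \<le> b - s n" using ex[of x b] by auto
      then show "x \<in> (\<Union>n. {a..b - s n})" using x by auto
    next
      fix x assume "x \<in> (\<Union>n. {a..b - s n})"
      then obtain n where "a \<le> x" "x \<le> b - s n" by auto
      then show "x \<in> {a..<b}" using s0[of n] by auto
    qed
    then show ?thesis using True by (simp add: A_def flip: image_UN)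
  next
    case False
    have "(\<Union>n. {a + s n..b}) = {a<..b}"
    proof (intro equalityI subsetI)
      fix x assume x: "x \<in> {a<..b}"
      then obtain n where "a \<le> x - s n" using ex[of a x] by auto
      then have "a + s n \<le> x" by simp
      then show "x \<in> (\<Union>n. {a + s n..b})" using x by auto
    next
      fix x assume "x \<in> (\<Union>n. {a + s n..b})"
      then obtain n where "a + s n \<le> x" "x \<le> b" by auto
      then show "x \<in> {a<..b}" using s0[of n] by auto
    qed
    then show ?thesis using False I by (simp add: A_def flip: image_UN)
  qed
  have "upper_half_box I = (\<Union>m. \<Union>n. ?P ` ({?l..?u - s m} \<times> A n))"
  proof (intro equalityI subsetI)
    fix z assume "z \<in> upper_half_box I"
    then obtain r u where z: "z = of_real r * u" "u \<in> I" "?l \<le> r" "r < ?u"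
      by (auto simp: upper_half_box_def)
    then obtain n t where "u = cis t" "t \<in> A n" using A by blast
    moreover obtain m where "r \<le> ?u - s m" using ex[OF z(4)] by auto
    ultimately show "z \<in> (\<Union>m. \<Union>n. ?P ` ({?l..?u - s m} \<times> A n))"
      using z by (intro UN_I[of m] UN_I[of n] image_eqI[of _ _ "(r, t)"]) auto
  next
    fix z assume "z \<in> (\<Union>m. \<Union>n. ?P ` ({?l..?u - s m} \<times> A n))"
    then obtain m n r t where z: "z = of_real r * cis t" "?l \<le> r" "r \<le> ?u - s m" "t \<in> A n" by auto
    then have "cis t \<in> I" "r < ?u" using A s0[of m] by auto
    with z show "z \<in> upper_half_box I" by (auto simp: upper_half_box_def)
  qed
  moreover have "compact (?P ` ({?l..?u - s m} \<times> A n))" for m n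
    by (intro compact_continuous_image compact_Times)
       (auto simp: A_def case_prod_unfold intro!: continuous_intros)
  then have "?P ` ({?l..?u - s m} \<times> A n) \<in> sets borel" for m n
    by (intro borel_closed compact_imp_closed)
  ultimately show ?thesis by auto
qed

text \<open>
  The sandwich, rather than the end points, describes both kinds of half-open arcs by one formula.
\<close>

definition arc_mid :: "complex set \<Rightarrow> complex" where
  "arc_mid I = (SOME u. \<exists>m. u = cis m \<and> cis ` {m - pi * arc_len I<..<m + pi * arc_len I} \<subseteq> I \<and>
     I \<subseteq> cis ` {m - pi * arc_len I..m + pi * arc_len I})"

lemma arc_mid:
  assumes "half_open_arc I"
  obtains m where "arc_mid I = cis m" "cis ` {m - pi * arc_len I<..<m + pi * arc_len I} \<subseteq> I"
    "I \<subseteq> cis ` {m - pi * arc_len I..m + pi * arc_len I}"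
proof -
  obtain a b where ab: "b - a = 2 * pi * arc_len I" and I: "I = cis ` {a..<b} \<or> I = cis ` {a<..b}"
    using half_open_arcE[OF assms] by metis
  have "(a + b) / 2 - pi * arc_len I = a" "(a + b) / 2 + pi * arc_len I = b"
    using ab by (auto simp: field_simps)
  then have "\<exists>u m. u = cis m \<and> cis ` {m - pi * arc_len I<..<m + pi * arc_len I} \<subseteq> I \<and>
     I \<subseteq> cis ` {m - pi * arc_len I..m + pi * arc_len I}"
    using I by (intro exI[of _ "cis ((a + b) / 2)"] exI[of _ "(a + b) / 2"]) auto
  from someI_ex[OF this] show ?thesis using that unfolding arc_mid_def by blast
qed

text \<open>
  The radius lies halfway between \<open>1 - |I|\<close> and \<open>1 - |I| / 2\<close>.
\<close>

definition box_centre :: "complex set \<Rightarrow> complex" where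
  "box_centre I = of_real (1 - 3 / 4 * arc_len I) * arc_mid I"

lemma norm_cis_diff_le: "norm (cis s - cis t) \<le> \<bar>s - t\<bar>"
proof -
  have "cis s - cis t = cis t * (cis (s - t) - 1)"
    by (simp add: algebra_simps cis_mult)
  then have "norm (cis s - cis t) = 2 * \<bar>sin ((s - t) / 2)\<bar>"
    using dist_exp_i_1[of "s - t"] by (simp add: norm_mult cis_conv_exp dist_norm)
  also have "\<dots> \<le> \<bar>s - t\<bar>" using abs_sin_x_le_abs_x[of "(s - t) / 2"] by simp
  finally show ?thesis .
qed

context
  fixes I assumes I: "half_open_arc I" and len: "0 < arc_len I" "arc_len I \<le> 1"
begin

lemma norm_arc_mid: "norm (arc_mid I) = 1"
  by (rule arc_mid[OF I]) simp

lemma arc_mid_mem: "arc_mid I \<in> I"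
  using arc_mid[OF I] len by (metis (no_types, lifting) greaterThanLessThan_iff image_subset_iff
      less_add_same_cancel1 diff_less_eq mult_pos_pos pi_gt_zero)

lemma norm_box_centre: "norm (box_centre I) = 1 - 3 / 4 * arc_len I"
  using len by (simp add: box_centre_def norm_mult norm_arc_mid del: of_real_diff)

lemma box_centre_mem: "box_centre I \<in> upper_half_box I"
  unfolding upper_half_box_def box_centre_def
  using len arc_mid_mem by (intro CollectI exI[of _ "1 - 3 / 4 * arc_len I"] exI[of _ "arc_mid I"]) auto

text \<open>
  Radially the box extends at most \<open>|I| / 4\<close> from the centre, and along the circle at most \<open>\<pi> |I|\<close>.
\<close>

lemma dist_box_centre:
  assumes z: "z \<in> upper_half_box I"
  shows "dist (box_centre I) z < 5 * arc_len I"
proof -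
  obtain r u where z: "z = of_real r * u" "u \<in> I" "1 - arc_len I \<le> r" "r < 1 - arc_len I / 2"
    using z by (auto simp: upper_half_box_def)
  obtain m where m: "arc_mid I = cis m" "I \<subseteq> cis ` {m - pi * arc_len I..m + pi * arc_len I}"
    using arc_mid[OF I] by metis
  then obtain t where t: "u = cis t" "\<bar>m - t\<bar> \<le> pi * arc_len I"
    using z(2) by fastforce
  have "norm (box_centre I - z) = norm (of_real (1 - 3 / 4 * arc_len I - r) * cis m + of_real r * (cis m - cis t))"
    by (simp add: box_centre_def m z t algebra_simps)
  also have "\<dots> \<le> \<bar>1 - 3 / 4 * arc_len I - r\<bar> + \<bar>r\<bar> * norm (cis m - cis t)"
    by (rule norm_triangle_le) (simp add: norm_mult del: of_real_diff)
  also have "\<bar>r\<bar> * norm (cis m - cis t) \<le> 1 * \<bar>m - t\<bar>"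
    using z(3,4) len by (intro mult_mono norm_cis_diff_le) auto
  also have "\<bar>1 - 3 / 4 * arc_len I - r\<bar> + 1 * \<bar>m - t\<bar> \<le> arc_len I / 4 + pi * arc_len I"
    using z(3,4) t(2) by auto
  also have "\<dots> < 5 * arc_len I"
    using len pi_less_4 by (simp add: field_simps)
  finally show ?thesis by (simp add: dist_norm)
qed

text \<open>
  If \<open>|I| \<le> 1 / 2\<close>, the disc stays at distance more than \<open>9 / 16\<close> from the origin, where a displacement by
  \<open>|I| / 8\<close> changes the argument by less than \<open>\<pi> |I|\<close>. For the full circle the condition on the argument is void.
\<close>

lemma ball_box_centre:
  assumes "arc_len I = 1 \<Longrightarrow> I = unit_circle" "arc_len I \<noteq> 1 \<Longrightarrow> arc_len I \<le> 1/2"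
  shows "ball (box_centre I) (arc_len I / 8) \<subseteq> upper_half_box I"
proof
  fix z assume z: "z \<in> ball (box_centre I) (arc_len I / 8)"
  obtain m where m: "arc_mid I = cis m" "cis ` {m - pi * arc_len I<..<m + pi * arc_len I} \<subseteq> I"
    using arc_mid[OF I] by metis
  define l where "l = arc_len I"
  define v where "v = z * cis (- m)"
  have zv: "z = v * cis m" by (simp add: v_def mult.assoc cis_mult)
  have "norm (v - of_real (1 - 3 / 4 * l)) = norm ((v - of_real (1 - 3 / 4 * l)) * cis m)"
    by (simp add: norm_mult)
  also have "(v - of_real (1 - 3 / 4 * l)) * cis m = z - box_centre I"
    by (simp add: left_diff_distrib zv box_centre_def m l_def)
  finally have d: "norm (v - of_real (1 - 3 / 4 * l)) < l / 8"
    using z by (simp add: dist_norm norm_minus_commute l_def)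
  have nv: "norm v = norm z" by (simp add: zv norm_mult)
  have "\<bar>norm v - norm (of_real (1 - 3 / 4 * l) :: complex)\<bar> < l / 8"
    using norm_triangle_ineq3 d by (rule le_less_trans)
  moreover have "norm (of_real (1 - 3 / 4 * l) :: complex) = 1 - 3 / 4 * l"
    using len by (simp add: l_def del: of_real_diff)
  ultimately have nz: "1 - 7 / 8 * l < norm v" "norm v < 1 - 5 / 8 * l" by linarith+
  have v0: "norm v > 0" using nz len by (auto simp: l_def)
  have "z / of_real (norm z) \<in> I"
  proof (cases "l = 1")
    case True
    then have "I = unit_circle" using assms(1) by (simp add: l_def)
    then show ?thesis using v0 by (simp add: norm_divide nv)
  next
    case False
    then have l: "l \<le> 1/2" "0 < l" using assms(2) len by (auto simp: l_def)
    have re: "Re v > 1 - 7 / 8 * l" and im: "\<bar>Im v\<bar> < l / 8"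
      using abs_Re_le_cmod[of "v - of_real (1 - 3 / 4 * l)"] abs_Im_le_cmod[of "v - of_real (1 - 3 / 4 * l)"] d
      by auto
    have re': "Re v > 9 / 16" using re l by simp
    have "Arg v = arctan (Im v / Re v)" using re' by (intro arg_conv_arctan) auto
    then have "\<bar>Arg v\<bar> \<le> \<bar>Im v / Re v\<bar>" using abs_arctan_le[of "Im v / Re v"] by simp
    also have "\<dots> \<le> (l / 8) / (9 / 16)"
      unfolding abs_divide using re' im by (intro frac_le) auto
    also have "\<dots> < 1 * l" using l by simp
    also have "\<dots> \<le> pi * l" using l pi_gt3 by (intro mult_right_mono) auto
    finally have "m + Arg v \<in> {m - pi * l<..<m + pi * l}" by auto
    then have "cis (m + Arg v) \<in> I" using m(2) by (auto simp: l_def)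
    moreover have v: "v = of_real (norm v) * cis (Arg v)"
      by (simp add: rcis_cmod_Arg flip: rcis_def)
    then have "z = of_real (norm z) * cis (m + Arg v)"
    proof -
      have "z = of_real (norm v) * (cis (Arg v) * cis m)"
        using arg_cong[OF v, of "\<lambda>x. x * cis m"] by (simp only: zv mult.assoc)
      then show ?thesis by (simp only: nv cis_mult add.commute)
    qed
    then have "z / of_real (norm z) = cis (m + Arg v)"
      using v0 by (metis nonzero_mult_div_cancel_left nv norm_eq_zero of_real_eq_0_iff order_less_irrefl)
    ultimately show ?thesis by simp
  qed
  then show "z \<in> upper_half_box I"
    unfolding upper_half_box_def using nz nv v0 len
    by (intro CollectI exI[of _ "norm z"] exI[of _ "z / of_real (norm z)"]) (auto simp: l_def)
qed

end

section \<open>Linear programming duality on finite trees\<close>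

text \<open>
  Induction on \<open>E\<close>, treating its elements in decreasing order of \<open>h\<close>. The element \<open>I\<^sub>0\<close> with the least
  value comes last: subtract that value from \<open>h\<close>, apply the induction hypothesis to the other elements, and give \<open>I\<^sub>0\<close> the largest
  mass \<open>b\<close> that the constraints allow. Then every member of \<open>E\<close> lies below a set whose constraint is tight.
  The maximal tight sets \<open>T\<close> are pairwise disjoint as far as \<open>E\<close> is concerned and carry all of the mass, so
  adding \<open>h I\<^sub>0\<close> to \<open>l\<close> on \<open>T\<close> restores the covering condition at the cost \<open>h I\<^sub>0 * (\<Sum>I\<in>E. a I)\<close>, which is exactly
  the growth of the dual value. The tightness statement is the invariant that keeps this going.
\<close>

lemma greedy_tree_duality:
  fixes m h :: "'a set \<Rightarrow> real"
  assumes "finite E" "E \<subseteq> D"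
    and anc: "\<And>I. I \<in> D \<Longrightarrow> finite {J \<in> D. I \<subseteq> J}"
    and chain: "\<And>I J K. \<lbrakk>I \<in> D; J \<in> D; K \<in> D; I \<subseteq> J; I \<subseteq> K\<rbrakk> \<Longrightarrow> J \<subseteq> K \<or> K \<subseteq> J"
    and m: "\<And>J. J \<in> D \<Longrightarrow> 0 \<le> m J"
    and "\<And>I. I \<in> E \<Longrightarrow> 0 \<le> h I"
  shows "\<exists>a l F. (\<forall>I. 0 \<le> a I) \<and> (\<forall>J\<in>D. (\<Sum>I | I \<in> E \<and> I \<subseteq> J. a I) \<le> m J) \<and>
    (\<forall>I\<in>E. \<exists>J\<in>D. I \<subseteq> J \<and> (\<Sum>I | I \<in> E \<and> I \<subseteq> J. a I) = m J) \<and>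
    finite F \<and> F \<subseteq> D \<and> (\<forall>J. 0 \<le> l J) \<and> (\<forall>J. J \<notin> F \<longrightarrow> l J = 0) \<and>
    (\<forall>I\<in>E. h I \<le> (\<Sum>J | J \<in> F \<and> I \<subseteq> J. l J)) \<and> (\<Sum>J\<in>F. l J * m J) = (\<Sum>I\<in>E. a I * h I)"
  using assms(1,2,6)
proof (induction "card E" arbitrary: E h)
  case 0
  then have [simp]: "E = {}" by simp
  show ?case
    by (rule exI[of _ "\<lambda>_. 0"], rule exI[of _ "\<lambda>_. 0"], rule exI[of _ "{}"]) (simp add: m)
next
  case (Suc n E h)
  note fin[simp] = \<open>finite E\<close> and ED = \<open>E \<subseteq> D\<close>
  have "E \<noteq> {}" using Suc.hyps(2) by auto
  then have "Min (h ` E) \<in> h ` E" by (intro Min_in) auto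
  then obtain I0 where I0: "I0 \<in> E" "h I0 = Min (h ` E)" by auto
  have min: "h I0 \<le> h I" if "I \<in> E" for I using that I0 by simp
  define E' where "E' = E - {I0}"
  have E: "E = insert I0 E'" "I0 \<notin> E'" "finite E'" "E' \<subseteq> D" using I0 ED by (auto simp: E'_def)
  have cE': "n = card E'" using Suc.hyps(2) E by simp
  have nn: "0 \<le> h I - h I0" if "I \<in> E'" for I using min that by (simp add: E'_def)
  obtain a' l' F' where
    a': "\<And>I. 0 \<le> a' I" "\<And>J. J \<in> D \<Longrightarrow> (\<Sum>I | I \<in> E' \<and> I \<subseteq> J. a' I) \<le> m J"
      "\<And>I. I \<in> E' \<Longrightarrow> \<exists>J\<in>D. I \<subseteq> J \<and> (\<Sum>I | I \<in> E' \<and> I \<subseteq> J. a' I) = m J"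
    and l': "finite F'" "F' \<subseteq> D" "\<And>J. 0 \<le> l' J" "\<And>J. J \<notin> F' \<Longrightarrow> l' J = 0"
      "\<And>I. I \<in> E' \<Longrightarrow> h I - h I0 \<le> (\<Sum>J | J \<in> F' \<and> I \<subseteq> J. l' J)"
      "(\<Sum>J\<in>F'. l' J * m J) = (\<Sum>I\<in>E'. a' I * (h I - h I0))"
  proof -
    have ex3E: "\<And>P R. \<exists>a l F. P a l F \<Longrightarrow> (\<And>a l F. P a l F \<Longrightarrow> R) \<Longrightarrow> R" by blast
    show thesis
    proof (rule ex3E[OF Suc.hyps(1)[OF cE' E(3,4), of "\<lambda>I. h I - h I0"]], goal_cases)
      case (1 I)
      then show ?case by (rule nn)
    next
      case (2 a l F)
      then show ?case
        by (elim conjE, intro that[of a F l])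
           (assumption | erule spec | (drule (1) bspec, assumption) | (drule spec, drule (1) mp, assumption))+
    qed
  qed
  define s' where "s' J = (\<Sum>I | I \<in> E' \<and> I \<subseteq> J. a' I)" for J
  (* The largest mass at I0 that respects the constraints of all its supersets. *)
  define b where "b = Min ((\<lambda>J. m J - s' J) ` {J \<in> D. I0 \<subseteq> J})"
  have I0D: "I0 \<in> D" using I0 ED by auto
  have fin0: "finite {J \<in> D. I0 \<subseteq> J}" "{J \<in> D. I0 \<subseteq> J} \<noteq> {}" using I0D anc by auto
  have b_le: "b \<le> m J - s' J" if "J \<in> D" "I0 \<subseteq> J" for J
    unfolding b_def using that fin0 by (intro Min_le) auto
  have "b \<in> (\<lambda>J. m J - s' J) ` {J \<in> D. I0 \<subseteq> J}"
    unfolding b_def using fin0 by (intro Min_in) auto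
  then obtain J0 where J0: "J0 \<in> D" "I0 \<subseteq> J0" "b = m J0 - s' J0" by auto
  have b0: "b \<ge> 0" using J0 a'(2)[OF J0(1)] by (simp add: s'_def)
  define a where "a = a'(I0 := b)"
  define s where "s J = (\<Sum>I | I \<in> E \<and> I \<subseteq> J. a I)" for J
  have s: "s J = s' J + (if I0 \<subseteq> J then b else 0)" for J
  proof -
    have "{I \<in> E. I \<subseteq> J} = (if I0 \<subseteq> J then insert I0 {I \<in> E'. I \<subseteq> J} else {I \<in> E'. I \<subseteq> J})"
      using E by auto
    moreover have "(\<Sum>I | I \<in> E' \<and> I \<subseteq> J. a I) = s' J"
      unfolding s'_def a_def using E by (intro sum.cong) auto
    ultimately show ?thesis unfolding s_def using E by (auto simp: a_def)
  qed
  have s_le: "s J \<le> m J" if "J \<in> D" for J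
    using b_le[OF that] a'(2)[OF that] by (auto simp: s s'_def)
  have tight: "\<exists>J\<in>D. I \<subseteq> J \<and> s J = m J" if "I \<in> E" for I
  proof (cases "I = I0")
    case True then show ?thesis using J0 by (intro bexI[of _ J0]) (auto simp: s)
  next
    case False
    then obtain J where J: "J \<in> D" "I \<subseteq> J" "s' J = m J" using a'(3)[of I] \<open>I \<in> E\<close> E by (auto simp: s'_def)
    then have "s J = m J" using s_le[of J] s[of J] b0 by (auto split: if_splits)
    with J show ?thesis by blast
  qed
  (* The maximal tight sets above E. *)
  define T where "T = {J \<in> D. s J = m J \<and> (\<exists>I\<in>E. I \<subseteq> J) \<and> (\<forall>K\<in>D. J \<subseteq> K \<and> s K = m K \<longrightarrow> K = J)}"
  have finT: "finite T"
  proof (rule finite_subset)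
    show "T \<subseteq> (\<Union>I\<in>E. {J \<in> D. I \<subseteq> J})" by (auto simp: T_def)
    show "finite (\<Union>I\<in>E. {J \<in> D. I \<subseteq> J})" using ED anc by auto
  qed
  have T1: "\<exists>!J. J \<in> T \<and> I \<subseteq> J" if "I \<in> E" for I
  proof -
    let ?A = "{J \<in> D. I \<subseteq> J \<and> s J = m J}"
    have "finite ?A" using anc[of I] that ED by (auto elim!: rev_finite_subset)
    moreover have "?A \<noteq> {}" using tight[OF that] by auto
    ultimately obtain J where J: "J \<in> ?A" "\<forall>K\<in>?A. J \<subseteq> K \<longrightarrow> J = K"
      using finite_has_maximal[of ?A] by auto
    have JT: "J \<in> T"
    proof -
      have "K = J" if "K \<in> D" "J \<subseteq> K" "s K = m K" for K using J that by auto
      then show ?thesis unfolding T_def using J \<open>I \<in> E\<close> by auto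
    qed
    have uniq: "K = J" if K: "K \<in> T" "I \<subseteq> K" for K
    proof -
      have "J \<subseteq> K \<or> K \<subseteq> J" using chain[of I J K] J K \<open>I \<in> E\<close> ED by (auto simp: T_def)
      then show ?thesis using J K by (auto simp: T_def)
    qed
    have IJ: "I \<subseteq> J" using J by simp
    show ?thesis
    proof (rule ex1I)
      show "J \<in> T \<and> I \<subseteq> J" using JT IJ by (rule conjI)
      show "K = J" if "K \<in> T \<and> I \<subseteq> K" for K using uniq that by blast
    qed
  qed
  have T_sum: "(\<Sum>J\<in>T. m J) = (\<Sum>I\<in>E. a I)"
  proof -
    have "(\<Sum>J\<in>T. m J) = (\<Sum>J\<in>T. \<Sum>I | I \<in> E \<and> I \<subseteq> J. a I)"
      by (intro sum.cong) (auto simp: T_def s_def)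
    also have "\<dots> = (\<Sum>I\<in>E. \<Sum>J | J \<in> T \<and> I \<subseteq> J. a I)"
      by (rule sum.swap_restrict[OF finT fin])
    also have "\<dots> = (\<Sum>I\<in>E. a I)"
    proof (rule sum.cong[OF refl])
      fix I assume "I \<in> E"
      from T1[OF this] obtain J where "{J. J \<in> T \<and> I \<subseteq> J} = {J}" by (blast elim!: ex1E)
      then show "(\<Sum>J | J \<in> T \<and> I \<subseteq> J. a I) = a I" by simp
    qed
    finally show ?thesis .
  qed
  define l where "l J = l' J + (if J \<in> T then h I0 else 0)" for J
  have h0: "h I0 \<ge> 0" using Suc.prems(3)[OF I0(1)] .
  have l'_ext: "(\<Sum>J | J \<in> F' \<union> T \<and> I \<subseteq> J. l' J) = (\<Sum>J | J \<in> F' \<and> I \<subseteq> J. l' J)" for I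
    using l' finT by (intro sum.mono_neutral_right) auto
  have cover: "h I \<le> (\<Sum>J | J \<in> F' \<union> T \<and> I \<subseteq> J. l J)" if "I \<in> E" for I
  proof -
    from T1[OF that] obtain J where J: "{J. J \<in> T \<and> I \<subseteq> J} = {J}" by (blast elim!: ex1E)
    have "(\<Sum>J | J \<in> F' \<union> T \<and> I \<subseteq> J. if J \<in> T then h I0 else 0) = (\<Sum>J | J \<in> T \<and> I \<subseteq> J. h I0)"
      using l' finT by (intro sum.mono_neutral_cong_right) auto
    also have "\<dots> = h I0" by (simp add: J)
    finally have "(\<Sum>J | J \<in> F' \<union> T \<and> I \<subseteq> J. l J) = (\<Sum>J | J \<in> F' \<and> I \<subseteq> J. l' J) + h I0"
      by (simp add: l_def sum.distrib l'_ext del: Un_iff)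
    moreover have "h I - h I0 \<le> (\<Sum>J | J \<in> F' \<and> I \<subseteq> J. l' J)"
      using l'(5)[of I] l'(3) that E by (cases "I = I0") (auto intro: sum_nonneg)
    ultimately show ?thesis by simp
  qed
  have cost: "(\<Sum>J\<in>F' \<union> T. l J * m J) = (\<Sum>I\<in>E. a I * h I)"
  proof -
    have "(\<Sum>J\<in>F' \<union> T. l J * m J) = (\<Sum>J\<in>F' \<union> T. l' J * m J) + (\<Sum>J\<in>F' \<union> T. if J \<in> T then h I0 * m J else 0)"
      by (auto simp: l_def algebra_simps sum.distrib[symmetric] intro!: sum.cong)
    also have "(\<Sum>J\<in>F' \<union> T. l' J * m J) = (\<Sum>J\<in>F'. l' J * m J)"
      using l' finT by (intro sum.mono_neutral_right) auto
    also have "(\<Sum>J\<in>F' \<union> T. if J \<in> T then h I0 * m J else 0) = h I0 * (\<Sum>J\<in>T. m J)"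
      unfolding sum_distrib_left using l' finT by (intro sum.mono_neutral_cong_right) auto
    also have "(\<Sum>J\<in>F'. l' J * m J) = (\<Sum>I\<in>E'. a I * h I) - h I0 * (\<Sum>I\<in>E'. a I)"
      unfolding l'(6) sum_distrib_left sum_subtractf[symmetric]
      using E by (intro sum.cong) (auto simp: a_def algebra_simps)
    finally show ?thesis using E by (simp add: T_sum algebra_simps)
  qed
  show ?case
  proof (rule exI[of _ a], rule exI[of _ l], rule exI[of _ "F' \<union> T"], intro conjI)
    show "\<forall>I. 0 \<le> a I" using a' b0 by (simp add: a_def)
    show "\<forall>J\<in>D. (\<Sum>I | I \<in> E \<and> I \<subseteq> J. a I) \<le> m J" using s_le by (simp add: s_def)
    show "\<forall>I\<in>E. \<exists>J\<in>D. I \<subseteq> J \<and> (\<Sum>I | I \<in> E \<and> I \<subseteq> J. a I) = m J" using tight by (simp add: s_def)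
    show "F' \<union> T \<subseteq> D" using l' by (auto simp: T_def)
    show "\<forall>J. 0 \<le> l J" using l' h0 by (simp add: l_def)
  qed (use l' finT cover cost in \<open>auto simp: l_def\<close>)
qed

text \<open>
  The form in which the result is applied, without the invariant.
\<close>

lemma finite_tree_duality:
  fixes m h :: "'a set \<Rightarrow> real"
  assumes "finite E" "E \<subseteq> D"
    and "\<And>I. I \<in> D \<Longrightarrow> finite {J \<in> D. I \<subseteq> J}"
    and "\<And>I J K. \<lbrakk>I \<in> D; J \<in> D; K \<in> D; I \<subseteq> J; I \<subseteq> K\<rbrakk> \<Longrightarrow> J \<subseteq> K \<or> K \<subseteq> J"
    and "\<And>J. J \<in> D \<Longrightarrow> 0 \<le> m J"
    and "\<And>I. I \<in> E \<Longrightarrow> 0 \<le> h I"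
  obtains a l F where "\<forall>I. 0 \<le> a I" "\<forall>J\<in>D. (\<Sum>I | I \<in> E \<and> I \<subseteq> J. a I) \<le> m J"
    "finite F" "F \<subseteq> D" "\<forall>J. 0 \<le> l J" "\<forall>J. J \<notin> F \<longrightarrow> l J = 0"
    "\<forall>I\<in>E. h I \<le> (\<Sum>J | J \<in> F \<and> I \<subseteq> J. l J)" "(\<Sum>J\<in>F. l J * m J) = (\<Sum>I\<in>E. a I * h I)"
  by (rule exE[OF greedy_tree_duality[of E D m h]], (rule assms; assumption)+,
      elim exE conjE, rule that, assumption+)

section \<open>Trees of dyadic arcs and their boxes\<close>

text \<open>
  Comparable with \<open>(1 - |a|) + (1 - |z|)\<close> plus the angle between \<open>a\<close> and \<open>z\<close>. It behaves like a metric, except that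
  \<open>bdist a a = 1 - |a|\<^sup>2\<close> is positive.
\<close>

definition bdist :: "complex \<Rightarrow> complex \<Rightarrow> real" where
  "bdist a z = cmod (1 - cnj a * z)"

lemma bdist_commute: "bdist a z = bdist z a"
proof -
  have "1 - cnj a * z = cnj (1 - cnj z * a)" by simp
  then show ?thesis unfolding bdist_def by (metis complex_mod_cnj)
qed

lemma bdist_sq_diff: "(bdist a z)\<^sup>2 - (cmod (z - a))\<^sup>2 = (1 - (cmod a)\<^sup>2) * (1 - (cmod z)\<^sup>2)"
  unfolding bdist_def cmod_power2 by (simp add: power2_eq_square algebra_simps)

lemma dist_le_bdist:
  assumes "cmod a < 1" "cmod z < 1"
  shows "cmod (z - a) \<le> bdist a z"
proof (rule power2_le_imp_le)
  have "0 \<le> (1 - (cmod a)\<^sup>2) * (1 - (cmod z)\<^sup>2)"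
    using assms by (intro mult_nonneg_nonneg) (auto simp: power_le_one_iff)
  then show "(cmod (z - a))\<^sup>2 \<le> (bdist a z)\<^sup>2" using bdist_sq_diff[of a z] by simp
qed (simp add: bdist_def)

lemma bdist_ge:
  assumes "cmod a < 1" "cmod z < 1"
  shows "1 - cmod a \<le> bdist a z" "1 - cmod z \<le> bdist a z"
proof -
  have "1 - cmod a * cmod z \<le> bdist a z"
    unfolding bdist_def using norm_triangle_ineq2[of 1 "cnj a * z"] by (simp add: norm_mult)
  moreover have "cmod a * cmod z \<le> cmod a * 1" "cmod a * cmod z \<le> 1 * cmod z"
    using assms by (intro mult_mono; simp)+
  ultimately show "1 - cmod a \<le> bdist a z" "1 - cmod z \<le> bdist a z" by auto
qed

lemma bdist_pos: "cmod a < 1 \<Longrightarrow> cmod z < 1 \<Longrightarrow> 0 < bdist a z"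
  using bdist_ge(1)[of a z] by simp

text \<open>
  The numbers \<open>1 - cnj a w\<close> and \<open>1 - cnj a z\<close> differ by \<open>cnj a (z - w)\<close>, and \<open>|z - w| \<le> bdist w z\<close>.
\<close>

lemma bdist_triangle:
  assumes "cmod a < 1" "cmod z < 1" "cmod w < 1"
  shows "bdist a w \<le> bdist a z + bdist w z"
proof -
  have "1 - cnj a * w = (1 - cnj a * z) + cnj a * (z - w)" by (simp add: algebra_simps)
  then have "bdist a w \<le> bdist a z + cmod a * cmod (z - w)"
    unfolding bdist_def by (metis complex_mod_cnj norm_mult norm_triangle_ineq)
  also have "cmod a * cmod (z - w) \<le> 1 * bdist w z"
    using assms by (intro mult_mono dist_le_bdist) auto
  finally show ?thesis by simp
qed

lemma bdist_le_dist:
  assumes "cmod a < 1"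
  shows "bdist a z \<le> 2 * (1 - cmod a) + cmod (z - a)"
proof -
  have "1 - cnj a * z = of_real (1 - (cmod a)\<^sup>2) - cnj a * (z - a)"
    by (simp add: algebra_simps complex_norm_square flip: of_real_power)
  then have "bdist a z \<le> cmod (of_real (1 - (cmod a)\<^sup>2)) + cmod a * cmod (z - a)"
    unfolding bdist_def by (metis complex_mod_cnj norm_mult norm_triangle_ineq4)
  also have "cmod (of_real (1 - (cmod a)\<^sup>2)) = (1 - cmod a) * (1 + cmod a)"
  proof -
    have "(cmod a)\<^sup>2 \<le> 1" using assms by (simp add: power_le_one)
    then have "cmod (of_real (1 - (cmod a)\<^sup>2)) = 1 - (cmod a)\<^sup>2" by (simp del: of_real_diff)
    then show ?thesis by (simp add: power2_eq_square algebra_simps)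
  qed
  also have "\<dots> \<le> (1 - cmod a) * 2" using assms by (intro mult_left_mono) auto
  also have "cmod a * cmod (z - a) \<le> 1 * cmod (z - a)" using assms by (intro mult_right_mono) auto
  finally show ?thesis by simp
qed

locale whitney_tree =
  fixes D :: "complex set set" and G :: "nat \<Rightarrow> complex set set"
  assumes D_eq: "D = (\<Union>k. G k)" and G_0: "G 0 = {unit_circle}"
    and part: "\<And>k. partition_on unit_circle (G k)"
    and card_G: "\<And>k. card (G k) = 2 ^ k"
    and arc_G: "\<And>k I. I \<in> G k \<Longrightarrow> half_open_arc I"
    and len_G: "\<And>k I. I \<in> G k \<Longrightarrow> arc_len I = 1 / 2 ^ k"
    and nested: "\<And>k I. I \<in> G (Suc k) \<Longrightarrow> \<exists>J\<in>G k. I \<subseteq> J"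

lemma dyadic_system_whitney_tree:
  assumes "dyadic_system D"
  obtains G where "whitney_tree D G"
proof -
  obtain G where "D = (\<Union>k. G k)" "G 0 = {unit_circle}" and
    G: "\<forall>k. partition_on unit_circle (G k) \<and> card (G k) = 2 ^ k \<and>
        (\<forall>I\<in>G k. half_open_arc I \<and> arc_len I = 1 / 2 ^ k) \<and> (\<forall>I\<in>G (Suc k). \<exists>J\<in>G k. I \<subseteq> J)"
    using assms unfolding dyadic_system_def by (elim exE conjE)
  then have "whitney_tree D G"
    by (intro whitney_tree.intro) (simp_all only: G[rule_format] simp_thms)
  then show thesis by (rule that)
qed

context whitney_tree
begin

lemma D_levelE: assumes "I \<in> D" obtains k where "I \<in> G k"
proof -
  have "I \<in> (\<Union>k. G k)" using assms by (simp only: D_eq[symmetric])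
  then show thesis using that by blast
qed

lemma G_subset_D: "G k \<subseteq> D" by (auto simp: D_eq)

lemma finite_G: "finite (G k)"
  using card_G[of k] by (intro card_ge_0_finite) simp

lemma countable_D: "countable D"
  unfolding D_eq by (rule countable_UN) (auto intro: countable_finite finite_G)

lemma half_open_arc_D: "I \<in> D \<Longrightarrow> half_open_arc I"
  using arc_G by (auto simp: D_eq)

lemma len_pos: "I \<in> D \<Longrightarrow> 0 < arc_len I"
  using len_G by (auto simp: D_eq)

lemma len_le_1: "I \<in> D \<Longrightarrow> arc_len I \<le> 1"
  using len_G by (auto simp: D_eq)

lemma len_dichotomy: "I \<in> D \<Longrightarrow> I = unit_circle \<and> arc_len I = 1 \<or> arc_len I \<le> 1 / 2"
proof -
  assume "I \<in> D"
  then obtain k where k: "I \<in> G k" by (rule D_levelE)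
  show ?thesis
  proof (cases k)
    case 0 then show ?thesis using k len_G[OF k] G_0 by simp
  next
    case (Suc n)
    have "arc_len I = 1 / 2 ^ n / 2" using len_G[OF k] Suc by simp
    moreover have "(1::real) / 2 ^ n \<le> 1" by simp
    then have "(1::real) / 2 ^ n / 2 \<le> 1 / 2" by (rule divide_right_mono) simp
    ultimately show ?thesis by simp
  qed
qed

lemma circle_in_D: "unit_circle \<in> D"
  using G_0 by (auto simp: D_eq intro!: exI[of _ 0])

lemma len_circle: "arc_len unit_circle = 1"
  using len_G[of unit_circle 0] G_0 by simp

lemma nonempty: "I \<in> D \<Longrightarrow> I \<noteq> {}"
  using partition_onD3[OF part] by (auto simp: D_eq)

lemma subset_circle: "I \<in> D \<Longrightarrow> I \<subseteq> unit_circle"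
  using partition_onD1[OF part] by (auto simp: D_eq)

lemma G_disjoint: "I \<in> G k \<Longrightarrow> J \<in> G k \<Longrightarrow> x \<in> I \<Longrightarrow> x \<in> J \<Longrightarrow> I = J"
  using partition_onD2[OF part[of k]] by (auto simp: disjoint_def)

lemma ancestor: "I \<in> G k \<Longrightarrow> j \<le> k \<Longrightarrow> \<exists>J\<in>G j. I \<subseteq> J"
proof (induction k arbitrary: I)
  case (Suc k)
  show ?case
  proof (cases "j = Suc k")
    case False
    obtain I' where I': "I' \<in> G k" "I \<subseteq> I'" using nested[OF Suc.prems(1)] by auto
    with Suc.IH[OF I'(1)] Suc.prems False show ?thesis by (meson le_SucE order_trans)
  qed (use Suc.prems in auto)
qed auto

lemma subset_level:
  assumes "I \<in> G k" "J \<in> G j" "I \<subseteq> J"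
  shows "j \<le> k"
proof (rule ccontr)
  assume "\<not> j \<le> k"
  then obtain K where K: "K \<in> G k" "J \<subseteq> K" using ancestor[OF assms(2), of k] by auto
  obtain x where "x \<in> I" using nonempty[of I] assms(1) G_subset_D by auto
  then have "K = I" using G_disjoint[OF K(1) assms(1)] assms(3) K(2) by auto
  then have "J = I" using K assms by auto
  then have "(1::real) / 2 ^ j = 1 / 2 ^ k" using len_G[OF assms(1)] len_G[OF assms(2)] by simp
  then have "(2::real) ^ j = 2 ^ k" by (simp add: field_simps)
  with \<open>\<not> j \<le> k\<close> show False by simp
qed

lemma chain:
  assumes "I \<in> D" "J \<in> D" "K \<in> D" "I \<subseteq> J" "I \<subseteq> K"
  shows "J \<subseteq> K \<or> K \<subseteq> J"
proof -
  obtain x where x: "x \<in> I" using nonempty assms(1) by auto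
  have *: "K \<subseteq> J" if "J \<in> G j" "K \<in> G k" "j \<le> k" "x \<in> J" "x \<in> K" for J K j k
    using ancestor[OF that(2,3)] G_disjoint[OF that(1) _ that(4)] that(5) by blast
  obtain j k where "J \<in> G j" "K \<in> G k" using assms(2,3) by (meson D_levelE)
  then show ?thesis using *[of J j K k] *[of K k J j] x assms(4,5) by (meson nle_le subsetD)
qed

lemma finite_ancestors: "I \<in> D \<Longrightarrow> finite {J \<in> D. I \<subseteq> J}"
proof -
  assume "I \<in> D"
  then obtain k where k: "I \<in> G k" by (rule D_levelE)
  have "{J \<in> D. I \<subseteq> J} \<subseteq> (\<Union>j\<le>k. G j)" using subset_level[OF k] by (auto simp: D_eq)
  then show ?thesis by (rule finite_subset) (simp add: finite_G)
qed

lemma box_norm: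
  assumes "I \<in> D" "z \<in> upper_half_box I"
  shows "1 - arc_len I \<le> cmod z" "cmod z < 1 - arc_len I / 2"
proof -
  obtain r u where z: "z = of_real r * u" "u \<in> I" "1 - arc_len I \<le> r" "r < 1 - arc_len I / 2"
    using assms(2) by (auto simp: upper_half_box_def)
  have "cmod z = r" using z subset_circle[OF assms(1)] len_le_1[OF assms(1)] by (auto simp: norm_mult)
  then show "1 - arc_len I \<le> cmod z" "cmod z < 1 - arc_len I / 2" using z by auto
qed

lemma box_subset_disc: "I \<in> D \<Longrightarrow> upper_half_box I \<subseteq> unit_disc"
  using box_norm(2) len_pos by fastforce

lemma box_level_unique:
  assumes "I \<in> G i" "J \<in> G j" "z \<in> upper_half_box I" "z \<in> upper_half_box J"
  shows "i \<le> j"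
proof (rule ccontr)
  assume "\<not> i \<le> j"
  then have "(2::real) ^ Suc j \<le> 2 ^ i" by (intro power_increasing) auto
  then have "(1::real) / 2 ^ i \<le> 1 / 2 ^ j / 2" by (simp add: field_simps)
  moreover have "1 - 1 / 2 ^ i \<le> cmod z" "cmod z < 1 - 1 / 2 ^ j / 2"
    using box_norm[of I z] box_norm[of J z] assms len_G[OF assms(1)] len_G[OF assms(2)] G_subset_D by auto
  ultimately show False by linarith
qed

text \<open>
  The modulus of \<open>z\<close> determines the level, and then its argument determines the arc; the origin lies
  only in the box of the full circle.
\<close>

lemma boxes_disjoint:
  assumes "I \<in> D" "J \<in> D" "z \<in> upper_half_box I" "z \<in> upper_half_box J"
  shows "I = J"
proof -
  obtain i j where ij: "I \<in> G i" "J \<in> G j" using assms by (meson D_levelE)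
  then have "i = j" using box_level_unique[OF ij assms(3,4)] box_level_unique[OF ij(2,1) assms(4,3)] by simp
  show ?thesis
  proof (cases "cmod z = 0")
    case True
    then have "arc_len I = 1" "arc_len J = 1" using box_norm(1)[OF assms(1,3)] box_norm(1)[OF assms(2,4)]
        len_le_1[OF assms(1)] len_le_1[OF assms(2)] by auto
    then show ?thesis using len_dichotomy[OF assms(1)] len_dichotomy[OF assms(2)] by auto
  next
    case False
    have *: "z / of_real (cmod z) \<in> K" if K: "K \<in> D" "z \<in> upper_half_box K" for K
    proof -
      obtain r u where z: "z = of_real r * u" "u \<in> K" "1 - arc_len K \<le> r"
        using K(2) by (auto simp: upper_half_box_def)
      have "cmod z = r" using z subset_circle[OF K(1)] len_le_1[OF K(1)] by (auto simp: norm_mult)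
      then show ?thesis using z False by auto
    qed
    then show ?thesis using G_disjoint[OF ij(1)] ij(2) assms \<open>i = j\<close> by blast
  qed
qed

lemma boxes_cover:
  assumes "cmod z < 1"
  shows "\<exists>I\<in>D. z \<in> upper_half_box I"
proof -
  have "\<exists>k. (1/2) ^ k < 1 - cmod z" using assms by (intro real_arch_pow_inv) auto
  then obtain k0 where "(1/2::real) ^ k0 < 1 - cmod z" ..
  moreover have "(1/2::real) ^ Suc k0 \<le> (1/2) ^ k0" by simp
  ultimately have k0: "(1/2::real) ^ Suc k0 < 1 - cmod z" by linarith
  define k where "k = (LEAST k. (1/2::real) ^ Suc k < 1 - cmod z)"
  have k: "(1/2::real) ^ Suc k < 1 - cmod z" unfolding k_def by (rule LeastI[of _ k0]) (rule k0)
  have k': "1 - cmod z \<le> (1/2) ^ k"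
  proof (cases k)
    case (Suc n)
    then have "\<not> (1/2::real) ^ Suc n < 1 - cmod z" unfolding k_def by (intro not_less_Least) simp
    then show ?thesis using Suc by simp
  qed simp
  define u where "u = (if z = 0 then 1 else z / of_real (cmod z))"
  have "u \<in> unit_circle" by (auto simp: u_def norm_divide)
  then obtain I where I: "I \<in> G k" "u \<in> I" using partition_onD1[OF part[of k]] by auto
  have "z = of_real (cmod z) * u" by (auto simp: u_def)
  then have "z \<in> upper_half_box I"
    unfolding upper_half_box_def using I k k' len_G[OF I(1)]
    by (intro CollectI exI[of _ "cmod z"] exI[of _ u]) (auto simp: power_divide)
  then show ?thesis using I G_subset_D by auto
qed

abbreviation w where "w \<equiv> box_centre"

lemma norm_w: "I \<in> D \<Longrightarrow> cmod (w I) = 1 - 3 / 4 * arc_len I"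
  by (intro norm_box_centre half_open_arc_D len_pos len_le_1)

lemma norm_w_less_1: "I \<in> D \<Longrightarrow> cmod (w I) < 1"
  using norm_w len_pos by fastforce

lemma w_in_box: "I \<in> D \<Longrightarrow> w I \<in> upper_half_box I"
  by (intro box_centre_mem half_open_arc_D len_pos len_le_1)

lemma ball_w: "I \<in> D \<Longrightarrow> ball (w I) (arc_len I / 8) \<subseteq> upper_half_box I"
  using len_dichotomy[of I] by (intro ball_box_centre half_open_arc_D len_pos len_le_1) auto

lemma box_near_w: "I \<in> D \<Longrightarrow> z \<in> upper_half_box I \<Longrightarrow> cmod (z - w I) < 5 * arc_len I"
  using dist_box_centre[OF half_open_arc_D len_pos len_le_1, of I z] by (simp add: dist_norm norm_minus_commute)

text \<open>
  Move \<open>z\<close> radially into the box of \<open>J\<close>, which costs at most \<open>|J|\<close>.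
\<close>

lemma box_near_ancestor:
  assumes "I \<in> D" "J \<in> D" "I \<subseteq> J" "z \<in> upper_half_box I"
  shows "cmod (z - w J) < 6 * arc_len J"
proof -
  obtain i j where ij: "I \<in> G i" "J \<in> G j" using assms by (meson D_levelE)
  have le: "arc_len I \<le> arc_len J"
    unfolding len_G[OF ij(1)] len_G[OF ij(2)]
    using subset_level[OF ij assms(3)] by (intro divide_left_mono power_increasing) auto
  obtain r u where z: "z = of_real r * u" "u \<in> I" "1 - arc_len I \<le> r" "r < 1 - arc_len I / 2"
    using assms(4) by (auto simp: upper_half_box_def)
  have u: "cmod u = 1" using z(2) subset_circle[OF assms(1)] by auto
  let ?z = "of_real (1 - 3 / 4 * arc_len J) * u"
  have "?z \<in> upper_half_box J"
    unfolding upper_half_box_def using z assms(3) len_pos[OF assms(2)]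
    by (intro CollectI exI[of _ "1 - 3 / 4 * arc_len J"] exI[of _ u]) auto
  then have 1: "cmod (?z - w J) < 5 * arc_len J" by (rule box_near_w[OF assms(2)])
  have "cmod (z - ?z) = cmod (of_real (r - (1 - 3 / 4 * arc_len J)) * u)"
    by (simp add: z algebra_simps)
  also have "\<dots> = \<bar>r - (1 - 3 / 4 * arc_len J)\<bar>" by (simp add: norm_mult u del: of_real_diff)
  also have "\<dots> \<le> arc_len J" using z le len_pos[OF assms(1)] by (auto simp: abs_if)
  finally have 2: "cmod (z - ?z) \<le> arc_len J" .
  have "cmod (z - w J) \<le> cmod (z - ?z) + cmod (?z - w J)" by (metis diff_add_cancel add_diff_eq norm_triangle_ineq)
  with 1 2 show ?thesis by simp
qed

text \<open>
  The inner discs lie in disjoint boxes, so their areas \<open>|I|\<^sup>2 / 64\<close> add up to at most the area of the ball.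
\<close>

lemma packing:
  assumes "finite F" "F \<subseteq> D" "\<And>I. I \<in> F \<Longrightarrow> ball (w I) (arc_len I / 8) \<subseteq> ball a R" "0 \<le> R"
  shows "(\<Sum>I\<in>F. (arc_len I)\<^sup>2) \<le> 64 * R\<^sup>2"
proof -
  have disj: "disjoint_family_on (\<lambda>I. ball (w I) (arc_len I / 8)) F"
    unfolding disjoint_family_on_def using ball_w boxes_disjoint assms(2) by blast
  have sub: "ball (w I) (arc_len I / 8) \<subseteq> unit_disc" if "I \<in> F" for I
    using ball_w box_subset_disc assms(2) that by blast
  have m: "ball (w I) (arc_len I / 8) \<in> sets dA" if "I \<in> F" for I
    using sub[OF that] by (intro sets_dA_borel) auto
  have e: "emeasure dA (ball (w I) (arc_len I / 8)) = ennreal ((arc_len I / 8)\<^sup>2)" if "I \<in> F" for I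
    using sub[OF that] len_pos[of I] that assms(2) by (intro emeasure_dA_ball) auto
  have "ennreal (\<Sum>I\<in>F. (arc_len I / 8)\<^sup>2) = (\<Sum>I\<in>F. ennreal ((arc_len I / 8)\<^sup>2))"
    by (rule sum_ennreal[symmetric]) simp
  also have "\<dots> = (\<Sum>I\<in>F. emeasure dA (ball (w I) (arc_len I / 8)))"
    by (intro sum.cong refl e[symmetric])
  also have "\<dots> = emeasure dA (\<Union>I\<in>F. ball (w I) (arc_len I / 8))"
    using m disj assms(1) by (intro sum_emeasure) auto
  also have "\<dots> \<le> ennreal (R\<^sup>2)"
    using m assms by (intro emeasure_dA_le_ball[where z = a] sets.finite_UN) auto
  finally have "(\<Sum>I\<in>F. (arc_len I / 8)\<^sup>2) \<le> R\<^sup>2" by (subst (asm) ennreal_le_iff) auto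
  then show ?thesis by (simp add: power_divide flip: sum_divide_distrib)
qed

lemma len_le_bdist:
  assumes "I \<in> D" "cmod a < 1"
  shows "3 / 4 * arc_len I \<le> bdist a (w I)"
  using bdist_ge(2)[OF assms(2) norm_w_less_1[OF assms(1)]] norm_w[OF assms(1)] by simp

text \<open>
  If \<open>bdist a w\<^sub>I < R\<close>, then \<open>|I|\<close> is at most \<open>4 R / 3\<close>, so the inner disc of \<open>I\<close> lies in the ball of radius \<open>2 R\<close> about \<open>a\<close>.
\<close>

lemma sum_len_sq_near:
  assumes "finite F" "F \<subseteq> D" "cmod a < 1" "0 < R"
  shows "(\<Sum>I | I \<in> F \<and> bdist a (w I) < R. (arc_len I)\<^sup>2) \<le> 256 * R\<^sup>2"
proof -
  have "(\<Sum>I | I \<in> F \<and> bdist a (w I) < R. (arc_len I)\<^sup>2) \<le> 64 * (2 * R)\<^sup>2"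
  proof (rule packing)
    fix I assume I: "I \<in> {I \<in> F. bdist a (w I) < R}"
    then have ID: "I \<in> D" using assms(2) by auto
    have "cmod (w I - a) < R" using dist_le_bdist[OF assms(3) norm_w_less_1[OF ID]] I by simp
    moreover have "arc_len I / 8 \<le> R" using len_le_bdist[OF ID assms(3)] I assms(4) by simp
    ultimately show "ball (w I) (arc_len I / 8) \<subseteq> ball a (2 * R)"
      by (subst ball_subset_ball_iff) (auto simp: dist_norm)
  qed (use assms in auto)
  then show ?thesis by (simp add: power_mult_distrib)
qed

text \<open>
  The hypothesis only concerns dyadic arcs, while a \<open>bdist\<close>-ball may meet several of them. All arcs \<open>I\<close> that
  contribute have length at most \<open>4 R / 3\<close>, hence an ancestor of length \<open>2\<^bsup>-k\<^esup>\<close> comparable with \<open>R\<close>. By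
  \<open>packing\<close> at most \<open>4096\<close> such ancestors occur, and each contributes at most \<open>2\<^bsup>-kp\<^esup> \<le> 3 R\<^sup>p\<close>. For large \<open>R\<close> the
  full circle takes the place of these ancestors.
\<close>

lemma carleson_sum_near:
  fixes \<alpha> :: "complex set \<Rightarrow> real"
  assumes E: "finite E" "E \<subseteq> D" and \<alpha>: "\<And>I. 0 \<le> \<alpha> I"
    and carl: "\<And>J. J \<in> D \<Longrightarrow> (\<Sum>I | I \<in> E \<and> I \<subseteq> J. \<alpha> I) \<le> arc_len J powr p"
    and p: "0 < p" "p \<le> 1" and a: "cmod a < 1" and R: "0 < R"
  shows "(\<Sum>I | I \<in> E \<and> bdist a (w I) < R. \<alpha> I) \<le> 12288 * R powr p"
proof (cases "4 / 3 * R \<ge> 1")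
  case True
  have "(\<Sum>I | I \<in> E \<and> bdist a (w I) < R. \<alpha> I) \<le> (\<Sum>I | I \<in> E \<and> I \<subseteq> unit_circle. \<alpha> I)"
    using E \<alpha> subset_circle by (intro sum_mono2) auto
  also have "\<dots> \<le> 1" using carl[OF circle_in_D] by (simp add: len_circle)
  also have "1 \<le> 2 * R powr p"
  proof -
    have "(1/2) powr 1 \<le> (1/2) powr p" using p by (intro powr_mono') auto
    also have "\<dots> \<le> R powr p" using True p by (intro powr_mono2) auto
    finally show ?thesis by simp
  qed
  finally show ?thesis using powr_ge_zero[of R p] by linarith
next
  case False
  define N where "N = {I \<in> E. bdist a (w I) < R}"
  have "\<exists>k. (1/2) ^ k < 4 / 3 * R" using R by (intro real_arch_pow_inv) auto
  then obtain k0 where k0: "(1/2::real) ^ k0 < 4 / 3 * R" by auto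
  (* The finest level whose arcs are not shorter than 4 R / 3. *)
  define k where "k = (LEAST k. (1/2::real) ^ k < 4 / 3 * R) - 1"
  have "(LEAST k. (1/2::real) ^ k < 4 / 3 * R) \<noteq> 0"
    using LeastI[of "\<lambda>k. (1/2::real) ^ k < 4 / 3 * R" k0] k0 False by (metis power_0 less_imp_le)
  then have Suc_k: "(LEAST k. (1/2::real) ^ k < 4 / 3 * R) = Suc k" unfolding k_def by simp
  have k: "(1/2::real) ^ Suc k < 4 / 3 * R" using LeastI[of "\<lambda>k. (1/2::real) ^ k < 4 / 3 * R" k0] k0 Suc_k by simp
  have k': "4 / 3 * R \<le> (1/2) ^ k"
    using not_less_Least[of k "\<lambda>k. (1/2::real) ^ k < 4 / 3 * R"] Suc_k by simp
  define M where "M = {J \<in> G k. \<exists>I\<in>N. I \<subseteq> J}"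
  have finM: "finite M" unfolding M_def using finite_G by simp
  have lenM: "arc_len J = (1/2) ^ k" if "J \<in> M" for J
    using len_G that by (auto simp: M_def power_divide)
  have near: "\<exists>J\<in>M. I \<subseteq> J" if I: "I \<in> N" for I
  proof -
    have ID: "I \<in> D" using I E by (auto simp: N_def)
    then obtain i where i: "I \<in> G i" by (rule D_levelE)
    have "(1/2::real) ^ i < (1/2) ^ k"
      using len_le_bdist[OF ID a] I len_G[OF i] k' by (auto simp: N_def power_divide)
    then have "k < i" using power_decreasing[of i k "1/2::real"] by (cases "i \<le> k") auto
    then show ?thesis using ancestor[OF i, of k] I by (auto simp: M_def)
  qed
  have "(\<Sum>J\<in>M. (arc_len J)\<^sup>2) \<le> 64 * (8 * (1/2) ^ k)\<^sup>2"
  proof (rule packing)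
    fix J assume J: "J \<in> M"
    then obtain I where I: "I \<in> N" "I \<subseteq> J" and JD: "J \<in> D" using G_subset_D by (auto simp: M_def)
    have ID: "I \<in> D" using I E by (auto simp: N_def)
    have "cmod (w I - a) \<le> (1/2) ^ k"
      using dist_le_bdist[OF a norm_w_less_1[OF ID]] I k' R by (auto simp: N_def)
    moreover have "cmod (w I - w J) \<le> 6 * (1/2) ^ k"
      using box_near_ancestor[OF ID JD I(2) w_in_box[OF ID]] lenM[OF J] by simp
    moreover have "cmod (w J - a) \<le> cmod (w I - a) + cmod (w I - w J)"
      by (metis dist_norm dist_triangle3 add.commute norm_minus_commute)
    ultimately have "cmod (w J - a) \<le> 7 * (1/2) ^ k" by simp
    moreover have "(0::real) < (1/2)^k" by simp
    ultimately show "ball (w J) (arc_len J / 8) \<subseteq> ball a (8 * (1/2) ^ k)"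
      unfolding lenM[OF J] by (subst ball_subset_ball_iff) (auto simp: dist_norm norm_minus_commute)
  qed (use finM G_subset_D in \<open>auto simp: M_def\<close>)
  then have "real (card M) * ((1/2) ^ k)\<^sup>2 \<le> 4096 * ((1/2) ^ k)\<^sup>2"
    by (simp add: lenM power_mult_distrib)
  then have card: "real (card M) \<le> 4096" by (simp add: mult_le_cancel_right)
  have "sum \<alpha> N \<le> (\<Sum>J\<in>M. \<Sum>I | I \<in> E \<and> I \<subseteq> J. \<alpha> I)"
  proof -
    have "sum \<alpha> N \<le> (\<Sum>I\<in>N. \<Sum>J | J \<in> M \<and> I \<subseteq> J. \<alpha> I)"
    proof (rule sum_mono)
      fix I assume "I \<in> N"
      then obtain J where J: "J \<in> M" "I \<subseteq> J" using near by auto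
      show "\<alpha> I \<le> (\<Sum>J | J \<in> M \<and> I \<subseteq> J. \<alpha> I)"
        by (rule member_le_sum[of J _ "\<lambda>_. \<alpha> I"]) (use J finM \<alpha> in auto)
    qed
    also have "\<dots> \<le> (\<Sum>I\<in>E. \<Sum>J | J \<in> M \<and> I \<subseteq> J. \<alpha> I)"
      using E \<alpha> by (intro sum_mono2 sum_nonneg) (auto simp: N_def)
    also have "\<dots> = (\<Sum>J\<in>M. \<Sum>I | I \<in> E \<and> I \<subseteq> J. \<alpha> I)"
      by (rule sum.swap_restrict[OF E(1) finM])
    finally show ?thesis .
  qed
  also have "\<dots> \<le> (\<Sum>J\<in>M. ((1/2) ^ k) powr p)"
  proof (rule sum_mono)
    fix J assume "J \<in> M"
    then show "(\<Sum>I | I \<in> E \<and> I \<subseteq> J. \<alpha> I) \<le> ((1/2) ^ k) powr p"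
      using carl[of J] lenM G_subset_D by (auto simp: M_def)
  qed
  also have "\<dots> = real (card M) * ((1/2) ^ k) powr p" by simp
  also have "\<dots> \<le> 4096 * (3 * R powr p)"
  proof (intro mult_mono card)
    have "((1/2) ^ k) powr p \<le> (8 / 3 * R) powr p" using k p by (intro powr_mono2) auto
    also have "\<dots> = (8/3) powr p * R powr p" by (rule powr_mult)
    also have "\<dots> \<le> 3 * R powr p"
    proof (rule mult_right_mono)
      have "(8/3::real) powr p \<le> (8/3) powr 1" using p by (intro powr_mono) auto
      then show "(8/3::real) powr p \<le> 3" by simp
    qed simp
    finally show "((1/2) ^ k) powr p \<le> 3 * R powr p" .
  qed auto
  finally show ?thesis by (simp add: N_def)
qed

end

section \<open>Existence of dyadic systems\<close>

lemma cis_inj: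
  assumes "cis s = cis t" "\<bar>s - t\<bar> < 2 * pi"
  shows "s = t"
proof -
  have "cis (s - t) = 1" using assms(1) by (simp add: cis_divide[symmetric])
  then obtain m :: int where m: "s - t = 2 * pi * of_int m"
    unfolding cis_conv_exp exp_eq_1 by auto
  then have "\<bar>2 * pi * of_int m\<bar> < 2 * pi * 1" using assms(2) by simp
  then have "\<bar>of_int m :: real\<bar> < 1" by (simp add: abs_mult)
  then have "m = 0" by linarith
  then show ?thesis using m by simp
qed

definition std_arc :: "nat \<Rightarrow> nat \<Rightarrow> complex set" where
  "std_arc k j = cis ` {2 * pi * (real j / 2 ^ k)..<2 * pi * (real (Suc j) / 2 ^ k)}"

lemma half_open_arc_std: "half_open_arc (std_arc k j)"
  unfolding half_open_arc_def std_arc_def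
proof (intro exI conjI disjI1 refl)
  show "2 * pi * (real j / 2 ^ k) < 2 * pi * (real (Suc j) / 2 ^ k)"
    by (intro mult_strict_left_mono divide_strict_right_mono) auto
  have "real (Suc j) / 2 ^ k \<le> real j / 2 ^ k + 1" by (simp add: field_simps)
  then have "2 * pi * (real (Suc j) / 2 ^ k) \<le> 2 * pi * (real j / 2 ^ k + 1)" by (intro mult_left_mono) auto
  then show "2 * pi * (real (Suc j) / 2 ^ k) \<le> 2 * pi * (real j / 2 ^ k) + 2 * pi" by (simp add: algebra_simps)
qed simp

lemma arc_len_std: "arc_len (std_arc k j) = 1 / 2 ^ k"
proof -
  let ?a = "2 * pi * (real j / 2 ^ k)" and ?b = "2 * pi * (real (Suc j) / 2 ^ k)"
  have "real (Suc j) / 2 ^ k \<le> real j / 2 ^ k + 1" by (simp add: field_simps)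
  then have "?b \<le> 2 * pi * (real j / 2 ^ k + 1)" by (intro mult_left_mono) auto
  moreover have "?a < ?b"
    by (intro mult_strict_left_mono divide_strict_right_mono) auto
  ultimately have "arc_len (std_arc k j) = (?b - ?a) / (2 * pi)"
    unfolding std_arc_def by (intro arc_preimage_sandwich) (auto simp: algebra_simps)
  then show ?thesis by (simp add: field_simps)
qed

lemma cis_mem_std_arc:
  assumes "0 \<le> x" "x < 1" "j < 2 ^ k"
  shows "cis (2 * pi * x) \<in> std_arc k j \<longleftrightarrow> real j / 2 ^ k \<le> x \<and> x < real (Suc j) / 2 ^ k"
proof
  assume "cis (2 * pi * x) \<in> std_arc k j"
  then obtain t where t: "cis (2 * pi * x) = cis t" "2 * pi * (real j / 2 ^ k) \<le> t" "t < 2 * pi * (real (Suc j) / 2 ^ k)"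
    by (auto simp: std_arc_def)
  have "real (Suc j) \<le> 2 ^ k" using assms(3) by (metis Suc_leI of_nat_le_iff of_nat_numeral of_nat_power)
  then have "2 * pi * (real (Suc j) / 2 ^ k) \<le> 2 * pi * 1" by (intro mult_left_mono) (auto simp: field_simps)
  moreover have "0 \<le> 2 * pi * (real j / 2 ^ k)" by simp
  moreover have "2 * pi * x < 2 * pi * 1" using assms by (intro mult_strict_left_mono) auto
  moreover have "0 \<le> 2 * pi * x" using assms by simp
  ultimately have "\<bar>2 * pi * x - t\<bar> < 2 * pi" using t by linarith
  then have "t = 2 * pi * x" using cis_inj[OF t(1)] by simp
  then show "real j / 2 ^ k \<le> x \<and> x < real (Suc j) / 2 ^ k" using t(2,3)
    by (simp only: mult_le_cancel_left_pos[of "2 * pi"] mult_less_cancel_left_pos[of "2 * pi"] pi_gt_zero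
        zero_less_mult_iff zero_less_numeral simp_thms)
next
  assume "real j / 2 ^ k \<le> x \<and> x < real (Suc j) / 2 ^ k"
  then show "cis (2 * pi * x) \<in> std_arc k j"
    unfolding std_arc_def
    by (intro imageI) (simp only: atLeastLessThan_iff mult_le_cancel_left_pos[of "2 * pi"]
        mult_less_cancel_left_pos[of "2 * pi"] pi_gt_zero zero_less_mult_iff zero_less_numeral simp_thms)
qed

lemma circle_param: "u \<in> unit_circle \<Longrightarrow> \<exists>x. 0 \<le> x \<and> x < 1 \<and> u = cis (2 * pi * x)"
  using Arg2pi_ge_0[of u] Arg2pi_lt_2pi[of u] Arg2pi_eq[of u]
  by (intro exI[of _ "Arg2pi u / (2 * pi)"]) (auto simp: cis_conv_exp)

lemma std_arc_unique:
  assumes "0 \<le> x"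
  shows "real j / 2 ^ k \<le> x \<and> x < real (Suc j) / 2 ^ k \<longleftrightarrow> j = nat \<lfloor>x * 2 ^ k\<rfloor>"
proof -
  have "real j / 2 ^ k \<le> x \<and> x < real (Suc j) / 2 ^ k \<longleftrightarrow> of_int (int j) \<le> x * 2 ^ k \<and> x * 2 ^ k < of_int (int j) + 1"
    by (auto simp: field_simps)
  also have "\<dots> \<longleftrightarrow> \<lfloor>x * 2 ^ k\<rfloor> = int j" by (auto simp: floor_eq_iff)
  also have "\<dots> \<longleftrightarrow> j = nat \<lfloor>x * 2 ^ k\<rfloor>" using assms by auto
  finally show ?thesis .
qed

lemma std_arc_subset_circle: "std_arc k j \<subseteq> unit_circle"
  by (auto simp: std_arc_def)

lemma std_arc_nonempty: "std_arc k j \<noteq> {}"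
  by (auto simp: std_arc_def divide_less_cancel)

lemma std_arc_disjoint:
  assumes "i < 2 ^ k" "j < 2 ^ k" "u \<in> std_arc k i" "u \<in> std_arc k j"
  shows "i = j"
proof -
  obtain x where x: "0 \<le> x" "x < 1" "u = cis (2 * pi * x)" using circle_param[of u] assms(3) std_arc_subset_circle by blast
  show ?thesis
    using assms(3,4) cis_mem_std_arc[OF x(1,2) assms(1)] cis_mem_std_arc[OF x(1,2) assms(2)]
    unfolding x(3) std_arc_unique[OF x(1)] by simp
qed

text \<open>
  The supremum over all systems controls the embedding only because there is at least one system.
\<close>

theorem dyadic_system_exists: "\<exists>D. dyadic_system D"
proof -
  define G where "G k = std_arc k ` {..<2 ^ k}" for k
  have inj: "inj_on (std_arc k) {..<2 ^ k}" for k
    using std_arc_disjoint std_arc_nonempty by (intro inj_onI) (metis ex_in_conv lessThan_iff)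
  have "dyadic_system (\<Union>k. G k)"
    unfolding dyadic_system_def
  proof (intro exI[of _ G] conjI allI refl ballI)
    have "std_arc 0 0 = unit_circle"
    proof
      show "unit_circle \<subseteq> std_arc 0 0"
      proof
        fix u assume "u \<in> unit_circle"
        then obtain x where "0 \<le> x" "x < 1" "u = cis (2 * pi * x)" using circle_param by blast
        then show "u \<in> std_arc 0 0" by (simp add: cis_mem_std_arc)
      qed
    qed (rule std_arc_subset_circle)
    then show "G 0 = {unit_circle}" by (auto simp: G_def lessThan_Suc)
  next
    fix k
    show "card (G k) = 2 ^ k" unfolding G_def by (simp add: card_image[OF inj])
    show "partition_on unit_circle (G k)"
    proof (rule partition_onI)
      show "\<Union> (G k) = unit_circle"
      proof
        show "unit_circle \<subseteq> \<Union> (G k)"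
        proof
          fix u assume "u \<in> unit_circle"
          then obtain x where x: "0 \<le> x" "x < 1" "u = cis (2 * pi * x)" using circle_param by blast
          define j where "j = nat \<lfloor>x * 2 ^ k\<rfloor>"
          have j: "real j / 2 ^ k \<le> x \<and> x < real (Suc j) / 2 ^ k"
            unfolding std_arc_unique[OF x(1)] by (simp add: j_def)
          have "real j / 2 ^ k < 1" using j x(2) by linarith
          then have "j < 2 ^ k" by (simp add: field_simps)
          then show "u \<in> \<Union> (G k)" using cis_mem_std_arc[OF x(1,2), of j k] j x(3) by (auto simp: G_def)
        qed
      qed (auto simp: G_def std_arc_def)
      show "disjnt p q" if pq: "p \<in> G k" "q \<in> G k" "p \<noteq> q" for p q
      proof -
        obtain i j where ij: "p = std_arc k i" "q = std_arc k j" "i < 2 ^ k" "j < 2 ^ k" using pq by (auto simp: G_def)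
        then show ?thesis using std_arc_disjoint[OF ij(3,4)] pq(3) by (auto simp: disjnt_iff)
      qed
      show "{} \<notin> G k" using std_arc_nonempty by (auto simp: G_def dest: sym)
    qed
  next
    fix k I assume "I \<in> G k"
    then show "half_open_arc I" "arc_len I = 1 / 2 ^ k" by (auto simp: G_def half_open_arc_std arc_len_std)
  next
    fix k I assume "I \<in> G (Suc k)"
    then obtain j where j: "I = std_arc (Suc k) j" "j < 2 ^ Suc k" by (auto simp: G_def)
    have "real (2 * (j div 2)) \<le> real j" "real (Suc j) \<le> real (2 * Suc (j div 2))"
      unfolding of_nat_le_iff by presburger+
    then have half: "real (j div 2) \<le> real j / 2" "real (Suc j) / 2 \<le> real (Suc (j div 2))" by simp_all
    have "real (j div 2) / 2 ^ k \<le> real j / 2 ^ Suc k" "real (Suc j) / 2 ^ Suc k \<le> real (Suc (j div 2)) / 2 ^ k"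
      using half[THEN divide_right_mono, of "2 ^ k"] by simp_all
    then have "2 * pi * (real (j div 2) / 2 ^ k) \<le> 2 * pi * (real j / 2 ^ Suc k)"
      "2 * pi * (real (Suc j) / 2 ^ Suc k) \<le> 2 * pi * (real (Suc (j div 2)) / 2 ^ k)"
      by (intro mult_left_mono; simp)+
    then have "I \<subseteq> std_arc k (j div 2)"
      unfolding j(1) std_arc_def by (intro image_mono) (auto simp only: atLeastLessThan_iff subset_eq intro: order_trans less_le_trans)
    moreover have "j div 2 < 2 ^ k" using j(2) by auto
    ultimately show "\<exists>J\<in>G k. I \<subseteq> J" by (auto simp: G_def)
  qed
  then show ?thesis by blast
qed

section \<open>The gauge as a dual supremum\<close>

context whitney_tree
begin

text \<open>
  Weak compactness of the primal problem. Apply duality to the first \<open>n\<close> levels to get multipliers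
  \<open>l\<^sub>n\<close> of cost at most \<open>K\<close>. Each single cost \<open>l\<^sub>n(J) |J|\<^sup>p\<close> is bounded by \<open>K\<close>, so a diagonal subsequence
  converges pointwise. An arc has finitely many ancestors, hence the covering condition survives in the
  limit; the cost is controlled through its finite partial sums.
\<close>

lemma dyadic_gauge_le:
  fixes h :: "complex set \<Rightarrow> real"
  assumes h: "\<And>I. I \<in> D \<Longrightarrow> 0 \<le> h I"
    and bound: "\<And>E \<alpha>. \<lbrakk>finite E; E \<subseteq> D; \<And>I. 0 \<le> \<alpha> I;
        \<And>J. J \<in> D \<Longrightarrow> (\<Sum>I | I \<in> E \<and> I \<subseteq> J. \<alpha> I) \<le> arc_len J powr p\<rbrakk>
      \<Longrightarrow> (\<Sum>I\<in>E. \<alpha> I * h I) \<le> K"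
  shows "dyadic_gauge p D (\<lambda>I. ennreal (h I)) \<le> ennreal K"
proof -
  have m: "0 < arc_len J powr p" if "J \<in> D" for J using len_pos[OF that] by simp
  define E where "E n = (\<Union>k\<le>n. G k)" for n
  have E: "finite (E n)" "E n \<subseteq> D" for n using finite_G G_subset_D by (auto simp: E_def)
  have "\<exists>l. (\<forall>J. 0 \<le> l J) \<and> (\<forall>F. finite F \<longrightarrow> F \<subseteq> D \<longrightarrow> (\<Sum>J\<in>F. l J * arc_len J powr p) \<le> K) \<and>
      (\<forall>I\<in>E n. h I \<le> (\<Sum>J | J \<in> D \<and> I \<subseteq> J. l J))" for n
  proof -
    obtain a l F where al: "\<forall>I. 0 \<le> a I" "\<forall>J\<in>D. (\<Sum>I | I \<in> E n \<and> I \<subseteq> J. a I) \<le> arc_len J powr p"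
      and F: "finite F" "F \<subseteq> D" and l: "\<forall>J. 0 \<le> l J" "\<forall>J. J \<notin> F \<longrightarrow> l J = 0"
      "\<forall>I\<in>E n. h I \<le> (\<Sum>J | J \<in> F \<and> I \<subseteq> J. l J)"
      "(\<Sum>J\<in>F. l J * arc_len J powr p) = (\<Sum>I\<in>E n. a I * h I)"
    proof (rule finite_tree_duality[of "E n" D "\<lambda>J. arc_len J powr p" h])
      show "J \<subseteq> K \<or> K \<subseteq> J" if "I \<in> D" "J \<in> D" "K \<in> D" "I \<subseteq> J" "I \<subseteq> K" for I J K
        using that by (rule chain)
      show "0 \<le> h I" if "I \<in> E n" for I using h E(2)[of n] that by auto
    qed (use E finite_ancestors in auto)
    have K: "(\<Sum>I\<in>E n. a I * h I) \<le> K" using al by (intro bound E) auto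
    show ?thesis
    proof (intro exI[of _ l] conjI allI impI ballI)
      fix F' assume F': "finite F'" "F' \<subseteq> D"
      have "(\<Sum>J\<in>F'. l J * arc_len J powr p) \<le> (\<Sum>J\<in>F' \<union> F. l J * arc_len J powr p)"
        using F' F l(1) by (intro sum_mono2) auto
      also have "\<dots> = (\<Sum>J\<in>F. l J * arc_len J powr p)"
        using F' F l(2) by (intro sum.mono_neutral_right) auto
      finally show "(\<Sum>J\<in>F'. l J * arc_len J powr p) \<le> K" using l(4) K by simp
    next
      fix I assume I: "I \<in> E n"
      then have "h I \<le> (\<Sum>J | J \<in> F \<and> I \<subseteq> J. l J)" using l(3) by blast
      also have "\<dots> \<le> (\<Sum>J | J \<in> D \<and> I \<subseteq> J. l J)"
        using F l(1) finite_ancestors[of I] I E(2) by (intro sum_mono2) auto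
      finally show "h I \<le> (\<Sum>J | J \<in> D \<and> I \<subseteq> J. l J)" .
    qed (use l in auto)
  qed
  from choice[OF allI[OF this]] obtain l where l: "\<forall>n. (\<forall>J. 0 \<le> l n J) \<and>
      (\<forall>F. finite F \<longrightarrow> F \<subseteq> D \<longrightarrow> (\<Sum>J\<in>F. l n J * arc_len J powr p) \<le> K) \<and>
      (\<forall>I\<in>E n. h I \<le> (\<Sum>J | J \<in> D \<and> I \<subseteq> J. l n J))" ..
  have l0: "0 \<le> l n J" for n J using l by blast
  have lK: "(\<Sum>J\<in>F. l n J * arc_len J powr p) \<le> K" if "finite F" "F \<subseteq> D" for n F using l that by blast
  have lh: "h I \<le> (\<Sum>J | J \<in> D \<and> I \<subseteq> J. l n J)" if "I \<in> E n" for n I using l that by blast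
  have "norm (l n J * arc_len J powr p) \<le> K" if "J \<in> D" for n J
    using lK[of "{J}" n] that l0[of n J] by simp
  then obtain r where r: "strict_mono (r :: nat \<Rightarrow> nat)"
    and "\<And>J. J \<in> D \<Longrightarrow> \<exists>c. (\<lambda>n. l (r n) J * arc_len J powr p) \<longlonglongrightarrow> c"
    using function_convergent_subsequence[OF countable_D, of "\<lambda>n J. l n J * arc_len J powr p" K] by metis
  then obtain c where c: "\<And>J. J \<in> D \<Longrightarrow> (\<lambda>n. l (r n) J * arc_len J powr p) \<longlonglongrightarrow> c J"
    by metis
  define L where "L J = c J / arc_len J powr p" for J
  have L: "(\<lambda>n. l (r n) J) \<longlonglongrightarrow> L J" if "J \<in> D" for J
    using tendsto_divide[OF c[OF that] tendsto_const, of "arc_len J powr p"] m[OF that] by (simp add: L_def)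
  have L0: "0 \<le> L J" if "J \<in> D" for J
    using L[OF that] by (rule LIMSEQ_le_const) (use l0 in auto)
  have cover: "h I \<le> (\<Sum>J | J \<in> D \<and> I \<subseteq> J. L J)" if I: "I \<in> D" for I
  proof (rule LIMSEQ_le_const)
    show "(\<lambda>n. \<Sum>J | J \<in> D \<and> I \<subseteq> J. l (r n) J) \<longlonglongrightarrow> (\<Sum>J | J \<in> D \<and> I \<subseteq> J. L J)"
      by (intro tendsto_sum L) auto
    obtain k where k: "I \<in> G k" using I by (rule D_levelE)
    have "I \<in> E (r n)" if "n \<ge> k" for n
      using k that strict_mono_imp_increasing[OF r, of n] by (auto simp: E_def intro: order_trans)
    then show "\<exists>N. \<forall>n\<ge>N. h I \<le> (\<Sum>J | J \<in> D \<and> I \<subseteq> J. l (r n) J)" using lh by blast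
  qed
  have cost: "(\<Sum>J\<in>F. L J * arc_len J powr p) \<le> K" if "finite F" "F \<subseteq> D" for F
  proof (rule LIMSEQ_le_const2)
    show "(\<lambda>n. \<Sum>J\<in>F. l (r n) J * arc_len J powr p) \<longlonglongrightarrow> (\<Sum>J\<in>F. L J * arc_len J powr p)"
      using that by (intro tendsto_sum tendsto_mult L tendsto_const) auto
  qed (use lK that in auto)
  have "dyadic_gauge p D (\<lambda>I. ennreal (h I)) \<le> (\<Sum>\<^sub>\<infinity>J\<in>D. ennreal (L J * arc_len J powr p))"
    unfolding dyadic_gauge_def
  proof (rule INF_lower, safe)
    fix I assume I: "I \<in> D"
    have "(\<Sum>\<^sub>\<infinity>J\<in>{J \<in> D. I \<subseteq> J}. ennreal (L J)) = (\<Sum>J | J \<in> D \<and> I \<subseteq> J. ennreal (L J))"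
      using finite_ancestors[OF I] by simp
    also have "\<dots> = ennreal (\<Sum>J | J \<in> D \<and> I \<subseteq> J. L J)" by (rule sum_ennreal) (use L0 in auto)
    finally show "ennreal (h I) \<le> (\<Sum>\<^sub>\<infinity>J\<in>{J \<in> D. I \<subseteq> J}. ennreal (L J))"
      using cover[OF I] by (simp add: ennreal_leI)
  qed (use L0 in auto)
  also have "\<dots> = (SUP F\<in>{F. finite F \<and> F \<subseteq> D}. \<Sum>J\<in>F. ennreal (L J * arc_len J powr p))"
    by (rule nonneg_infsum_complete) simp
  also have "\<dots> \<le> ennreal K"
  proof (rule SUP_least)
    fix F assume F: "F \<in> {F. finite F \<and> F \<subseteq> D}"
    have "(\<Sum>J\<in>F. ennreal (L J * arc_len J powr p)) = ennreal (\<Sum>J\<in>F. L J * arc_len J powr p)"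
      using F L0 by (intro sum_ennreal mult_nonneg_nonneg) auto
    also have "\<dots> \<le> ennreal K" using cost F by (intro ennreal_leI) auto
    finally show "(\<Sum>J\<in>F. ennreal (L J * arc_len J powr p)) \<le> ennreal K" .
  qed
  finally show ?thesis .
qed

end

section \<open>Integration over dyadic shells\<close>

text \<open>
  The value of \<open>\<Sum>\<^sub>j 2\<^sup>\<beta> 2\<^bsup>(\<beta>-\<gamma>)j\<^esup>\<close>.
\<close>

definition shell_const :: "real \<Rightarrow> real \<Rightarrow> real" where
  "shell_const \<beta> \<gamma> = 2 powr \<beta> / (1 - 2 powr (\<beta> - \<gamma>))"

lemma shell_const_nonneg: "\<beta> < \<gamma> \<Longrightarrow> 0 \<le> shell_const \<beta> \<gamma>"
  using powr_less_mono[of "\<beta> - \<gamma>" 0 2] by (simp add: shell_const_def)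

lemma shell_index:
  assumes "0 < r" "r \<le> (x::real)"
  shows "\<exists>j. 2 ^ j * r \<le> x \<and> x < 2 ^ Suc j * r"
proof -
  have "\<exists>n. x / r < 2 ^ n" by (rule real_arch_pow) simp
  then obtain n0 where n0: "x < 2 ^ n0 * r" using assms by (auto simp: field_simps)
  define n where "n = (LEAST n. x < 2 ^ n * r)"
  have n: "x < 2 ^ n * r" unfolding n_def using n0 by (rule LeastI)
  then have "n \<noteq> 0" using assms by (cases n) auto
  then obtain j where j: "n = Suc j" by (cases n) auto
  have "\<not> x < 2 ^ j * r" using not_less_Least[of j "\<lambda>n. x < 2 ^ n * r"] j by (simp add: n_def)
  then show ?thesis using n j by (intro exI[of _ j]) auto
qed

text \<open>
  Cut \<open>{d \<ge> r}\<close> into the shells \<open>2\<^sup>j r \<le> d < 2\<^bsup>j+1\<^esup> r\<close>. The growth condition bounds the \<open>j\<close>-th contribution by a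
  multiple of \<open>2\<^bsup>(\<beta>-\<gamma>)j\<^esup>\<close>, and \<open>\<beta> < \<gamma>\<close> makes the series converge.
\<close>

lemma shell_integral:
  assumes [measurable]: "d \<in> borel_measurable M" and r: "0 < r" and \<gamma>: "\<beta> < \<gamma>" "0 < \<gamma>" and A: "0 \<le> A"
    and growth: "\<And>R. r \<le> R \<Longrightarrow> emeasure M {x \<in> space M. d x < R} \<le> ennreal (A * R powr \<beta>)"
  shows "(\<integral>\<^sup>+x. ennreal (d x powr - \<gamma>) * indicator {x. r \<le> d x} x \<partial>M)
    \<le> ennreal (A * shell_const \<beta> \<gamma> * r powr (\<beta> - \<gamma>))"
proof -
  define S where "S j = {x \<in> space M. d x < 2 ^ Suc j * r}" for j :: nat
  have [measurable]: "S j \<in> sets M" for j unfolding S_def by measurable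
  define c where "c j = (2 ^ j * r) powr - \<gamma>" for j :: nat
  have "(\<integral>\<^sup>+x. ennreal (d x powr - \<gamma>) * indicator {x. r \<le> d x} x \<partial>M)
      \<le> (\<integral>\<^sup>+x. (\<Sum>j. ennreal (c j) * indicator (S j) x) \<partial>M)"
  proof (rule nn_integral_mono)
    fix x assume x: "x \<in> space M"
    show "ennreal (d x powr - \<gamma>) * indicator {x. r \<le> d x} x \<le> (\<Sum>j. ennreal (c j) * indicator (S j) x)"
    proof (cases "r \<le> d x")
      case True
      then obtain j where j: "2 ^ j * r \<le> d x" "d x < 2 ^ Suc j * r" using shell_index[OF r] by blast
      have "d x powr - \<gamma> \<le> c j" unfolding c_def using j r \<gamma> by (intro powr_mono2') auto
      then have "ennreal (d x powr - \<gamma>) * indicator {x. r \<le> d x} x \<le> ennreal (c j) * indicator (S j) x"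
        using True j x by (auto simp: S_def intro: ennreal_leI)
      also have "\<dots> \<le> (\<Sum>j. ennreal (c j) * indicator (S j) x)"
      proof -
        have "t j \<le> (\<Sum>j. t j)" for t :: "nat \<Rightarrow> ennreal" using sum_le_suminf[of t "{j}"] by simp
        then show ?thesis .
      qed
      finally show ?thesis .
    qed simp
  qed
  also have "\<dots> = (\<Sum>j. ennreal (c j) * emeasure M (S j))"
    by (subst nn_integral_suminf) (auto simp: nn_integral_cmult_indicator)
  also have "\<dots> \<le> (\<Sum>j. ennreal (A * 2 powr \<beta> * r powr (\<beta> - \<gamma>) * (2 powr (\<beta> - \<gamma>)) ^ j))"
  proof (intro suminf_le allI)
    fix j :: nat
    have "(1::real) \<le> 2 ^ Suc j" by (rule one_le_power) simp
    then have "1 * r \<le> 2 ^ Suc j * r" using r by (intro mult_right_mono) auto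
    then have "ennreal (c j) * emeasure M (S j) \<le> ennreal (c j) * ennreal (A * (2 ^ Suc j * r) powr \<beta>)"
      unfolding S_def by (intro mult_left_mono growth) auto
    also have "\<dots> = ennreal (c j * (A * (2 ^ Suc j * r) powr \<beta>))"
      by (simp add: c_def flip: ennreal_mult')
    also have "c j * (A * (2 ^ Suc j * r) powr \<beta>) = A * 2 powr \<beta> * r powr (\<beta> - \<gamma>) * (2 powr (\<beta> - \<gamma>)) ^ j"
    proof -
      have p: "(2 ^ n * r) powr e = (2 powr e) ^ n * r powr e" for n and e :: real
        using r by (simp add: powr_mult powr_power) (simp add: powr_realpow[symmetric] powr_powr mult.commute)
      have "c j * (A * (2 ^ Suc j * r) powr \<beta>) = A * 2 powr \<beta> * (r powr - \<gamma> * r powr \<beta>) * ((2 powr - \<gamma>) * (2 powr \<beta>)) ^ j"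
        unfolding c_def p by (simp add: power_mult_distrib mult_ac)
      also have "\<dots> = A * 2 powr \<beta> * r powr (\<beta> - \<gamma>) * (2 powr (\<beta> - \<gamma>)) ^ j"
        by (simp add: powr_add[symmetric] add.commute)
      finally show ?thesis .
    qed
    finally show "ennreal (c j) * emeasure M (S j) \<le> ennreal (A * 2 powr \<beta> * r powr (\<beta> - \<gamma>) * (2 powr (\<beta> - \<gamma>)) ^ j)" .
  qed auto
  also have "\<dots> = ennreal (A * 2 powr \<beta> * r powr (\<beta> - \<gamma>) * (1 / (1 - 2 powr (\<beta> - \<gamma>))))"
  proof (rule suminf_ennreal_eq)
    have "2 powr (\<beta> - \<gamma>) < 1" using powr_less_mono[of "\<beta> - \<gamma>" 0 2] \<gamma> by simp
    then show "(\<lambda>j. A * 2 powr \<beta> * r powr (\<beta> - \<gamma>) * (2 powr (\<beta> - \<gamma>)) ^ j) sums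
        (A * 2 powr \<beta> * r powr (\<beta> - \<gamma>) * (1 / (1 - 2 powr (\<beta> - \<gamma>))))"
      by (intro sums_mult geometric_sums) auto
  qed (use A in auto)
  also have "A * 2 powr \<beta> * r powr (\<beta> - \<gamma>) * (1 / (1 - 2 powr (\<beta> - \<gamma>))) = A * shell_const \<beta> \<gamma> * r powr (\<beta> - \<gamma>)"
    by (simp add: shell_const_def)
  finally show ?thesis .
qed

lemma shell_sum:
  fixes v d :: "'a \<Rightarrow> real"
  assumes F: "finite F" and v: "\<And>i. i \<in> F \<Longrightarrow> 0 \<le> v i" and r: "0 < r" and \<gamma>: "\<beta> < \<gamma>" "0 < \<gamma>" and A: "0 \<le> A"
    and growth: "\<And>R. r \<le> R \<Longrightarrow> (\<Sum>i | i \<in> F \<and> d i < R. v i) \<le> A * R powr \<beta>"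
  shows "(\<Sum>i | i \<in> F \<and> r \<le> d i. v i * d i powr - \<gamma>) \<le> A * shell_const \<beta> \<gamma> * r powr (\<beta> - \<gamma>)"
proof -
  let ?M = "point_measure F (\<lambda>i. ennreal (v i))"
  have "ennreal (\<Sum>i | i \<in> F \<and> r \<le> d i. v i * d i powr - \<gamma>)
      = (\<Sum>i | i \<in> F \<and> r \<le> d i. ennreal (v i * d i powr - \<gamma>))"
    using v by (intro sum_ennreal[symmetric]) auto
  also have "\<dots> = (\<Sum>i\<in>F. ennreal (v i) * (ennreal (d i powr - \<gamma>) * indicator {i. r \<le> d i} i))"
    using F v by (intro sum.mono_neutral_cong_left) (auto simp: ennreal_mult)
  also have "\<dots> = (\<integral>\<^sup>+i. ennreal (d i powr - \<gamma>) * indicator {i. r \<le> d i} i \<partial>?M)"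
    using F by (simp add: nn_integral_point_measure_finite)
  also have "\<dots> \<le> ennreal (A * shell_const \<beta> \<gamma> * r powr (\<beta> - \<gamma>))"
  proof (rule shell_integral[OF _ r \<gamma> A])
    fix R assume R: "r \<le> R"
    have "emeasure ?M {x \<in> space ?M. d x < R} = (\<Sum>i | i \<in> F \<and> d i < R. ennreal (v i))"
      using F by (simp add: space_point_measure emeasure_point_measure_finite)
    also have "\<dots> = ennreal (\<Sum>i | i \<in> F \<and> d i < R. v i)" using v by (intro sum_ennreal) auto
    finally show "emeasure ?M {x \<in> space ?M. d x < R} \<le> ennreal (A * R powr \<beta>)"
      using growth[OF R] by (simp add: ennreal_leI)
  qed simp
  finally show ?thesis
    by (subst (asm) ennreal_le_iff) (auto simp: A shell_const_nonneg \<gamma>)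
qed

lemma bdist_measurable [measurable]: "bdist a \<in> borel_measurable dA"
  unfolding bdist_def[abs_def] by (intro borel_measurable_dA borel_measurable_continuous_onI continuous_intros)

lemma cmod_measurable_dA [measurable]: "cmod \<in> borel_measurable dA"
  by (intro borel_measurable_dA borel_measurable_continuous_onI continuous_intros)

lemma sets_bdist_ball [simp]: "{z. cmod z < 1 \<and> bdist a z < R} \<in> sets dA"
proof -
  have "{z \<in> space dA. bdist a z < R} \<in> sets dA" by measurable
  then show ?thesis by simp
qed

lemma emeasure_bdist_ball:
  assumes "cmod a < 1" "0 \<le> R"
  shows "emeasure dA {z \<in> space dA. bdist a z < R} \<le> ennreal (R\<^sup>2)"
proof (rule emeasure_dA_le_ball[where z = a])
  show "{z \<in> space dA. bdist a z < R} \<subseteq> ball a R"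
    using dist_le_bdist[OF assms(1)] by (fastforce simp: dist_norm norm_minus_commute)
qed (use assms in auto)

lemma bdist_ball_weight:
  assumes "cmod a < 1" "0 < R" "0 \<le> q"
  shows "(\<integral>\<^sup>+z. ennreal ((1 - cmod z) powr q) * indicator {z. bdist a z < R} z \<partial>dA) \<le> ennreal (R powr (q + 2))"
proof -
  have "(\<integral>\<^sup>+z. ennreal ((1 - cmod z) powr q) * indicator {z. bdist a z < R} z \<partial>dA)
      \<le> (\<integral>\<^sup>+z. ennreal (R powr q) * indicator {z \<in> space dA. bdist a z < R} z \<partial>dA)"
  proof (rule nn_integral_mono)
    fix z assume z: "z \<in> space dA"
    then have "1 - cmod z \<le> bdist a z" using bdist_ge(2)[OF assms(1), of z] by simp
    then show "ennreal ((1 - cmod z) powr q) * indicator {z. bdist a z < R} z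
        \<le> ennreal (R powr q) * indicator {z \<in> space dA. bdist a z < R} z"
      using z assms by (auto split: split_indicator intro!: ennreal_leI powr_mono2)
  qed
  also have "\<dots> = ennreal (R powr q) * emeasure dA {z \<in> space dA. bdist a z < R}"
    by (rule nn_integral_cmult_indicator) measurable
  also have "\<dots> \<le> ennreal (R powr q) * ennreal (R\<^sup>2)"
    using assms by (intro mult_left_mono emeasure_bdist_ball) auto
  also have "\<dots> = ennreal (R powr (q + 2))"
    using assms by (simp add: powr_add flip: ennreal_mult')
  finally show ?thesis .
qed

text \<open>
  The weight gives a \<open>bdist\<close>-ball of radius \<open>R\<close> mass at most \<open>R\<^bsup>q+2\<^esup>\<close>, and \<open>q + 2 < 3\<close>.
\<close>

lemma kernel_weight_integral:
  assumes "cmod a < 1" "0 \<le> q" "q < 1"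
  shows "(\<integral>\<^sup>+z. ennreal ((1 - cmod z) powr q * bdist a z powr - 3) \<partial>dA)
    \<le> ennreal (shell_const (q + 2) 3 * (1 - cmod a) powr (q - 1))"
proof -
  let ?f = "\<lambda>z. ennreal ((1 - cmod z) powr q)"
  have "(\<integral>\<^sup>+z. ennreal ((1 - cmod z) powr q * bdist a z powr - 3) \<partial>dA)
      = (\<integral>\<^sup>+z. ?f z * (ennreal (bdist a z powr - 3) * indicator {z. 1 - cmod a \<le> bdist a z} z) \<partial>dA)"
    using bdist_ge(1)[OF assms(1)] by (intro nn_integral_cong) (auto simp: ennreal_mult)
  also have "\<dots> = (\<integral>\<^sup>+z. ennreal (bdist a z powr - 3) * indicator {z. 1 - cmod a \<le> bdist a z} z \<partial>density dA ?f)"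
    by (subst nn_integral_density) auto
  also have "\<dots> \<le> ennreal (1 * shell_const (q + 2) 3 * (1 - cmod a) powr (q + 2 - 3))"
  proof (rule shell_integral)
    fix R assume R: "1 - cmod a \<le> R"
    have "emeasure (density dA ?f) {z \<in> space (density dA ?f). bdist a z < R}
        = (\<integral>\<^sup>+z. ?f z * indicator {z \<in> space dA. bdist a z < R} z \<partial>dA)"
      by (subst emeasure_density) auto
    also have "\<dots> = (\<integral>\<^sup>+z. ?f z * indicator {z. bdist a z < R} z \<partial>dA)"
      by (intro nn_integral_cong) (auto split: split_indicator)
    also have "\<dots> \<le> ennreal (1 * R powr (q + 2))"
      using bdist_ball_weight[OF assms(1) _ assms(2), of R] R assms(1) by simp
    finally show "emeasure (density dA ?f) {z \<in> space (density dA ?f). bdist a z < R} \<le> ennreal (1 * R powr (q + 2))" .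
  qed (use assms in auto)
  finally show ?thesis by simp
qed

section \<open>Kernels centred at boxes\<close>

text \<open>
  The factor \<open>|I|\<^sup>2\<close> gives the kernel the size \<open>1 / |I|\<close> on the box of \<open>I\<close>.
\<close>

definition test_kernel :: "complex set \<Rightarrow> complex \<Rightarrow> complex" where
  "test_kernel I z = of_real ((arc_len I)\<^sup>2) / (1 - cnj (box_centre I) * z) ^ 3"

definition test_sum :: "complex set set \<Rightarrow> (complex set \<Rightarrow> real) \<Rightarrow> complex \<Rightarrow> complex" where
  "test_sum E b z = (\<Sum>I\<in>E. of_real (b I) * test_kernel I z)"

definition schur_const :: "real \<Rightarrow> real" where
  "schur_const p = 2 * (512 * shell_const (3 - p / 2) 3) * shell_const (p / 2 + 2) 3"

definition carleson_const :: "real \<Rightarrow> real" where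
  "carleson_const p = 4 * schur_const p * 12288 + 2 * 8192\<^sup>2"

lemma schur_const_nonneg: "0 < p \<Longrightarrow> p \<le> 1 \<Longrightarrow> 0 \<le> schur_const p"
  unfolding schur_const_def by (intro mult_nonneg_nonneg shell_const_nonneg) auto

context whitney_tree
begin

lemma norm_test_kernel:
  assumes "I \<in> D" "cmod z < 1"
  shows "cmod (test_kernel I z) = (arc_len I)\<^sup>2 * bdist (w I) z powr - 3"
  using bdist_pos[OF norm_w_less_1[OF assms(1)] assms(2)]
  by (simp add: test_kernel_def norm_divide norm_power bdist_def powr_minus powr_numeral divide_inverse
      norm_mult norm_inverse del: of_real_power)

lemma test_kernel_holomorphic: "I \<in> D \<Longrightarrow> test_kernel I holomorphic_on unit_disc"
  unfolding test_kernel_def[abs_def]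
proof (intro holomorphic_intros)
  fix z assume "I \<in> D" "z \<in> unit_disc"
  then have "0 < bdist (w I) z" by (intro bdist_pos norm_w_less_1) auto
  then show "(1 - cnj (w I) * z) ^ 3 \<noteq> 0" by (auto simp: bdist_def)
qed

lemma test_sum_holomorphic: "E \<subseteq> D \<Longrightarrow> test_sum E b holomorphic_on unit_disc"
  unfolding test_sum_def[abs_def] by (intro holomorphic_intros test_kernel_holomorphic) auto

lemma test_sum_measurable: "E \<subseteq> D \<Longrightarrow> test_sum E b \<in> borel_measurable dA"
  by (intro borel_measurable_dA_continuous holomorphic_on_imp_continuous_on test_sum_holomorphic)

text \<open>
  By \<open>sum_len_sq_near\<close> the masses \<open>|I|\<^sup>2\<close> grow like \<open>256 R\<^sup>2\<close>, and \<open>256 * shell_const 2 3 = 2048\<close>.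
\<close>

lemma kernel_sum_far:
  assumes "finite F" "F \<subseteq> D" "cmod a < 1" "0 < r"
  shows "(\<Sum>I | I \<in> F \<and> r \<le> bdist a (w I). (arc_len I)\<^sup>2 * bdist a (w I) powr - 3) \<le> 2048 / r"
proof -
  have "(\<Sum>I | I \<in> F \<and> r \<le> bdist a (w I). (arc_len I)\<^sup>2 * bdist a (w I) powr - 3)
      \<le> 256 * shell_const 2 3 * r powr (2 - 3)"
  proof (rule shell_sum)
    fix R assume "r \<le> R"
    then show "(\<Sum>I | I \<in> F \<and> bdist a (w I) < R. (arc_len I)\<^sup>2) \<le> 256 * R powr 2"
      using sum_len_sq_near[OF assms(1-3), of R] assms(4) by simp
  qed (use assms in auto)
  moreover have "shell_const 2 3 = 8" by (simp add: shell_const_def powr_neg_one)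
  moreover have "r powr (2 - 3) = 1 / r" using assms(4) by (simp add: powr_neg_one)
  ultimately show ?thesis by simp
qed

lemma test_sum_norm_le:
  assumes "F \<subseteq> D" "cmod z < 1" "\<And>I. I \<in> F \<Longrightarrow> \<bar>b I\<bar> \<le> 1"
  shows "cmod (test_sum F b z) \<le> (\<Sum>I\<in>F. (arc_len I)\<^sup>2 * bdist z (w I) powr - 3)"
  unfolding test_sum_def
proof (rule sum_norm_le)
  fix I assume I: "I \<in> F"
  then have "cmod (of_real (b I) * test_kernel I z) = \<bar>b I\<bar> * ((arc_len I)\<^sup>2 * bdist z (w I) powr - 3)"
    using assms by (subst bdist_commute) (simp add: norm_mult norm_test_kernel subset_eq)
  also have "\<dots> \<le> 1 * ((arc_len I)\<^sup>2 * bdist z (w I) powr - 3)"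
    using assms(3)[OF I] by (intro mult_right_mono) auto
  finally show "cmod (of_real (b I) * test_kernel I z) \<le> (arc_len I)\<^sup>2 * bdist z (w I) powr - 3" by simp
qed

lemma test_sum_bloch:
  assumes "finite F" "F \<subseteq> D" "cmod z < 1" "\<And>I. I \<in> F \<Longrightarrow> \<bar>b I\<bar> \<le> 1"
  shows "cmod (test_sum F b z) \<le> 2048 / (1 - cmod z)"
proof -
  have "{I. I \<in> F \<and> 1 - cmod z \<le> bdist z (w I)} = F"
    using bdist_ge(1)[OF assms(3) norm_w_less_1] assms(2) by auto
  then have "(\<Sum>I\<in>F. (arc_len I)\<^sup>2 * bdist z (w I) powr - 3) \<le> 2048 / (1 - cmod z)"
    using kernel_sum_far[OF assms(1-3), of "1 - cmod z"] assms(3) by simp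
  moreover have "cmod (test_sum F b z) \<le> (\<Sum>I\<in>F. (arc_len I)\<^sup>2 * bdist z (w I) powr - 3)"
    using assms by (intro test_sum_norm_le) auto
  ultimately show ?thesis by simp
qed

text \<open>
  First half of Schur's test: testing the kernel against the weight \<open>|I|\<^bsup>1-p/2\<^esup>\<close>. The exponent is chosen below
  \<open>1\<close> so that the shells sum up, and such that only the nonnegative power \<open>(1 - |z|)\<^bsup>p/2\<^esup>\<close> remains to be integrated
  in the second half.
\<close>

lemma schur_row:
  assumes "finite F" "F \<subseteq> D" "cmod z < 1" "0 < p" "p \<le> 1"
  shows "(\<Sum>I\<in>F. arc_len I powr (3 - p / 2) * bdist z (w I) powr - 3)
    \<le> 512 * shell_const (3 - p / 2) 3 * (1 - cmod z) powr (- p / 2)"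
proof -
  have eq: "{I. I \<in> F \<and> 1 - cmod z \<le> bdist z (w I)} = F"
    using bdist_ge(1)[OF assms(3) norm_w_less_1] assms(2) by auto
  have "(\<Sum>I | I \<in> F \<and> 1 - cmod z \<le> bdist z (w I). arc_len I powr (3 - p / 2) * bdist z (w I) powr - 3)
    \<le> 512 * shell_const (3 - p / 2) 3 * (1 - cmod z) powr (3 - p / 2 - 3)"
  proof (rule shell_sum)
    fix R assume R: "1 - cmod z \<le> R"
    then have R0: "0 < R" using assms(3) by linarith
    have "(\<Sum>I | I \<in> F \<and> bdist z (w I) < R. arc_len I powr (3 - p / 2))
        \<le> (\<Sum>I | I \<in> F \<and> bdist z (w I) < R. (2 * R powr (1 - p / 2)) * (arc_len I)\<^sup>2)"
    proof (rule sum_mono)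
      fix I assume I: "I \<in> {I \<in> F. bdist z (w I) < R}"
      then have ID: "I \<in> D" using assms(2) by auto
      have l: "0 < arc_len I" "arc_len I \<le> 2 * R"
        using len_pos[OF ID] len_le_bdist[OF ID assms(3)] I R0 by auto
      have "arc_len I powr (3 - p / 2) = arc_len I powr (1 - p / 2) * (arc_len I)\<^sup>2"
        using l by (simp add: powr_add[symmetric] flip: powr_numeral)
      also have "\<dots> \<le> (2 * R) powr (1 - p / 2) * (arc_len I)\<^sup>2"
        using l assms by (intro mult_right_mono powr_mono2) auto
      also have "(2 * R) powr (1 - p / 2) = 2 powr (1 - p / 2) * R powr (1 - p / 2)"
        using R0 by (simp add: powr_mult)
      also have "\<dots> * (arc_len I)\<^sup>2 \<le> (2 * R powr (1 - p / 2)) * (arc_len I)\<^sup>2"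
        using powr_mono[of "1 - p / 2" 1 "2::real"] assms by (intro mult_right_mono) auto
      finally show "arc_len I powr (3 - p / 2) \<le> (2 * R powr (1 - p / 2)) * (arc_len I)\<^sup>2" .
    qed
    also have "\<dots> = 2 * R powr (1 - p / 2) * (\<Sum>I | I \<in> F \<and> bdist z (w I) < R. (arc_len I)\<^sup>2)"
      by (simp add: sum_distrib_left)
    also have "\<dots> \<le> 2 * R powr (1 - p / 2) * (256 * R\<^sup>2)"
      by (intro mult_left_mono sum_len_sq_near assms R0) auto
    also have "\<dots> = 512 * R powr (3 - p / 2)"
      using R0 by (simp add: powr_add[symmetric] flip: powr_numeral)
    finally show "(\<Sum>I | I \<in> F \<and> bdist z (w I) < R. arc_len I powr (3 - p / 2)) \<le> 512 * R powr (3 - p / 2)" .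
  qed (use assms in auto)
  then show ?thesis by (simp add: eq)
qed

text \<open>
  Cauchy-Schwarz, splitting \<open>|I|\<^sup>4\<close> as \<open>|I|\<^bsup>1+p/2\<^esup> |I|\<^bsup>3-p/2\<^esup>\<close>; the second factor is summed by \<open>schur_row\<close>.
\<close>

lemma schur_pointwise:
  assumes F: "finite F" "F \<subseteq> D" and z: "cmod z < 1" and p: "0 < p" "p \<le> 1"
  shows "(cmod (test_sum F b z))\<^sup>2 * (1 - cmod z) powr p \<le>
    512 * shell_const (3 - p / 2) 3 *
      (\<Sum>I\<in>F. (b I)\<^sup>2 * arc_len I powr (1 + p / 2) * ((1 - cmod z) powr (p / 2) * bdist (w I) z powr - 3))"
proof -
  let ?d = "\<lambda>I. bdist (w I) z powr - 3"
  let ?l = arc_len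
  have "cmod (test_sum F b z) \<le> (\<Sum>I\<in>F. \<bar>b I\<bar> * ((?l I)\<^sup>2 * ?d I))"
    unfolding test_sum_def
    by (rule sum_norm_le) (use F z in \<open>simp add: norm_mult norm_test_kernel subset_eq\<close>)
  also have "\<dots> = (\<Sum>I\<in>F. (\<bar>b I\<bar> * sqrt (?l I powr (1 + p / 2) * ?d I)) * sqrt (?l I powr (3 - p / 2) * ?d I))"
  proof (rule sum.cong[OF refl])
    fix I assume "I \<in> F"
    then have l: "0 < ?l I" using F len_pos by auto
    have "sqrt (?l I powr (1 + p / 2) * ?d I) * sqrt (?l I powr (3 - p / 2) * ?d I)
        = sqrt ((?l I powr (1 + p / 2) * ?l I powr (3 - p / 2)) * (?d I)\<^sup>2)"
      by (simp add: real_sqrt_mult[symmetric] power2_eq_square mult_ac)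
    also have "?l I powr (1 + p / 2) * ?l I powr (3 - p / 2) = ((?l I)\<^sup>2)\<^sup>2"
      using l by (simp add: powr_add[symmetric] power_mult[symmetric] powr_numeral)
    also have "sqrt (((?l I)\<^sup>2)\<^sup>2 * (?d I)\<^sup>2) = (?l I)\<^sup>2 * ?d I"
      unfolding power_mult_distrib[symmetric] by (simp only: real_sqrt_abs) simp
    finally show "\<bar>b I\<bar> * ((?l I)\<^sup>2 * ?d I)
        = (\<bar>b I\<bar> * sqrt (?l I powr (1 + p / 2) * ?d I)) * sqrt (?l I powr (3 - p / 2) * ?d I)" by simp
  qed
  finally have "(cmod (test_sum F b z))\<^sup>2 \<le>
      (\<Sum>I\<in>F. (\<bar>b I\<bar> * sqrt (?l I powr (1 + p / 2) * ?d I)) * sqrt (?l I powr (3 - p / 2) * ?d I))\<^sup>2"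
    by (rule power_mono) simp
  also have "\<dots> \<le> (\<Sum>I\<in>F. (\<bar>b I\<bar> * sqrt (?l I powr (1 + p / 2) * ?d I))\<^sup>2) * (\<Sum>I\<in>F. (sqrt (?l I powr (3 - p / 2) * ?d I))\<^sup>2)"
    by (rule Cauchy_Schwarz_ineq_sum)
  also have "\<dots> = (\<Sum>I\<in>F. (b I)\<^sup>2 * ?l I powr (1 + p / 2) * ?d I) * (\<Sum>I\<in>F. ?l I powr (3 - p / 2) * bdist z (w I) powr - 3)"
    by (simp add: power_mult_distrib mult.assoc bdist_commute)
  also have "\<dots> \<le> (\<Sum>I\<in>F. (b I)\<^sup>2 * ?l I powr (1 + p / 2) * ?d I) * (512 * shell_const (3 - p / 2) 3 * (1 - cmod z) powr (- p / 2))"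
    by (intro mult_left_mono schur_row F z p sum_nonneg) auto
  finally have "(cmod (test_sum F b z))\<^sup>2 * (1 - cmod z) powr p \<le>
      (\<Sum>I\<in>F. (b I)\<^sup>2 * ?l I powr (1 + p / 2) * ?d I) * (512 * shell_const (3 - p / 2) 3 * (1 - cmod z) powr (- p / 2)) * (1 - cmod z) powr p"
    by (rule mult_right_mono) simp
  also have "\<dots> = 512 * shell_const (3 - p / 2) 3 * ((\<Sum>I\<in>F. (b I)\<^sup>2 * ?l I powr (1 + p / 2) * ?d I) * ((1 - cmod z) powr (- p / 2) * (1 - cmod z) powr p))"
    by (simp add: mult_ac)
  also have "(1 - cmod z) powr (- p / 2) * (1 - cmod z) powr p = (1 - cmod z) powr (p / 2)"
    by (simp add: powr_add[symmetric])
  also have "(\<Sum>I\<in>F. (b I)\<^sup>2 * ?l I powr (1 + p / 2) * ?d I) * (1 - cmod z) powr (p / 2)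
      = (\<Sum>I\<in>F. (b I)\<^sup>2 * ?l I powr (1 + p / 2) * ((1 - cmod z) powr (p / 2) * ?d I))"
    unfolding sum_distrib_right by (intro sum.cong refl) (simp add: mult_ac)
  finally show ?thesis .
qed

text \<open>
  Second half of Schur's test: integrating over \<open>z\<close> turns \<open>|I|\<^bsup>1+p/2\<^esup>\<close> into \<open>|I|\<^sup>p\<close>.
\<close>

lemma test_sum_bergman_bound:
  assumes F: "finite F" "F \<subseteq> D" and p: "0 < p" "p \<le> 1"
  shows "(\<integral>\<^sup>+z. ennreal ((cmod (test_sum F b z))\<^sup>2 * (1 - cmod z) powr p) \<partial>dA)
    \<le> ennreal (schur_const p * (\<Sum>I\<in>F. (b I)\<^sup>2 * arc_len I powr p))"
proof -
  define c where "c = 512 * shell_const (3 - p / 2) 3"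
  have c: "0 \<le> c" unfolding c_def using p by (intro mult_nonneg_nonneg shell_const_nonneg) auto
  define s where "s = shell_const (p / 2 + 2) 3"
  have s: "0 \<le> s" unfolding s_def using p by (intro shell_const_nonneg) auto
  let ?k = "\<lambda>I z. (1 - cmod z) powr (p / 2) * bdist (w I) z powr - 3"
  let ?v = "\<lambda>I. c * ((b I)\<^sup>2 * arc_len I powr (1 + p / 2))"
  have "(\<integral>\<^sup>+z. ennreal ((cmod (test_sum F b z))\<^sup>2 * (1 - cmod z) powr p) \<partial>dA)
      \<le> (\<integral>\<^sup>+z. (\<Sum>I\<in>F. ennreal (?v I) * ennreal (?k I z)) \<partial>dA)"
  proof (rule nn_integral_mono)
    fix z assume "z \<in> space dA"
    then have z: "cmod z < 1" by simp
    have "ennreal ((cmod (test_sum F b z))\<^sup>2 * (1 - cmod z) powr p) \<le> ennreal (\<Sum>I\<in>F. ?v I * ?k I z)"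
      using schur_pointwise[OF F z p, of b]
      by (intro ennreal_leI) (simp add: c_def sum_distrib_left mult.assoc)
    also have "\<dots> = (\<Sum>I\<in>F. ennreal (?v I * ?k I z))" using c by (intro sum_ennreal[symmetric]) auto
    also have "\<dots> = (\<Sum>I\<in>F. ennreal (?v I) * ennreal (?k I z))" using c by (intro sum.cong refl ennreal_mult) auto
    finally show "ennreal ((cmod (test_sum F b z))\<^sup>2 * (1 - cmod z) powr p) \<le> (\<Sum>I\<in>F. ennreal (?v I) * ennreal (?k I z))" .
  qed
  also have "\<dots> = (\<Sum>I\<in>F. ennreal (?v I) * (\<integral>\<^sup>+z. ennreal (?k I z) \<partial>dA))"
    by (subst nn_integral_sum) (auto intro!: sum.cong nn_integral_cmult)
  also have "\<dots> \<le> (\<Sum>I\<in>F. ennreal (2 * c * s * ((b I)\<^sup>2 * arc_len I powr p)))"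
  proof (rule sum_mono)
    fix I assume "I \<in> F"
    then have I: "I \<in> D" using F by auto
    have l: "0 < arc_len I" by (rule len_pos[OF I])
    have q: "(1 - cmod (w I)) powr (p / 2 - 1) \<le> 2 * arc_len I powr (p / 2 - 1)"
    proof -
      have "(3 / 4 * arc_len I) powr (p / 2 - 1) = (3/4) powr (p / 2 - 1) * arc_len I powr (p / 2 - 1)"
        by (rule powr_mult)
      also have "(3/4::real) powr (p / 2 - 1) \<le> (3/4) powr (- 1)" using p by (intro powr_mono') auto
      also have "(3/4::real) powr (- 1) \<le> 2" by (simp add: powr_minus)
      finally show ?thesis using norm_w[OF I] by (simp add: mult_right_mono)
    qed
    have "ennreal (?v I) * (\<integral>\<^sup>+z. ennreal (?k I z) \<partial>dA) \<le> ennreal (?v I) * ennreal (s * (1 - cmod (w I)) powr (p / 2 - 1))"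
      unfolding s_def using p by (intro mult_left_mono kernel_weight_integral norm_w_less_1 I) auto
    also have "\<dots> \<le> ennreal (?v I) * ennreal (s * (2 * arc_len I powr (p / 2 - 1)))"
      using s q by (intro mult_left_mono ennreal_leI) auto
    also have "\<dots> = ennreal (?v I * (s * (2 * arc_len I powr (p / 2 - 1))))"
      using c s by (intro ennreal_mult[symmetric]) auto
    also have "?v I * (s * (2 * arc_len I powr (p / 2 - 1))) = 2 * c * s * ((b I)\<^sup>2 * (arc_len I powr (1 + p / 2) * arc_len I powr (p / 2 - 1)))"
      by (simp add: mult_ac)
    also have "arc_len I powr (1 + p / 2) * arc_len I powr (p / 2 - 1) = arc_len I powr p"
      by (simp add: powr_add[symmetric])
    finally show "ennreal (?v I) * (\<integral>\<^sup>+z. ennreal (?k I z) \<partial>dA) \<le> ennreal (2 * c * s * ((b I)\<^sup>2 * arc_len I powr p))" .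
  qed
  also have "\<dots> = ennreal (\<Sum>I\<in>F. 2 * c * s * ((b I)\<^sup>2 * arc_len I powr p))"
    using c s by (intro sum_ennreal) auto
  also have "\<dots> = ennreal (schur_const p * (\<Sum>I\<in>F. (b I)\<^sup>2 * arc_len I powr p))"
    by (simp add: sum_distrib_left schur_const_def c_def s_def)
  finally show ?thesis .
qed

end

section \<open>Green's function and test functions in \<open>\<Q>\<^sub>p\<close>\<close>

lemma green_disc_eq: "green_disc z a = ln (bdist a z / cmod (z - a))"
  by (simp add: green_disc_def moebius_disc_def norm_divide bdist_def norm_minus_commute)

text \<open>
  This is \<open>ln t \<le> t - 1\<close> for \<open>t = |\<sigma>\<^sub>a(z)|\<^sup>2\<close>, where \<open>1 - t\<close> is the fraction on the left; \<open>green_upper_far\<close> uses \<open>1 / t\<close>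
  instead, which costs a bounded factor when \<open>|\<sigma>\<^sub>a(z)| \<ge> 1 / 2\<close>.
\<close>

lemma green_lower:
  assumes "cmod a < 1" "cmod z < 1" "z \<noteq> a"
  shows "(1 - (cmod a)\<^sup>2) * (1 - (cmod z)\<^sup>2) / (bdist a z)\<^sup>2 \<le> 2 * green_disc z a"
proof -
  let ?x = "(cmod (z - a) / bdist a z)\<^sup>2"
  have d: "0 < bdist a z" by (rule bdist_pos[OF assms(1,2)])
  have x: "0 < ?x" using d assms(3) by simp
  have "ln ?x \<le> ?x - 1" by (rule ln_le_minus_one[OF x])
  moreover have "ln ?x = - 2 * green_disc z a"
    using d assms(3) by (simp add: green_disc_eq ln_realpow ln_div)
  moreover have "1 - ?x = (1 - (cmod a)\<^sup>2) * (1 - (cmod z)\<^sup>2) / (bdist a z)\<^sup>2"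
    using d bdist_sq_diff[of a z] by (simp add: power_divide field_simps)
  ultimately show ?thesis by linarith
qed

lemma green_upper_far:
  assumes "cmod a < 1" "cmod z < 1" "bdist a z \<le> 2 * cmod (z - a)"
  shows "green_disc z a \<le> 8 * ((1 - cmod a) * (1 - cmod z)) / (bdist a z)\<^sup>2"
proof -
  have d: "0 < bdist a z" by (rule bdist_pos[OF assms(1,2)])
  then have za: "0 < cmod (z - a)" using assms(3) by linarith
  let ?y = "(bdist a z / cmod (z - a))\<^sup>2"
  have y: "0 < ?y" using d za by simp
  have "2 * green_disc z a = ln ?y" using d za by (simp add: green_disc_eq ln_realpow)
  also have "\<dots> \<le> ?y - 1" by (rule ln_le_minus_one[OF y])
  also have "\<dots> = (1 - (cmod a)\<^sup>2) * (1 - (cmod z)\<^sup>2) / (cmod (z - a))\<^sup>2"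
    using za bdist_sq_diff[of a z] by (simp add: power_divide field_simps)
  also have "\<dots> \<le> ((2 * (1 - cmod a)) * (2 * (1 - cmod z))) / ((bdist a z)\<^sup>2 / 4)"
  proof (intro frac_le mult_mono)
    have *: "1 - t\<^sup>2 \<le> 2 * (1 - t)" for t :: real
    proof -
      have "0 \<le> (1 - t)\<^sup>2" by simp
      then show ?thesis by (simp add: power2_eq_square algebra_simps)
    qed
    show "1 - (cmod a)\<^sup>2 \<le> 2 * (1 - cmod a)" "1 - (cmod z)\<^sup>2 \<le> 2 * (1 - cmod z)" by (rule *)+
    have "(bdist a z)\<^sup>2 \<le> (2 * cmod (z - a))\<^sup>2" using assms(3) d by (intro power_mono) auto
    then show "(bdist a z)\<^sup>2 / 4 \<le> (cmod (z - a))\<^sup>2" by (simp add: power_mult_distrib)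
  qed (use assms d in \<open>auto simp: power_le_one\<close>)
  also have "\<dots> = 2 * (8 * ((1 - cmod a) * (1 - cmod z)) / (bdist a z)\<^sup>2)"
    by (simp add: field_simps)
  finally show ?thesis by simp
qed

text \<open>
  For \<open>p \<le> 1\<close> the logarithmic singularity is dominated by an integrable power of the distance.
\<close>

lemma green_powr_near:
  assumes "0 < p" "p \<le> 1" "2 * cmod (z - a) < bdist a z" "z \<noteq> a"
  shows "green_disc z a powr p \<le> bdist a z / cmod (z - a)"
proof -
  let ?y = "bdist a z / cmod (z - a)"
  have "cmod (z - a) \<le> bdist a z" using assms(3) norm_ge_zero[of "z - a"] by linarith
  then have y: "1 \<le> ?y" using assms(4) by (simp add: field_simps)
  have g0: "0 \<le> green_disc z a" using y unfolding green_disc_eq by (rule ln_ge_zero)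
  have "green_disc z a \<le> ?y" using ln_le_minus_one[of ?y] y unfolding green_disc_eq by linarith
  then have "green_disc z a powr p \<le> ?y powr p" using g0 assms by (intro powr_mono2) auto
  also have "\<dots> \<le> ?y powr 1" using assms y by (intro powr_mono) auto
  finally show ?thesis using y by simp
qed

text \<open>
  The annulus where \<open>|z - a|\<close> is comparable with \<open>2\<^bsup>-j\<^esup> R\<close> contributes at most \<open>2 R 2\<^bsup>-j\<^esup>\<close>.
\<close>

lemma inverse_distance_integral:
  assumes R: "0 < R"
  shows "(\<integral>\<^sup>+z. ennreal (1 / cmod (z - a)) * indicator (ball a R) z \<partial>dA) \<le> ennreal (4 * R)"
proof -
  define S where "S j = ball a (R / 2 ^ j) \<inter> unit_disc" for j :: nat
  have S[measurable]: "S j \<in> sets dA" for j unfolding S_def by (intro sets_dA_borel) auto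
  have "(\<integral>\<^sup>+z. ennreal (1 / cmod (z - a)) * indicator (ball a R) z \<partial>dA)
     \<le> (\<integral>\<^sup>+z. (\<Sum>j. ennreal (2 ^ Suc j / R) * indicator (S j) z) \<partial>dA)"
  proof (rule nn_integral_mono)
    fix z assume z: "z \<in> space dA"
    show "ennreal (1 / cmod (z - a)) * indicator (ball a R) z \<le> (\<Sum>j. ennreal (2 ^ Suc j / R) * indicator (S j) z)"
    proof (cases "z \<in> ball a R \<and> z \<noteq> a")
      case True
      then have za: "0 < cmod (z - a)" "cmod (z - a) < R" by (auto simp: dist_norm norm_minus_commute)
      then obtain j where j: "2 ^ j * cmod (z - a) \<le> R" "R < 2 ^ Suc j * cmod (z - a)"
        using shell_index[OF za(1), of R] by auto
      (* The sets S j are open discs, so membership needs the strict inequality. *)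
      have strict: "\<exists>j. 2 ^ j * cmod (z - a) < R \<and> R \<le> 2 ^ Suc j * cmod (z - a)"
      proof (cases "2 ^ j * cmod (z - a) < R")
        case False
        then have e: "2 ^ j * cmod (z - a) = R" using j by simp
        then obtain i where "j = Suc i" using za by (cases j) auto
        then show ?thesis using e za by (intro exI[of _ i]) auto
      qed (use j in \<open>auto intro!: exI[of _ j]\<close>)
      then obtain j where j: "2 ^ j * cmod (z - a) < R" "R \<le> 2 ^ Suc j * cmod (z - a)" by blast
      have "z \<in> S j" using j(1) z by (auto simp: S_def dist_norm norm_minus_commute field_simps)
      moreover have "1 / cmod (z - a) \<le> 2 ^ Suc j / R" using j(2) za R by (simp add: field_simps)
      ultimately have "ennreal (1 / cmod (z - a)) * indicator (ball a R) z \<le> ennreal (2 ^ Suc j / R) * indicator (S j) z"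
        using True by (simp add: ennreal_leI)
      also have "\<dots> \<le> (\<Sum>j. ennreal (2 ^ Suc j / R) * indicator (S j) z)"
      proof -
        have "t j \<le> (\<Sum>j. t j)" for t :: "nat \<Rightarrow> ennreal" using sum_le_suminf[of t "{j}"] by simp
        then show ?thesis .
      qed
      finally show ?thesis .
    qed auto
  qed
  also have "\<dots> = (\<Sum>j. ennreal (2 ^ Suc j / R) * emeasure dA (S j))"
    by (subst nn_integral_suminf) (auto simp: nn_integral_cmult_indicator)
  also have "\<dots> \<le> (\<Sum>j. ennreal (2 * R * (1/2) ^ j))"
  proof (intro suminf_le allI)
    fix j
    have "ennreal (2 ^ Suc j / R) * emeasure dA (S j) \<le> ennreal (2 ^ Suc j / R) * ennreal ((R / 2 ^ j)\<^sup>2)"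
      using R by (intro mult_left_mono emeasure_dA_le_ball[where z = a]) (use S[of j] in \<open>auto simp: S_def\<close>)
    also have "\<dots> = ennreal (2 ^ Suc j / R * (R / 2 ^ j)\<^sup>2)" using R by (simp flip: ennreal_mult')
    also have "2 ^ Suc j / R * (R / 2 ^ j)\<^sup>2 = 2 * R * (1/2) ^ j"
      using R by (simp add: power2_eq_square field_simps power_divide)
    finally show "ennreal (2 ^ Suc j / R) * emeasure dA (S j) \<le> ennreal (2 * R * (1/2) ^ j)" .
  qed auto
  also have "\<dots> = ennreal (2 * R * (1 / (1 - 1/2)))"
    using R by (intro suminf_ennreal_eq sums_mult geometric_sums) auto
  finally show ?thesis by simp
qed


definition qp_const :: "real \<Rightarrow> real" where
  "qp_const p = 8 * (carleson_const p * shell_const p (2 * p)) + 2048\<^sup>2 * 512"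

lemma carleson_const_nonneg: "0 < p \<Longrightarrow> p \<le> 1 \<Longrightarrow> 0 \<le> carleson_const p"
  unfolding carleson_const_def schur_const_def
  by (intro add_nonneg_nonneg mult_nonneg_nonneg shell_const_nonneg) auto

lemma qp_const_pos: "0 < p \<Longrightarrow> p \<le> 1 \<Longrightarrow> 0 < qp_const p"
  unfolding qp_const_def
  by (intro add_nonneg_pos mult_nonneg_nonneg carleson_const_nonneg shell_const_nonneg) auto

context whitney_tree
begin

context
  fixes E :: "complex set set" and b :: "complex set \<Rightarrow> real" and p :: real
  assumes E: "finite E" "E \<subseteq> D" and p: "0 < p" "p \<le> 1"
    and carl: "\<And>J. J \<in> D \<Longrightarrow> (\<Sum>I | I \<in> E \<and> I \<subseteq> J. (b I)\<^sup>2 * arc_len I powr p) \<le> arc_len J powr p"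
begin

lemma test_coeff_le_1:
  assumes I: "I \<in> E"
  shows "\<bar>b I\<bar> \<le> 1"
proof -
  have ID: "I \<in> D" using I E by auto
  have "(b I)\<^sup>2 * arc_len I powr p \<le> (\<Sum>I' | I' \<in> E \<and> I' \<subseteq> I. (b I')\<^sup>2 * arc_len I' powr p)"
    by (rule member_le_sum) (use I E in auto)
  also have "\<dots> \<le> 1 * arc_len I powr p" using carl[OF ID] by simp
  finally have "(b I)\<^sup>2 \<le> 1" using len_pos[OF ID] by (subst (asm) mult_le_cancel_right_pos) auto
  then show ?thesis by (simp add: abs_square_le_1)
qed

text \<open>
  Split the sum at \<open>bdist a w\<^sub>I = 2 R\<close>. The near terms have total mass at most a multiple of \<open>R\<^sup>p\<close> by
  \<open>carleson_sum_near\<close>, and Schur's test bounds their integral over the whole disc. For the far terms the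
  triangle inequality allows to replace \<open>z\<close> by \<open>a\<close> in the kernels, so their sum is at most \<open>8192 / R\<close> on the ball, whose weighted
  area is at most \<open>R\<^bsup>p+2\<^esup>\<close>.
\<close>

lemma test_sum_carleson:
  assumes a: "cmod a < 1" and R: "0 < R"
  shows "(\<integral>\<^sup>+z. ennreal ((cmod (test_sum E b z))\<^sup>2 * (1 - cmod z) powr p) * indicator {z. bdist a z < R} z \<partial>dA)
    \<le> ennreal (carleson_const p * R powr p)"
proof -
  (* Beyond 2 R a point of the ball is at least half as far from the centre w I as a is. *)
  define N where "N = {I \<in> E. bdist a (w I) < 2 * R}"
  have N: "finite N" "N \<subseteq> D" "finite (E - N)" "E - N \<subseteq> D" "N \<subseteq> E" using E by (auto simp: N_def)
  let ?f1 = "\<lambda>z. ennreal ((cmod (test_sum N b z))\<^sup>2 * (1 - cmod z) powr p)"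
  let ?g = "\<lambda>z. ennreal ((1 - cmod z) powr p) * indicator {z. bdist a z < R} z"
  have far: "cmod (test_sum (E - N) b z) \<le> 8192 / R" if z: "cmod z < 1" "bdist a z < R" for z
  proof -
    have "cmod (test_sum (E - N) b z) \<le> (\<Sum>I\<in>E - N. (arc_len I)\<^sup>2 * bdist z (w I) powr - 3)"
      using N z test_coeff_le_1 by (intro test_sum_norm_le) auto
    also have "\<dots> \<le> (\<Sum>I\<in>E - N. 8 * ((arc_len I)\<^sup>2 * bdist a (w I) powr - 3))"
    proof (rule sum_mono)
      fix I assume I: "I \<in> E - N"
      then have ID: "I \<in> D" using E by auto
      note wI = norm_w_less_1[OF ID]
      have d: "2 * R \<le> bdist a (w I)" using I by (auto simp: N_def)
      have "bdist a (w I) \<le> bdist a z + bdist z (w I)"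
        using bdist_triangle[OF a z(1) wI] by (simp add: bdist_commute)
      then have "bdist a (w I) / 2 \<le> bdist z (w I)" using d z(2) by simp
      then have "bdist z (w I) powr - 3 \<le> (bdist a (w I) / 2) powr - 3"
        using d R by (intro powr_mono2') auto
      also have "\<dots> = 8 * bdist a (w I) powr - 3"
      proof -
        have "(2::real) powr - 3 = 1 / 8" by (simp add: powr_minus)
        then show ?thesis unfolding powr_divide by (simp only:) simp
      qed
      finally show "(arc_len I)\<^sup>2 * bdist z (w I) powr - 3 \<le> 8 * ((arc_len I)\<^sup>2 * bdist a (w I) powr - 3)"
        using mult_left_mono[of _ _ "(arc_len I)\<^sup>2"] by fastforce
    qed
    also have "\<dots> = 8 * (\<Sum>I | I \<in> E \<and> 2 * R \<le> bdist a (w I). (arc_len I)\<^sup>2 * bdist a (w I) powr - 3)"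
      unfolding sum_distrib_left[symmetric]
      by (intro arg_cong[where f = "\<lambda>x. 8 * x"] sum.cong) (auto simp: N_def)
    also have "\<dots> \<le> 8 * (2048 / (2 * R))"
      by (intro mult_left_mono kernel_sum_far E a) (use R in auto)
    finally show ?thesis by simp
  qed
  have "(\<integral>\<^sup>+z. ennreal ((cmod (test_sum E b z))\<^sup>2 * (1 - cmod z) powr p) * indicator {z. bdist a z < R} z \<partial>dA)
      \<le> (\<integral>\<^sup>+z. 2 * ?f1 z + ennreal (2 * (8192 / R)\<^sup>2) * ?g z \<partial>dA)"
  proof (rule nn_integral_mono)
    fix z assume "z \<in> space dA"
    then have z: "cmod z < 1" by simp
    show "ennreal ((cmod (test_sum E b z))\<^sup>2 * (1 - cmod z) powr p) * indicator {z. bdist a z < R} z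
        \<le> 2 * ?f1 z + ennreal (2 * (8192 / R)\<^sup>2) * ?g z"
    proof (cases "bdist a z < R")
      case True
      have split: "test_sum E b z = test_sum N b z + test_sum (E - N) b z"
        unfolding test_sum_def using E N by (intro sum.subset_diff[THEN trans]) (auto simp: add.commute)
      have "cmod (test_sum E b z) \<le> cmod (test_sum N b z) + 8192 / R"
        unfolding split using far[OF z True] norm_triangle_ineq[of "test_sum N b z" "test_sum (E - N) b z"] by linarith
      then have "(cmod (test_sum E b z))\<^sup>2 \<le> (cmod (test_sum N b z) + 8192 / R)\<^sup>2"
        by (intro power_mono) auto
      also have "\<dots> \<le> 2 * (cmod (test_sum N b z))\<^sup>2 + 2 * (8192 / R)\<^sup>2"
        using sum_squares_bound[of "cmod (test_sum N b z)" "8192 / R"] by (simp add: power2_sum)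
      finally have "(cmod (test_sum E b z))\<^sup>2 * (1 - cmod z) powr p
          \<le> (2 * (cmod (test_sum N b z))\<^sup>2 + 2 * (8192 / R)\<^sup>2) * (1 - cmod z) powr p"
        by (rule mult_right_mono) simp
      also have "\<dots> = 2 * ((cmod (test_sum N b z))\<^sup>2 * (1 - cmod z) powr p) + 2 * (8192 / R)\<^sup>2 * (1 - cmod z) powr p"
        by (simp add: distrib_right mult.assoc)
      finally have "ennreal ((cmod (test_sum E b z))\<^sup>2 * (1 - cmod z) powr p)
          \<le> ennreal (2 * ((cmod (test_sum N b z))\<^sup>2 * (1 - cmod z) powr p) + 2 * (8192 / R)\<^sup>2 * (1 - cmod z) powr p)"
        by (rule ennreal_leI)
      also have "\<dots> = 2 * ?f1 z + ennreal (2 * (8192 / R)\<^sup>2) * ennreal ((1 - cmod z) powr p)"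
        by (simp add: ennreal_plus ennreal_mult)
      finally show ?thesis using True by simp
    qed simp
  qed
  also have "\<dots> = 2 * (\<integral>\<^sup>+z. ?f1 z \<partial>dA) + ennreal (2 * (8192 / R)\<^sup>2) * (\<integral>\<^sup>+z. ?g z \<partial>dA)"
  proof -
    have [measurable]: "test_sum N b \<in> borel_measurable dA" by (rule test_sum_measurable[OF N(2)])
    have [measurable]: "(indicator {z. bdist a z < R} :: _ \<Rightarrow> ennreal) \<in> borel_measurable dA"
      by (rule indicator_dA_measurable) measurable
    show ?thesis by (simp add: nn_integral_add nn_integral_cmult)
  qed
  also have "\<dots> \<le> 2 * ennreal (schur_const p * (12288 * (2 * R powr p))) + ennreal (2 * (8192 / R)\<^sup>2) * ennreal (R powr (p + 2))"
  proof (intro add_mono mult_left_mono)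
    have "(\<Sum>I\<in>N. (b I)\<^sup>2 * arc_len I powr p) \<le> 12288 * (2 * R) powr p"
      unfolding N_def using E p a R by (intro carleson_sum_near carl) auto
    also have "(2 * R) powr p = 2 powr p * R powr p" by (rule powr_mult)
    also have "12288 * (2 powr p * R powr p) \<le> 12288 * (2 * R powr p)"
      using powr_mono[of p 1 "2::real"] p by (intro mult_left_mono mult_right_mono) auto
    finally have "schur_const p * (\<Sum>I\<in>N. (b I)\<^sup>2 * arc_len I powr p) \<le> schur_const p * (12288 * (2 * R powr p))"
      by (rule mult_left_mono) (rule schur_const_nonneg[OF p])
    then show "(\<integral>\<^sup>+z. ?f1 z \<partial>dA) \<le> ennreal (schur_const p * (12288 * (2 * R powr p)))"
      using test_sum_bergman_bound[OF N(1,2) p, of b] by (meson ennreal_leI order_trans)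
    show "(\<integral>\<^sup>+z. ?g z \<partial>dA) \<le> ennreal (R powr (p + 2))"
      using p by (intro bdist_ball_weight a R) auto
  qed auto
  also have "\<dots> = ennreal (2 * (schur_const p * (12288 * (2 * R powr p))) + 2 * (8192 / R)\<^sup>2 * R powr (p + 2))"
  proof -
    have *: "2 * ennreal x + ennreal u * ennreal v = ennreal (2 * x + u * v)"
      if "0 \<le> x" "0 \<le> u" "0 \<le> v" for x u v
      using that by (simp add: ennreal_plus ennreal_mult)
    show ?thesis by (rule *) (use schur_const_nonneg[OF p] in auto)
  qed
  also have "2 * (schur_const p * (12288 * (2 * R powr p))) + 2 * (8192 / R)\<^sup>2 * R powr (p + 2) = carleson_const p * R powr p"
    using R by (simp add: carleson_const_def powr_add powr_numeral field_simps power2_eq_square)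
  finally show ?thesis .
qed

text \<open>
  Where \<open>|\<sigma>\<^sub>a(z)| \<ge> 1 / 2\<close>, Green's function is comparable with \<open>(1 - |a|) (1 - |z|) / (bdist a z)\<^sup>2\<close>. In the remaining
  disc about \<open>a\<close> all of \<open>1 - |z|\<close>, \<open>1 - |a|\<close> and \<open>bdist a z\<close> are comparable; there the Bloch bound
  \<open>2048 / (1 - |z|)\<close> is used against the singularity \<open>1 / |z - a|\<close>.
\<close>

lemma test_sum_green_pointwise:
  assumes a: "cmod a < 1" and z: "cmod z < 1"
  shows "ennreal ((cmod (test_sum E b z))\<^sup>2 * green_disc z a powr p) \<le>
     ennreal (8 * (1 - cmod a) powr p) * (ennreal ((cmod (test_sum E b z))\<^sup>2 * (1 - cmod z) powr p) *
       (ennreal (bdist a z powr - (2 * p)) * indicator {z. 1 - cmod a \<le> bdist a z} z))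
   + ennreal (2048\<^sup>2 * 64 / (1 - cmod a)) * (ennreal (1 / cmod (z - a)) * indicator (ball a (2 * (1 - cmod a))) z)"
    (is "_ \<le> ?far + ?near")
proof -
  let ?t = "(cmod (test_sum E b z))\<^sup>2"
  have d: "0 < bdist a z" by (rule bdist_pos[OF a z])
  show ?thesis
  proof (cases "z = a")
    case True
    then show ?thesis by (simp add: green_disc_def moebius_disc_def)
  next
    case za: False
    show ?thesis
    proof (cases "bdist a z \<le> 2 * cmod (z - a)")
      case True
      have g0: "0 \<le> green_disc z a" unfolding green_disc_eq
        using dist_le_bdist[OF a z] za by (intro ln_ge_zero) (auto simp: field_simps)
      have "green_disc z a powr p \<le> (8 * ((1 - cmod a) * (1 - cmod z)) / (bdist a z)\<^sup>2) powr p"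
        by (intro powr_mono2 g0 green_upper_far a z True) (use p in simp)
      also have "\<dots> = 8 powr p * ((1 - cmod a) powr p * (1 - cmod z) powr p) * bdist a z powr - (2 * p)"
      proof -
        have "((bdist a z)\<^sup>2) powr p = bdist a z powr (2 * p)"
          using d by (simp add: powr_powr flip: powr_numeral)
        then show ?thesis unfolding powr_divide powr_mult by (simp only: powr_minus divide_inverse)
      qed
      also have "\<dots> \<le> 8 * ((1 - cmod a) powr p * (1 - cmod z) powr p) * bdist a z powr - (2 * p)"
        using powr_mono[of p 1 "8::real"] p by (intro mult_right_mono) auto
      finally have "?t * green_disc z a powr p \<le> ?t * (8 * ((1 - cmod a) powr p * (1 - cmod z) powr p) * bdist a z powr - (2 * p))"
        by (rule mult_left_mono) simp
      also have "\<dots> = 8 * (1 - cmod a) powr p * (?t * (1 - cmod z) powr p * bdist a z powr - (2 * p))"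
        by (simp add: mult_ac)
      finally have "ennreal (?t * green_disc z a powr p) \<le> ennreal (8 * (1 - cmod a) powr p * (?t * (1 - cmod z) powr p * bdist a z powr - (2 * p)))"
        by (rule ennreal_leI)
      also have "\<dots> = ennreal (8 * (1 - cmod a) powr p) * (ennreal (?t * (1 - cmod z) powr p) * ennreal (bdist a z powr - (2 * p)))"
        by (subst ennreal_mult, simp, simp, subst ennreal_mult, simp, simp, simp)
      also have "\<dots> = ?far" using bdist_ge(1)[OF a z] by simp
      also have "\<dots> \<le> ?far + ?near" by simp
      finally show ?thesis .
    next
      case False
      then have near: "2 * cmod (z - a) < bdist a z" by simp
      have b1: "bdist a z < 4 * (1 - cmod a)" using bdist_le_dist[OF a, of z] near by linarith
      have b2: "bdist a z < 4 * (1 - cmod z)"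
        using bdist_le_dist[OF z, of a] near by (simp add: bdist_commute norm_minus_commute)
      have b3: "1 - cmod a \<le> bdist a z" by (rule bdist_ge(1)[OF a z])
      have in_ball: "z \<in> ball a (2 * (1 - cmod a))" using near b1 by (simp add: dist_norm norm_minus_commute)
      have "cmod (test_sum E b z) \<le> 2048 / (1 - cmod z)"
        using test_sum_bloch[OF E z] test_coeff_le_1 by simp
      also have "\<dots> \<le> 2048 / ((1 - cmod a) / 4)" using b2 b3 a by (intro divide_left_mono) auto
      finally have "?t \<le> (2048 / ((1 - cmod a) / 4))\<^sup>2" by (rule power_mono) simp
      moreover have "green_disc z a powr p \<le> 4 * (1 - cmod a) / cmod (z - a)"
      proof -
        have "bdist a z / cmod (z - a) \<le> 4 * (1 - cmod a) / cmod (z - a)"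
          using b1 by (intro divide_right_mono) auto
        with green_powr_near[OF p near za] show ?thesis by linarith
      qed
      ultimately have "?t * green_disc z a powr p \<le> (2048 / ((1 - cmod a) / 4))\<^sup>2 * (4 * (1 - cmod a) / cmod (z - a))"
        by (rule mult_mono) auto
      also have "\<dots> = 2048\<^sup>2 * 64 / (1 - cmod a) * (1 / cmod (z - a))"
      proof -
        have *: "(2048 / (t / 4))\<^sup>2 * (4 * t / s) = 2048\<^sup>2 * 64 / t * (1 / s)" if "0 < t" "0 < s" for t s :: real
          using that by (simp add: power2_eq_square field_simps)
        show ?thesis by (rule *) (use a za in auto)
      qed
      finally have "ennreal (?t * green_disc z a powr p) \<le> ennreal (2048\<^sup>2 * 64 / (1 - cmod a) * (1 / cmod (z - a)))"
        by (rule ennreal_leI)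
      also have "\<dots> = ?near" using a in_ball by (subst ennreal_mult) auto
      also have "\<dots> \<le> ?far + ?near" by simp
      finally show ?thesis .
    qed
  qed
qed

lemma test_sum_green_integral:
  assumes a: "cmod a < 1"
  shows "(\<integral>\<^sup>+z. ennreal ((cmod (test_sum E b z))\<^sup>2 * green_disc z a powr p) \<partial>dA) \<le> ennreal (qp_const p)"
proof -
  have [measurable]: "test_sum E b \<in> borel_measurable dA" by (rule test_sum_measurable[OF E(2)])
  let ?F = "\<lambda>z. ennreal ((cmod (test_sum E b z))\<^sup>2 * (1 - cmod z) powr p)"
  let ?S = "\<lambda>z. ennreal (bdist a z powr - (2 * p)) * indicator {z. 1 - cmod a \<le> bdist a z} z"
  let ?B = "\<lambda>z. ennreal (1 / cmod (z - a)) * indicator (ball a (2 * (1 - cmod a))) z"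
  have [measurable]: "(indicator {z. 1 - cmod a \<le> bdist a z} :: _ \<Rightarrow> ennreal) \<in> borel_measurable dA"
    by (rule indicator_dA_measurable) measurable
  have B[measurable]: "?B \<in> borel_measurable dA" by (intro borel_measurable_dA borel_measurable_times_ennreal borel_measurable_indicator) auto
  have "(\<integral>\<^sup>+z. ?F z * ?S z \<partial>dA) = (\<integral>\<^sup>+z. ?S z \<partial>density dA ?F)"
    by (subst nn_integral_density) auto
  also have "\<dots> \<le> ennreal (carleson_const p * shell_const p (2 * p) * (1 - cmod a) powr (p - 2 * p))"
  proof (rule shell_integral)
    fix R assume R: "1 - cmod a \<le> R"
    have "emeasure (density dA ?F) {z \<in> space (density dA ?F). bdist a z < R}
        = (\<integral>\<^sup>+z. ?F z * indicator {z \<in> space dA. bdist a z < R} z \<partial>dA)"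
      by (subst emeasure_density) auto
    also have "\<dots> = (\<integral>\<^sup>+z. ?F z * indicator {z. bdist a z < R} z \<partial>dA)"
      by (intro nn_integral_cong) (auto split: split_indicator)
    also have "\<dots> \<le> ennreal (carleson_const p * R powr p)"
      using test_sum_carleson[OF a] R a by simp
    finally show "emeasure (density dA ?F) {z \<in> space (density dA ?F). bdist a z < R} \<le> ennreal (carleson_const p * R powr p)" .
  qed (use a p carleson_const_nonneg in auto)
  finally have far: "(\<integral>\<^sup>+z. ?F z * ?S z \<partial>dA) \<le> ennreal (carleson_const p * shell_const p (2 * p) * (1 - cmod a) powr - p)"
    by simp
  have near: "(\<integral>\<^sup>+z. ?B z \<partial>dA) \<le> ennreal (8 * (1 - cmod a))"
    using inverse_distance_integral[of "2 * (1 - cmod a)" a] a by simp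
  have "(\<integral>\<^sup>+z. ennreal ((cmod (test_sum E b z))\<^sup>2 * green_disc z a powr p) \<partial>dA)
     \<le> (\<integral>\<^sup>+z. ennreal (8 * (1 - cmod a) powr p) * (?F z * ?S z) + ennreal (2048\<^sup>2 * 64 / (1 - cmod a)) * ?B z \<partial>dA)"
    by (intro nn_integral_mono test_sum_green_pointwise a) simp
  also have "\<dots> = ennreal (8 * (1 - cmod a) powr p) * (\<integral>\<^sup>+z. ?F z * ?S z \<partial>dA) + ennreal (2048\<^sup>2 * 64 / (1 - cmod a)) * (\<integral>\<^sup>+z. ?B z \<partial>dA)"
    by (subst nn_integral_add, measurable, subst nn_integral_cmult, measurable, subst nn_integral_cmult, measurable)
  also have "\<dots> \<le> ennreal (8 * (1 - cmod a) powr p) * ennreal (carleson_const p * shell_const p (2 * p) * (1 - cmod a) powr - p)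
      + ennreal (2048\<^sup>2 * 64 / (1 - cmod a)) * ennreal (8 * (1 - cmod a))"
    by (intro add_mono mult_left_mono far near) auto
  also have "\<dots> = ennreal (8 * (1 - cmod a) powr p * (carleson_const p * shell_const p (2 * p) * (1 - cmod a) powr - p)
      + 2048\<^sup>2 * 64 / (1 - cmod a) * (8 * (1 - cmod a)))"
  proof -
    have *: "ennreal x * ennreal y + ennreal u * ennreal v = ennreal (x * y + u * v)"
      if "0 \<le> x" "0 \<le> y" "0 \<le> u" "0 \<le> v" for x y u v
      using that by (simp add: ennreal_plus ennreal_mult)
    show ?thesis
      by (rule *) (use a p carleson_const_nonneg shell_const_nonneg[of p "2 * p"] in auto)
  qed
  also have "8 * (1 - cmod a) powr p * (carleson_const p * shell_const p (2 * p) * (1 - cmod a) powr - p)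
      + 2048\<^sup>2 * 64 / (1 - cmod a) * (8 * (1 - cmod a)) = qp_const p"
  proof -
    have *: "8 * t powr p * (x * t powr - p) + 2048\<^sup>2 * 64 / t * (8 * t) = 8 * x + 2048\<^sup>2 * 512" if "0 < t" for t x :: real
      using that by (simp add: powr_minus)
    show ?thesis unfolding qp_const_def by (rule *) (use a in simp)
  qed
  finally show ?thesis .
qed

lemma test_function:
  obtains f where "f \<in> Qp_space p" "Qp_norm p f \<le> sqrt (qp_const p)"
    "\<And>z. z \<in> unit_disc \<Longrightarrow> deriv f z = test_sum E b z"
proof -
  obtain g where g: "\<And>z. z \<in> unit_disc \<Longrightarrow> (g has_field_derivative test_sum E b z) (at z)"
    using holomorphic_convex_primitive'[OF _ _ test_sum_holomorphic[OF E(2)]]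
    by (metis at_within_open convex_ball open_ball)
  define f where "f z = g z - g 0" for z
  have f: "(f has_field_derivative test_sum E b z) (at z)" if "z \<in> unit_disc" for z
    unfolding f_def[abs_def] using g[OF that] by (auto intro!: derivative_eq_intros)
  have deriv: "deriv f z = test_sum E b z" if "z \<in> unit_disc" for z
    by (rule DERIV_imp_deriv[OF f[OF that]])
  have hol: "f holomorphic_on unit_disc"
    unfolding holomorphic_on_open[OF open_ball] using f by blast
  have semi: "Qp_seminorm_sq p f \<le> ennreal (qp_const p)"
    unfolding Qp_seminorm_sq_def
  proof (rule SUP_least)
    fix a assume "a \<in> unit_disc"
    then have a: "cmod a < 1" by simp
    have "(\<integral>\<^sup>+z. ennreal ((cmod (deriv f z))\<^sup>2 * green_disc z a powr p) \<partial>dA)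
        = (\<integral>\<^sup>+z. ennreal ((cmod (test_sum E b z))\<^sup>2 * green_disc z a powr p) \<partial>dA)"
      using deriv by (intro nn_integral_cong) simp
    then show "(\<integral>\<^sup>+z. ennreal ((cmod (deriv f z))\<^sup>2 * green_disc z a powr p) \<partial>dA) \<le> ennreal (qp_const p)"
      using test_sum_green_integral[OF a] by simp
  qed
  have "f \<in> Qp_space p" using hol semi by (auto simp: Qp_space_def intro: le_less_trans)
  moreover have "Qp_norm p f \<le> sqrt (qp_const p)"
    using enn2real_mono[OF semi] qp_const_pos[OF p] by (simp add: Qp_norm_def f_def)
  ultimately show thesis using deriv by (rule that)
qed

end

end

section \<open>Carleson embedding\<close>

lemma null_singleton_dA: "AE z in dA. z \<noteq> a"
proof (cases "cmod a < 1")
  case True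
  have "emeasure dA {a} = ennreal (1 / pi) * emeasure lborel {a}"
    using True by (intro emeasure_dA_borel) auto
  then have "{a} \<in> null_sets dA" using True by (auto simp: null_sets_def intro!: sets_dA_borel)
  then show ?thesis by (rule AE_I'[of _ _ ]) auto
next
  case False
  then show ?thesis by (intro AE_I2) auto
qed

context whitney_tree
begin

text \<open>
  The radius is small enough to keep \<open>1 - |\<zeta>|\<close> comparable with \<open>|I|\<close>.
\<close>

definition box_nbhd :: "complex set \<Rightarrow> complex set" where
  "box_nbhd I = (\<Union>z\<in>upper_half_box I. ball z (arc_len I / 4))"

lemma box_nbhd_bounds:
  assumes "I \<in> D" "\<zeta> \<in> box_nbhd I"
  shows "arc_len I / 4 < 1 - cmod \<zeta>" "1 - cmod \<zeta> < 5 / 4 * arc_len I"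
proof -
  obtain z where z: "z \<in> upper_half_box I" "cmod (z - \<zeta>) < arc_len I / 4"
    using assms(2) by (auto simp: box_nbhd_def dist_norm)
  have "\<bar>cmod z - cmod \<zeta>\<bar> < arc_len I / 4" using norm_triangle_ineq3[of z \<zeta>] z(2) by linarith
  then show "arc_len I / 4 < 1 - cmod \<zeta>" "1 - cmod \<zeta> < 5 / 4 * arc_len I"
    using box_norm[OF assms(1) z(1)] by linarith+
qed

lemma box_nbhd_disc: "I \<in> D \<Longrightarrow> box_nbhd I \<subseteq> unit_disc"
  using box_nbhd_bounds(1) len_pos by fastforce

lemma box_nbhd_measurable [measurable]: "I \<in> D \<Longrightarrow> box_nbhd I \<in> sets dA"
  using box_nbhd_disc by (intro sets_dA_borel) (auto simp: box_nbhd_def intro!: borel_open open_UN)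

lemma box_nbhd_near_ancestor:
  assumes "I \<in> D" "J \<in> D" "I \<subseteq> J" "\<zeta> \<in> box_nbhd I"
  shows "cmod (\<zeta> - w J) < 7 * arc_len J"
proof -
  obtain z where z: "z \<in> upper_half_box I" "cmod (z - \<zeta>) < arc_len I / 4"
    using assms(4) by (auto simp: box_nbhd_def dist_norm)
  have "cmod (\<zeta> - w J) \<le> cmod (\<zeta> - z) + cmod (z - w J)" by (metis add_diff_eq diff_add_cancel norm_triangle_ineq)
  moreover have "cmod (z - w J) < 6 * arc_len J" by (rule box_near_ancestor[OF assms(1-3) z(1)])
  moreover have "arc_len I \<le> arc_len J"
  proof -
    obtain i j where ij: "I \<in> G i" "J \<in> G j" using assms by (meson D_levelE)
    show ?thesis unfolding len_G[OF ij(1)] len_G[OF ij(2)]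
      using subset_level[OF ij assms(3)] by (intro divide_left_mono power_increasing) auto
  qed
  ultimately show ?thesis using z(2) len_pos[OF assms(1)] by (simp add: norm_minus_commute)
qed

text \<open>
  An arc whose enlarged box contains \<open>\<zeta>\<close> has length comparable with \<open>1 - |\<zeta>|\<close>, and its inner disc lies in the ball
  of radius \<open>32 (1 - |\<zeta>|)\<close> about \<open>\<zeta>\<close>. Packing bounds the number of such arcs by \<open>65536 * 25 / 16 = 102400\<close>.
\<close>

lemma box_nbhd_overlap:
  assumes F: "finite F" "F \<subseteq> D" and \<zeta>: "cmod \<zeta> < 1"
  shows "card {I \<in> F. \<zeta> \<in> box_nbhd I} \<le> 102400"
proof -
  let ?N = "{I \<in> F. \<zeta> \<in> box_nbhd I}"
  define t where "t = 1 - cmod \<zeta>"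
  have t: "0 < t" using \<zeta> by (simp add: t_def)
  have "(\<Sum>I\<in>?N. (arc_len I)\<^sup>2) \<le> 64 * (32 * t)\<^sup>2"
  proof (rule packing)
    fix I assume "I \<in> ?N"
    then have I: "I \<in> D" "\<zeta> \<in> box_nbhd I" using F by auto
    have "cmod (\<zeta> - w I) < 7 * arc_len I" by (rule box_nbhd_near_ancestor[OF I(1) I(1) _ I(2)]) simp
    moreover have "arc_len I < 4 * t" using box_nbhd_bounds(1)[OF I] by (simp add: t_def)
    ultimately show "ball (w I) (arc_len I / 8) \<subseteq> ball \<zeta> (32 * t)"
      using len_pos[OF I(1)] by (subst ball_subset_ball_iff) (auto simp: dist_norm norm_minus_commute)
  qed (use F t in auto)
  moreover have "(\<Sum>I\<in>?N. (4 / 5 * t)\<^sup>2) \<le> (\<Sum>I\<in>?N. (arc_len I)\<^sup>2)"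
  proof (rule sum_mono)
    fix I assume "I \<in> ?N"
    then have I: "I \<in> D" "\<zeta> \<in> box_nbhd I" using F by auto
    show "(4 / 5 * t)\<^sup>2 \<le> (arc_len I)\<^sup>2"
      using box_nbhd_bounds(2)[OF I] t by (intro power_mono) (auto simp: t_def)
  qed
  moreover have "(\<Sum>I\<in>?N. (4 / 5 * t)\<^sup>2) = real (card ?N) * (16 / 25) * t\<^sup>2"
    by (simp add: power_mult_distrib power_divide)
  moreover have "64 * (32 * t)\<^sup>2 = 65536 * t\<^sup>2" by (simp add: power_mult_distrib)
  ultimately have "real (card ?N) * (16 / 25) * t\<^sup>2 \<le> 65536 * t\<^sup>2" by linarith
  then have "real (card ?N) * (16 / 25) \<le> 65536"
    using t by (simp only: mult_le_cancel_right_pos zero_less_power)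
  then show ?thesis by linarith
qed

definition local_energy :: "real \<Rightarrow> (complex \<Rightarrow> complex) \<Rightarrow> complex set \<Rightarrow> ennreal" where
  "local_energy p g I = (\<integral>\<^sup>+\<zeta>. ennreal ((cmod (g \<zeta>))\<^sup>2 * (1 - cmod \<zeta>) powr p) * indicator (box_nbhd I) \<zeta> \<partial>dA)"

text \<open>
  The mean value property of \<open>g\<^sup>2\<close> on a disc of radius \<open>|I| / 4\<close>, on which \<open>|I|\<^sup>p \<le> 4 (1 - |u|)\<^sup>p\<close>.
\<close>

lemma sq_le_local_energy:
  assumes g: "g holomorphic_on unit_disc" and p: "0 < p" "p \<le> 1" and I: "I \<in> D" and z: "z \<in> upper_half_box I"
  shows "ennreal ((cmod (g z))\<^sup>2) \<le> ennreal (64 / arc_len I powr (p + 2)) * local_energy p g I"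
proof -
  let ?l = "arc_len I"
  have l: "0 < ?l" by (rule len_pos[OF I])
  have gm[measurable]: "g \<in> borel_measurable dA"
    by (intro borel_measurable_dA_continuous holomorphic_on_imp_continuous_on g)
  have nb: "ball z (?l / 4) \<subseteq> box_nbhd I" using z by (auto simp: box_nbhd_def)
  have "ennreal (norm ((g z)\<^sup>2)) * ennreal ((?l / 4)\<^sup>2) \<le> (\<integral>\<^sup>+u\<in>ball z (?l / 4). ennreal (norm ((g u)\<^sup>2)) \<partial>dA)"
    using nb box_nbhd_disc[OF I] l by (intro area_submean holomorphic_intros g) auto
  also have "\<dots> \<le> (\<integral>\<^sup>+u. ennreal (4 / ?l powr p) * (ennreal ((cmod (g u))\<^sup>2 * (1 - cmod u) powr p) * indicator (box_nbhd I) u) \<partial>dA)"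
  proof (rule nn_integral_mono)
    fix u assume "u \<in> space dA"
    show "ennreal (norm ((g u)\<^sup>2)) * indicator (ball z (?l / 4)) u
        \<le> ennreal (4 / ?l powr p) * (ennreal ((cmod (g u))\<^sup>2 * (1 - cmod u) powr p) * indicator (box_nbhd I) u)"
    proof (cases "u \<in> ball z (?l / 4)")
      case True
      then have u: "u \<in> box_nbhd I" using nb by auto
      have "?l powr p \<le> (4 * (1 - cmod u)) powr p"
        using box_nbhd_bounds(1)[OF I u] l p by (intro powr_mono2) auto
      also have "\<dots> = 4 powr p * (1 - cmod u) powr p" by (rule powr_mult)
      also have "\<dots> \<le> 4 * (1 - cmod u) powr p"
        using powr_mono[of p 1 "4::real"] p by (intro mult_right_mono) auto
      finally have "1 \<le> 4 / ?l powr p * (1 - cmod u) powr p" using l by (simp add: field_simps)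
      then have "(cmod (g u))\<^sup>2 * 1 \<le> (cmod (g u))\<^sup>2 * (4 / ?l powr p * (1 - cmod u) powr p)"
        by (rule mult_left_mono) simp
      then have "ennreal ((cmod (g u))\<^sup>2) \<le> ennreal (4 / ?l powr p * ((cmod (g u))\<^sup>2 * (1 - cmod u) powr p))"
        by (intro ennreal_leI) (simp add: mult_ac)
      also have "\<dots> = ennreal (4 / ?l powr p) * ennreal ((cmod (g u))\<^sup>2 * (1 - cmod u) powr p)"
        by (rule ennreal_mult) auto
      finally show ?thesis using True u by (simp add: norm_power)
    qed simp
  qed
  also have "\<dots> = ennreal (4 / ?l powr p) * local_energy p g I"
    unfolding local_energy_def using I by (intro nn_integral_cmult) measurable
  finally have "ennreal (16 / ?l\<^sup>2) * (ennreal ((cmod (g z))\<^sup>2) * ennreal ((?l / 4)\<^sup>2))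
      \<le> ennreal (16 / ?l\<^sup>2) * (ennreal (4 / ?l powr p) * local_energy p g I)"
    by (intro mult_left_mono) (auto simp: norm_power)
  also have "ennreal (16 / ?l\<^sup>2) * (ennreal ((cmod (g z))\<^sup>2) * ennreal ((?l / 4)\<^sup>2)) = ennreal (16 / ?l\<^sup>2 * ((cmod (g z))\<^sup>2 * (?l / 4)\<^sup>2))"
    by (simp flip: ennreal_mult')
  also have "16 / ?l\<^sup>2 * ((cmod (g z))\<^sup>2 * (?l / 4)\<^sup>2) = (cmod (g z))\<^sup>2"
    using l by (simp add: power_divide)
  also have "ennreal (16 / ?l\<^sup>2) * (ennreal (4 / ?l powr p) * local_energy p g I)
      = ennreal (16 / ?l\<^sup>2 * (4 / ?l powr p)) * local_energy p g I"
    by (subst ennreal_mult) (auto simp: mult.assoc)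
  also have "16 / ?l\<^sup>2 * (4 / ?l powr p) = 64 / ?l powr (p + 2)"
    using l by (simp add: powr_add powr_numeral)
  finally show ?thesis .
qed

text \<open>
  Test the seminorm at \<open>a = w\<^sub>J\<close>. The enlarged boxes of all \<open>I \<subseteq> J\<close> stay within \<open>7 |J|\<close> of \<open>a\<close>, where
  \<open>1 - |\<zeta>| \<le> 216 |J| g(\<zeta>, a)\<close>; the overlap contributes the factor \<open>102400\<close>, and \<open>102400 * 216 = 22118400\<close>.
\<close>

lemma local_energy_carleson:
  assumes g[measurable]: "g \<in> borel_measurable dA" and p: "0 < p" "p \<le> 1" and F: "finite F" "F \<subseteq> D" and J: "J \<in> D"
    and S: "\<And>a. a \<in> unit_disc \<Longrightarrow> (\<integral>\<^sup>+z. ennreal ((cmod (g z))\<^sup>2 * green_disc z a powr p) \<partial>dA) \<le> S"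
  shows "(\<Sum>I | I \<in> F \<and> I \<subseteq> J. local_energy p g I) \<le> ennreal (22118400 * arc_len J powr p) * S"
proof -
  let ?P = "\<lambda>\<zeta>. ennreal ((cmod (g \<zeta>))\<^sup>2 * (1 - cmod \<zeta>) powr p)"
  let ?l = "arc_len J" and ?a = "w J"
  have l: "0 < ?l" by (rule len_pos[OF J])
  have a: "cmod ?a < 1" by (rule norm_w_less_1[OF J])
  have "(\<Sum>I | I \<in> F \<and> I \<subseteq> J. local_energy p g I)
      = (\<integral>\<^sup>+\<zeta>. (\<Sum>I | I \<in> F \<and> I \<subseteq> J. ?P \<zeta> * indicator (box_nbhd I) \<zeta>) \<partial>dA)"
    unfolding local_energy_def using F by (intro nn_integral_sum[symmetric]) (auto simp: subset_eq)
  also have "\<dots> \<le> (\<integral>\<^sup>+\<zeta>. ennreal (22118400 * ?l powr p) * ennreal ((cmod (g \<zeta>))\<^sup>2 * green_disc \<zeta> ?a powr p) \<partial>dA)"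
  (* Green's function has the value 0 at its pole, where the lower bound fails. *)
  proof (rule nn_integral_mono_AE, use null_singleton_dA[of ?a] in eventually_elim)
    fix \<zeta> assume "\<zeta> \<noteq> ?a"
    show "(\<Sum>I | I \<in> F \<and> I \<subseteq> J. ?P \<zeta> * indicator (box_nbhd I) \<zeta>) \<le> ennreal (22118400 * ?l powr p) * ennreal ((cmod (g \<zeta>))\<^sup>2 * green_disc \<zeta> ?a powr p)"
    proof (cases "\<exists>I. I \<in> F \<and> I \<subseteq> J \<and> \<zeta> \<in> box_nbhd I")
      case False
      then have "(\<Sum>I | I \<in> F \<and> I \<subseteq> J. ?P \<zeta> * indicator (box_nbhd I) \<zeta>) = 0"
        by (intro sum.neutral) auto
      then show ?thesis by simp
    next
      case True
      then obtain I where I: "I \<in> D" "I \<subseteq> J" "\<zeta> \<in> box_nbhd I" using F by auto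
      have \<zeta>: "cmod \<zeta> < 1" using box_nbhd_disc[OF I(1)] I(3) by auto
      have "(\<Sum>I | I \<in> F \<and> I \<subseteq> J. ?P \<zeta> * indicator (box_nbhd I) \<zeta>) = (\<Sum>I | I \<in> F \<and> I \<subseteq> J \<and> \<zeta> \<in> box_nbhd I. ?P \<zeta>)"
        using F by (intro sum.mono_neutral_cong_right) auto
      also have "\<dots> = of_nat (card {I. I \<in> F \<and> I \<subseteq> J \<and> \<zeta> \<in> box_nbhd I}) * ?P \<zeta>" by simp
      also have "\<dots> \<le> of_nat 102400 * ?P \<zeta>"
      proof (intro mult_right_mono of_nat_mono)
        have "card {I. I \<in> F \<and> I \<subseteq> J \<and> \<zeta> \<in> box_nbhd I} \<le> card {I \<in> F. \<zeta> \<in> box_nbhd I}"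
          using F by (intro card_mono) auto
        also have "\<dots> \<le> 102400" by (rule box_nbhd_overlap[OF F \<zeta>])
        finally show "card {I. I \<in> F \<and> I \<subseteq> J \<and> \<zeta> \<in> box_nbhd I} \<le> 102400" .
      qed simp
      also have "of_nat 102400 * ?P \<zeta> = ennreal (102400 * ((cmod (g \<zeta>))\<^sup>2 * (1 - cmod \<zeta>) powr p))"
        by (simp add: ennreal_mult)
      also have "\<dots> \<le> ennreal (102400 * ((cmod (g \<zeta>))\<^sup>2 * (216 * ?l powr p * green_disc \<zeta> ?a powr p)))"
      proof (intro ennreal_leI mult_left_mono)
        have "cmod (\<zeta> - ?a) < 7 * ?l" by (rule box_nbhd_near_ancestor[OF I(1) J I(2,3)])
        then have b: "bdist ?a \<zeta> \<le> 9 * ?l" using bdist_le_dist[OF a, of \<zeta>] norm_w[OF J] l by simp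
        have d: "0 < bdist ?a \<zeta>" by (rule bdist_pos[OF a \<zeta>])
        have one: "1 - t \<le> 1 - t\<^sup>2" if "0 \<le> t" "t < 1" for t :: real
          using that by (simp add: power2_eq_square mult_left_le)
        have "(3 / 4 * ?l) * (1 - cmod \<zeta>) / (9 * ?l)\<^sup>2 \<le> (1 - (cmod ?a)\<^sup>2) * (1 - (cmod \<zeta>)\<^sup>2) / (bdist ?a \<zeta>)\<^sup>2"
        proof (intro frac_le mult_mono)
          show "3 / 4 * ?l \<le> 1 - (cmod ?a)\<^sup>2" using one[OF norm_ge_zero a] norm_w[OF J] by linarith
          show "1 - cmod \<zeta> \<le> 1 - (cmod \<zeta>)\<^sup>2" using one[of "cmod \<zeta>"] \<zeta> by simp
          show "(bdist ?a \<zeta>)\<^sup>2 \<le> (9 * ?l)\<^sup>2" using b d by (intro power_mono) auto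
        qed (use d l \<zeta> a in \<open>auto simp: power_le_one\<close>)
        also have "\<dots> \<le> 2 * green_disc \<zeta> ?a" by (rule green_lower[OF a \<zeta> \<open>\<zeta> \<noteq> ?a\<close>])
        also have "(3 / 4 * ?l) * (1 - cmod \<zeta>) / (9 * ?l)\<^sup>2 = (1 - cmod \<zeta>) / (108 * ?l)"
          using l by (simp add: power2_eq_square field_simps)
        finally have "1 - cmod \<zeta> \<le> 2 * green_disc \<zeta> ?a * (108 * ?l)"
          using l by (subst (asm) pos_divide_le_eq) auto
        then have "1 - cmod \<zeta> \<le> 216 * ?l * green_disc \<zeta> ?a" by (simp add: mult_ac)
        then have "(1 - cmod \<zeta>) powr p \<le> (216 * ?l * green_disc \<zeta> ?a) powr p"
          using \<zeta> p by (intro powr_mono2) auto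
        also have "\<dots> = 216 powr p * ?l powr p * green_disc \<zeta> ?a powr p" by (simp add: powr_mult)
        also have "\<dots> \<le> 216 * ?l powr p * green_disc \<zeta> ?a powr p"
          using powr_mono[of p 1 "216::real"] p by (intro mult_right_mono) auto
        finally show "(1 - cmod \<zeta>) powr p \<le> 216 * ?l powr p * green_disc \<zeta> ?a powr p" .
      qed auto
      also have "102400 * ((cmod (g \<zeta>))\<^sup>2 * (216 * ?l powr p * green_disc \<zeta> ?a powr p))
          = 22118400 * ?l powr p * ((cmod (g \<zeta>))\<^sup>2 * green_disc \<zeta> ?a powr p)" by simp
      also have "ennreal \<dots> = ennreal (22118400 * ?l powr p) * ennreal ((cmod (g \<zeta>))\<^sup>2 * green_disc \<zeta> ?a powr p)"
        by (rule ennreal_mult) auto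
      finally show ?thesis .
    qed
  qed
  also have "\<dots> = ennreal (22118400 * ?l powr p) * (\<integral>\<^sup>+\<zeta>. ennreal ((cmod (g \<zeta>))\<^sup>2 * green_disc \<zeta> ?a powr p) \<partial>dA)"
  proof (rule nn_integral_cmult)
    have [measurable]: "(\<lambda>z. cmod (z - ?a)) \<in> borel_measurable dA"
      by (intro borel_measurable_dA borel_measurable_continuous_onI continuous_intros)
    show "(\<lambda>\<zeta>. ennreal ((cmod (g \<zeta>))\<^sup>2 * green_disc \<zeta> ?a powr p)) \<in> borel_measurable dA"
      unfolding green_disc_eq by measurable
  qed
  also have "\<dots> \<le> ennreal (22118400 * ?l powr p) * S" using a by (intro mult_left_mono S) auto
  finally show ?thesis .
qed

lemma box_measurable [measurable]: "I \<in> D \<Longrightarrow> upper_half_box I \<in> sets dA"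
  using box_subset_disc by (intro sets_dA_borel upper_half_box_borel half_open_arc_D) auto

lemma divide_ennreal_real: "0 < c \<Longrightarrow> x / ennreal c = ennreal (1 / c) * x"
  by (simp add: divide_ennreal_def inverse_ennreal divide_inverse mult.commute)

text \<open>
  Weak duality: bound the integral over each box by local energy times box average, insert the
  covering condition, and sum over \<open>I \<subseteq> J\<close> before summing over \<open>J\<close>. Working with the finitely many boxes of the first
  levels and passing to the limit at the end avoids double series.
\<close>

lemma weighted_embedding:
  assumes g: "g holomorphic_on unit_disc" and p: "0 < p" "p \<le> 1"
    and S: "\<And>a. a \<in> unit_disc \<Longrightarrow> (\<integral>\<^sup>+z. ennreal ((cmod (g z))\<^sup>2 * green_disc z a powr p) \<partial>dA) \<le> S"
    and V[measurable]: "V \<in> borel_measurable dA"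
    and l: "\<And>J. J \<in> D \<Longrightarrow> 0 \<le> l J"
      "\<And>I. I \<in> D \<Longrightarrow> box_average p V I \<le> (\<Sum>\<^sub>\<infinity>J\<in>{J \<in> D. I \<subseteq> J}. ennreal (l J))"
  shows "(\<integral>\<^sup>+z. ennreal ((cmod (g z))\<^sup>2) * ennreal (V z) \<partial>dA)
    \<le> ennreal (64 * 22118400) * S * (\<Sum>\<^sub>\<infinity>J\<in>D. ennreal (l J * arc_len J powr p))"
proof -
  let ?f = "\<lambda>z. ennreal ((cmod (g z))\<^sup>2) * ennreal (V z)"
  have gm[measurable]: "g \<in> borel_measurable dA"
    by (intro borel_measurable_dA_continuous holomorphic_on_imp_continuous_on g)
  let ?K = "\<Sum>\<^sub>\<infinity>J\<in>D. ennreal (l J * arc_len J powr p)"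
  define E where "E n = (\<Union>k\<le>n. G k)" for n
  have E: "finite (E n)" "E n \<subseteq> D" for n using finite_G G_subset_D by (auto simp: E_def)
  have box: "(\<integral>\<^sup>+z. ?f z * indicator (upper_half_box I) z \<partial>dA) \<le> 64 * (local_energy p g I * box_average p V I)"
    if I: "I \<in> D" for I
  proof -
    have "(\<integral>\<^sup>+z. ?f z * indicator (upper_half_box I) z \<partial>dA)
       \<le> (\<integral>\<^sup>+z. ennreal (64 / arc_len I powr (p + 2)) * local_energy p g I * (ennreal (V z) * indicator (upper_half_box I) z) \<partial>dA)"
      using sq_le_local_energy[OF g p I]
      by (intro nn_integral_mono) (auto split: split_indicator intro!: mult_right_mono)
    also have "\<dots> = ennreal (64 / arc_len I powr (p + 2)) * local_energy p g I * (\<integral>\<^sup>+z. ennreal (V z) * indicator (upper_half_box I) z \<partial>dA)"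
      using I by (intro nn_integral_cmult) measurable
    also have "\<dots> = 64 * (local_energy p g I * box_average p V I)"
    proof -
      have "0 < arc_len I powr (p + 2)" using len_pos[OF I] by simp
      then show ?thesis unfolding box_average_def
        by (subst divide_ennreal_real) (auto simp: ennreal_mult[of 64 "1 / _", simplified] mult_ac)
    qed
    finally show ?thesis .
  qed
  have fin: "(\<Sum>I\<in>F. local_energy p g I * box_average p V I) \<le> ennreal 22118400 * S * ?K" if F: "finite F" "F \<subseteq> D" for F
  proof -
    define A where "A = (\<Union>I\<in>F. {J \<in> D. I \<subseteq> J})"
    have A: "finite A" "A \<subseteq> D" using F finite_ancestors by (auto simp: A_def)
    have "(\<Sum>I\<in>F. local_energy p g I * box_average p V I) \<le> (\<Sum>I\<in>F. \<Sum>J | J \<in> A \<and> I \<subseteq> J. local_energy p g I * ennreal (l J))"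
    proof (rule sum_mono)
      fix I assume I: "I \<in> F"
      then have ID: "I \<in> D" using F by auto
      have "{J. J \<in> A \<and> I \<subseteq> J} = {J \<in> D. I \<subseteq> J}" using I by (auto simp: A_def)
      then have "box_average p V I \<le> (\<Sum>J | J \<in> A \<and> I \<subseteq> J. ennreal (l J))"
        using l(2)[OF ID] finite_ancestors[OF ID] by simp
      then have "local_energy p g I * box_average p V I \<le> local_energy p g I * (\<Sum>J | J \<in> A \<and> I \<subseteq> J. ennreal (l J))"
        by (rule mult_left_mono) simp
      then show "local_energy p g I * box_average p V I \<le> (\<Sum>J | J \<in> A \<and> I \<subseteq> J. local_energy p g I * ennreal (l J))"
        by (simp add: sum_distrib_left)
    qed
    also have "\<dots> = (\<Sum>J\<in>A. \<Sum>I | I \<in> F \<and> I \<subseteq> J. local_energy p g I * ennreal (l J))"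
      by (rule sum.swap_restrict[OF F(1) A(1)])
    also have "\<dots> \<le> (\<Sum>J\<in>A. ennreal 22118400 * S * ennreal (l J * arc_len J powr p))"
    proof (rule sum_mono)
      fix J assume "J \<in> A"
      then have J: "J \<in> D" using A by auto
      have "(\<Sum>I | I \<in> F \<and> I \<subseteq> J. local_energy p g I * ennreal (l J)) = (\<Sum>I | I \<in> F \<and> I \<subseteq> J. local_energy p g I) * ennreal (l J)"
        by (simp add: sum_distrib_right)
      also have "\<dots> \<le> ennreal (22118400 * arc_len J powr p) * S * ennreal (l J)"
        by (intro mult_right_mono local_energy_carleson gm p F J S) auto
      also have "\<dots> = ennreal 22118400 * S * ennreal (l J * arc_len J powr p)"
        using l(1)[OF J] by (simp add: ennreal_mult mult_ac)
      finally show "(\<Sum>I | I \<in> F \<and> I \<subseteq> J. local_energy p g I * ennreal (l J)) \<le> ennreal 22118400 * S * ennreal (l J * arc_len J powr p)" .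
    qed
    also have "\<dots> = ennreal 22118400 * S * (\<Sum>J\<in>A. ennreal (l J * arc_len J powr p))"
      by (simp add: sum_distrib_left)
    also have "\<dots> \<le> ennreal 22118400 * S * ?K"
    proof (rule mult_left_mono)
      have "?K = (SUP F\<in>{F. finite F \<and> F \<subseteq> D}. \<Sum>J\<in>F. ennreal (l J * arc_len J powr p))"
        by (rule nonneg_infsum_complete) simp
      then show "(\<Sum>J\<in>A. ennreal (l J * arc_len J powr p)) \<le> ?K" using A by (auto intro: SUP_upper)
    qed simp
    finally show ?thesis .
  qed
  define U where "U n = (\<Union>I\<in>E n. upper_half_box I)" for n
  have U[measurable]: "U n \<in> sets dA" for n unfolding U_def using E(1) subsetD[OF E(2)] box_measurable by (intro sets.finite_UN) blast+
  have "(\<integral>\<^sup>+z. ?f z \<partial>dA) = (\<integral>\<^sup>+z. (SUP n. ?f z * indicator (U n) z) \<partial>dA)"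
  proof (rule nn_integral_cong)
    fix z assume "z \<in> space dA"
    then obtain I where I: "I \<in> D" "z \<in> upper_half_box I" using boxes_cover[of z] by auto
    then obtain k where "I \<in> G k" using D_levelE by blast
    then have "z \<in> U k" using I by (auto simp: U_def E_def)
    show "?f z = (SUP n. ?f z * indicator (U n) z)"
    proof (rule antisym)
      have "?f z * indicator (U k) z \<le> (SUP n. ?f z * indicator (U n) z)" by (rule SUP_upper) simp
      then show "?f z \<le> (SUP n. ?f z * indicator (U n) z)" using \<open>z \<in> U k\<close> by simp
      show "(SUP n. ?f z * indicator (U n) z) \<le> ?f z" by (rule SUP_least) (auto split: split_indicator)
    qed
  qed
  also have "\<dots> = (SUP n. \<integral>\<^sup>+z. ?f z * indicator (U n) z \<partial>dA)"
  proof (rule nn_integral_monotone_convergence_SUP)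
    show "incseq (\<lambda>n z. ?f z * indicator (U n) z)"
    proof (intro incseq_SucI le_funI mult_left_mono)
      fix n z
      have "U n \<subseteq> U (Suc n)" by (auto simp: U_def E_def atMost_Suc)
      then show "indicator (U n) z \<le> (indicator (U (Suc n)) z :: ennreal)" by (auto split: split_indicator)
    qed simp
  qed measurable
  also have "\<dots> \<le> ennreal (64 * 22118400) * S * ?K"
  proof (rule SUP_least)
    fix n
    have "(\<integral>\<^sup>+z. ?f z * indicator (U n) z \<partial>dA) \<le> (\<integral>\<^sup>+z. (\<Sum>I\<in>E n. ?f z * indicator (upper_half_box I) z) \<partial>dA)"
    proof (rule nn_integral_mono)
      fix z
      show "?f z * indicator (U n) z \<le> (\<Sum>I\<in>E n. ?f z * indicator (upper_half_box I) z)"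
      proof (cases "z \<in> U n")
        case True
        then obtain I where I: "I \<in> E n" "z \<in> upper_half_box I" by (auto simp: U_def)
        have "?f z * indicator (upper_half_box I) z \<le> (\<Sum>I\<in>E n. ?f z * indicator (upper_half_box I) z)"
          by (rule member_le_sum) (use I E in auto)
        then show ?thesis using True I by simp
      qed simp
    qed
    also have "\<dots> = (\<Sum>I\<in>E n. \<integral>\<^sup>+z. ?f z * indicator (upper_half_box I) z \<partial>dA)"
    proof (rule nn_integral_sum)
      fix I assume "I \<in> E n"
      then have [measurable]: "upper_half_box I \<in> sets dA" using E(2) box_measurable by blast
      show "(\<lambda>z. ?f z * indicator (upper_half_box I) z) \<in> borel_measurable dA" by measurable
    qed
    also have "\<dots> \<le> (\<Sum>I\<in>E n. 64 * (local_energy p g I * box_average p V I))"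
      using box E by (intro sum_mono) auto
    also have "\<dots> = 64 * (\<Sum>I\<in>E n. local_energy p g I * box_average p V I)"
      by (simp add: sum_distrib_left)
    also have "\<dots> \<le> 64 * (ennreal 22118400 * S * ?K)" by (intro mult_left_mono fin E) auto
    also have "\<dots> = ennreal (64 * 22118400) * S * ?K" by (simp add: ennreal_mult mult.assoc)
    finally show "(\<integral>\<^sup>+z. ?f z * indicator (U n) z \<partial>dA) \<le> ennreal (64 * 22118400) * S * ?K" .
  qed
  finally show ?thesis .
qed

text \<open>
  The Carleson condition for a single arc, combined with the mean value property. It makes bounded sets of
  \<open>\<Q>\<^sub>p\<close> accessible to Montel's theorem.
\<close>

lemma bloch_estimate:
  assumes g: "g holomorphic_on unit_disc" and p: "0 < p" "p \<le> 1"
    and S: "\<And>a. a \<in> unit_disc \<Longrightarrow> (\<integral>\<^sup>+z. ennreal ((cmod (g z))\<^sup>2 * green_disc z a powr p) \<partial>dA) \<le> ennreal S"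
    and S0: "0 \<le> S" and z: "cmod z < 1"
  shows "(cmod (g z))\<^sup>2 \<le> 64 * 22118400 * S / (1 - cmod z)\<^sup>2"
proof -
  obtain I where I: "I \<in> D" "z \<in> upper_half_box I" using boxes_cover[OF z] by auto
  let ?l = "arc_len I"
  have l: "0 < ?l" by (rule len_pos[OF I(1)])
  have gm: "g \<in> borel_measurable dA"
    by (intro borel_measurable_dA_continuous holomorphic_on_imp_continuous_on g)
  have "{I'. I' \<in> {I} \<and> I' \<subseteq> I} = {I}" by auto
  then have "local_energy p g I \<le> ennreal (22118400 * ?l powr p) * ennreal S"
    using local_energy_carleson[OF gm p, of "{I}" I "ennreal S"] I S by simp
  then have "ennreal ((cmod (g z))\<^sup>2) \<le> ennreal (64 / ?l powr (p + 2)) * (ennreal (22118400 * ?l powr p) * ennreal S)"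
    using sq_le_local_energy[OF g p I] by (meson mult_left_mono order_trans zero_le)
  also have "\<dots> = ennreal (64 / ?l powr (p + 2) * (22118400 * ?l powr p * S))"
  proof -
    have *: "ennreal x * (ennreal y * ennreal s) = ennreal (x * (y * s))"
      if "0 \<le> x" "0 \<le> y" "0 \<le> s" for x y s
      using that by (simp add: ennreal_mult)
    show ?thesis by (rule *) (use S0 in auto)
  qed
  finally have "(cmod (g z))\<^sup>2 \<le> 64 / ?l powr (p + 2) * (22118400 * ?l powr p * S)"
    using S0 by (subst (asm) ennreal_le_iff) auto
  also have "\<dots> = 64 * 22118400 * S / ?l\<^sup>2"
    using l by (simp add: powr_add powr_numeral)
  also have "\<dots> \<le> 64 * 22118400 * S / (1 - cmod z)\<^sup>2"
    using box_norm(1)[OF I] z S0 by (intro divide_left_mono power_mono mult_pos_pos) (auto simp: zero_less_power)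
  finally show ?thesis .
qed

end

section \<open>Bounding the gauge by test functions\<close>

lemma dyadic_gauge_cong:
  assumes "\<And>I. I \<in> D \<Longrightarrow> h I = h' I"
  shows "dyadic_gauge p D h = dyadic_gauge p D h'"
  unfolding dyadic_gauge_def using assms by simp

text \<open>
  A deterministic substitute for averaging over random signs. By the parallelogram law the energies of
  \<open>F + x\<^sub>j\<close> and \<open>F - x\<^sub>j\<close> have mean \<open>\<parallel>F\<parallel>\<^sup>2 + \<parallel>x\<^sub>j\<parallel>\<^sup>2\<close>, so one of the two signs loses nothing.
\<close>

lemma sign_choice:
  fixes x :: "'i \<Rightarrow> 'a \<Rightarrow> complex"
  assumes "finite E" and x: "\<And>i. i \<in> E \<Longrightarrow> x i \<in> borel_measurable M" and V[measurable]: "V \<in> borel_measurable M"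
  shows "\<exists>\<epsilon> :: 'i \<Rightarrow> real. (\<forall>i. \<epsilon> i = 1 \<or> \<epsilon> i = -1) \<and>
    (\<Sum>i\<in>E. \<integral>\<^sup>+z. ennreal ((cmod (x i z))\<^sup>2) * V z \<partial>M) \<le> (\<integral>\<^sup>+z. ennreal ((cmod (\<Sum>i\<in>E. of_real (\<epsilon> i) * x i z))\<^sup>2) * V z \<partial>M)"
  using assms(1,2)
proof (induction E rule: finite_induct)
  case empty
  then show ?case by (intro exI[of _ "\<lambda>_. 1"]) simp
next
  case (insert j E)
  then obtain \<epsilon> :: "'i \<Rightarrow> real" where \<epsilon>: "\<forall>i. \<epsilon> i = 1 \<or> \<epsilon> i = -1"
    and le: "(\<Sum>i\<in>E. \<integral>\<^sup>+z. ennreal ((cmod (x i z))\<^sup>2) * V z \<partial>M)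
      \<le> (\<integral>\<^sup>+z. ennreal ((cmod (\<Sum>i\<in>E. of_real (\<epsilon> i) * x i z))\<^sup>2) * V z \<partial>M)" by auto
  define F where "F z = (\<Sum>i\<in>E. of_real (\<epsilon> i) * x i z)" for z
  have [measurable]: "F \<in> borel_measurable M"
    unfolding F_def[abs_def] using insert.prems by (intro borel_measurable_sum borel_measurable_times) auto
  have [measurable]: "x j \<in> borel_measurable M" using insert.prems by simp
  let ?I = "\<lambda>f. \<integral>\<^sup>+z. ennreal ((cmod (f z))\<^sup>2) * V z \<partial>M"
  have parallelogram: "?I (\<lambda>z. F z + x j z) + ?I (\<lambda>z. F z - x j z) = 2 * (?I F + ?I (x j))"
  proof -
    have "?I (\<lambda>z. F z + x j z) + ?I (\<lambda>z. F z - x j z)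
        = (\<integral>\<^sup>+z. 2 * (ennreal ((cmod (F z))\<^sup>2) * V z + ennreal ((cmod (x j z))\<^sup>2) * V z) \<partial>M)"
    proof (subst nn_integral_add[symmetric])
      show "(\<integral>\<^sup>+z. ennreal ((cmod (F z + x j z))\<^sup>2) * V z + ennreal ((cmod (F z - x j z))\<^sup>2) * V z \<partial>M) =
        (\<integral>\<^sup>+z. 2 * (ennreal ((cmod (F z))\<^sup>2) * V z + ennreal ((cmod (x j z))\<^sup>2) * V z) \<partial>M)"
      proof (rule nn_integral_cong)
        fix z
        have par: "(cmod (F z + x j z))\<^sup>2 + (cmod (F z - x j z))\<^sup>2 = 2 * ((cmod (F z))\<^sup>2 + (cmod (x j z))\<^sup>2)"
          unfolding cmod_power2 by (simp add: power2_eq_square algebra_simps)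
        have "ennreal ((cmod (F z + x j z))\<^sup>2) + ennreal ((cmod (F z - x j z))\<^sup>2) = 2 * (ennreal ((cmod (F z))\<^sup>2) + ennreal ((cmod (x j z))\<^sup>2))"
        proof -
          have "ennreal ((cmod (F z + x j z))\<^sup>2) + ennreal ((cmod (F z - x j z))\<^sup>2)
              = ennreal ((cmod (F z + x j z))\<^sup>2 + (cmod (F z - x j z))\<^sup>2)" by simp
          also note par
          also have "ennreal (2 * ((cmod (F z))\<^sup>2 + (cmod (x j z))\<^sup>2)) = ennreal 2 * ennreal ((cmod (F z))\<^sup>2 + (cmod (x j z))\<^sup>2)"
            by (rule ennreal_mult) auto
          finally show ?thesis by simp
        qed
        then show "ennreal ((cmod (F z + x j z))\<^sup>2) * V z + ennreal ((cmod (F z - x j z))\<^sup>2) * V z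
            = 2 * (ennreal ((cmod (F z))\<^sup>2) * V z + ennreal ((cmod (x j z))\<^sup>2) * V z)"
          by (simp add: distrib_right[symmetric] mult.assoc[symmetric])
      qed
    qed measurable
    also have "\<dots> = 2 * (?I F + ?I (x j))"
      by (subst nn_integral_cmult, measurable, subst nn_integral_add, measurable)
    finally show ?thesis .
  qed
  have "?I (\<lambda>z. F z + x j z) + ?I (\<lambda>z. F z - x j z) \<le> 2 * max (?I (\<lambda>z. F z + x j z)) (?I (\<lambda>z. F z - x j z))"
    unfolding mult_2 by (intro add_mono) auto
  then have "2 * (?I F + ?I (x j)) \<le> 2 * max (?I (\<lambda>z. F z + x j z)) (?I (\<lambda>z. F z - x j z))"
    unfolding parallelogram .
  then have max: "?I F + ?I (x j) \<le> max (?I (\<lambda>z. F z + x j z)) (?I (\<lambda>z. F z - x j z))"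
    by (subst (asm) ennreal_mult_le_mult_iff) auto
  obtain s :: real where s: "s = 1 \<or> s = -1" "?I F + ?I (x j) \<le> ?I (\<lambda>z. F z + of_real s * x j z)"
  proof (cases "?I F + ?I (x j) \<le> ?I (\<lambda>z. F z + x j z)")
    case True then show thesis by (intro that[of 1]) auto
  next
    case False
    then show thesis using max by (intro that[of "-1"]) (auto simp: max_def split: if_splits)
  qed
  show ?case
  proof (intro exI[of _ "\<epsilon>(j := s)"] conjI allI)
    fix i show "(\<epsilon>(j := s)) i = 1 \<or> (\<epsilon>(j := s)) i = -1" using \<epsilon> s by auto
  next
    have "(\<Sum>i\<in>insert j E. ?I (x i)) = ?I (x j) + (\<Sum>i\<in>E. ?I (x i))" using insert by simp
    also have "\<dots> \<le> ?I F + ?I (x j)" using le unfolding F_def by (simp add: add.commute add_left_mono)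
    also have "\<dots> \<le> ?I (\<lambda>z. F z + of_real s * x j z)" by (rule s)
    also have "(\<lambda>z. F z + of_real s * x j z) = (\<lambda>z. \<Sum>i\<in>insert j E. of_real ((\<epsilon>(j := s)) i) * x i z)"
      using insert by (auto simp: F_def fun_eq_iff add.commute intro!: sum.cong)
    finally show "(\<Sum>i\<in>insert j E. ?I (x i)) \<le> ?I (\<lambda>z. \<Sum>i\<in>insert j E. of_real ((\<epsilon>(j := s)) i) * x i z)" .
  qed
qed

context whitney_tree
begin

text \<open>
  On the box \<open>bdist w\<^sub>I z\<close> is at most \<open>7 |I|\<close>, and \<open>117649 = 7\<^sup>6\<close>.
\<close>

lemma test_kernel_lower:
  assumes I: "I \<in> D" and z: "z \<in> upper_half_box I"
  shows "1 \<le> 117649 * (arc_len I)\<^sup>2 * (cmod (test_kernel I z))\<^sup>2"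
proof -
  have l: "0 < arc_len I" by (rule len_pos[OF I])
  have z1: "cmod z < 1" using box_subset_disc[OF I] z by auto
  have "bdist (w I) z \<le> 7 * arc_len I"
    using bdist_le_dist[OF norm_w_less_1[OF I], of z] box_near_w[OF I z] norm_w[OF I] l by simp
  then have "(7 * arc_len I) powr - 3 \<le> bdist (w I) z powr - 3"
    by (intro powr_mono2' bdist_pos norm_w_less_1 I z1) auto
  then have "(arc_len I)\<^sup>2 * (7 * arc_len I) powr - 3 \<le> cmod (test_kernel I z)"
    unfolding norm_test_kernel[OF I z1] by (rule mult_left_mono) simp
  moreover have "(arc_len I)\<^sup>2 * (7 * arc_len I) powr - 3 = 1 / (343 * arc_len I)"
    using l by (simp add: powr_minus powr_numeral power_mult_distrib field_simps power2_eq_square power3_eq_cube)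
  ultimately have "1 / (343 * arc_len I) \<le> cmod (test_kernel I z)" by linarith
  then have "1 \<le> 343 * arc_len I * cmod (test_kernel I z)"
    using l by (simp add: field_simps)
  then have "1\<^sup>2 \<le> (343 * arc_len I * cmod (test_kernel I z))\<^sup>2" by (intro power_mono) auto
  then show ?thesis by (simp add: power_mult_distrib)
qed

text \<open>
  By duality it suffices to bound \<open>\<Sum> \<alpha>\<^sub>I h(I)\<close> for admissible \<open>\<alpha>\<close>. The coefficients with
  \<open>b\<^sub>I\<^sup>2 |I|\<^sup>p = \<alpha>\<^sub>I\<close> and well chosen signs give a test function whose energy dominates this sum.
\<close>

lemma gauge_le_test_functions:
  assumes p: "0 < p" "p \<le> 1" and V[measurable]: "V \<in> borel_measurable dA"
    and fin: "\<And>I. I \<in> D \<Longrightarrow> (\<integral>\<^sup>+z\<in>upper_half_box I. ennreal (V z) \<partial>dA) < \<infinity>"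
    and K: "0 \<le> K"
    and test: "\<And>f. f \<in> Qp_space p \<Longrightarrow> Qp_norm p f \<le> sqrt (qp_const p) \<Longrightarrow>
      (\<integral>\<^sup>+z. ennreal ((cmod (deriv f z))\<^sup>2) * ennreal (V z) \<partial>dA) \<le> ennreal K"
  shows "dyadic_gauge p D (box_average p V) \<le> ennreal (117649 * K)"
proof -
  define h where "h I = enn2real (box_average p V I)" for I
  have avg: "box_average p V I = ennreal (1 / arc_len I powr (p + 2)) * (\<integral>\<^sup>+z\<in>upper_half_box I. ennreal (V z) \<partial>dA)"
    if "I \<in> D" for I
    unfolding box_average_def using len_pos[OF that] by (intro divide_ennreal_real) simp
  have h: "box_average p V I = ennreal (h I)" if "I \<in> D" for I
    unfolding h_def using fin[OF that] by (intro ennreal_enn2real[symmetric]) (simp add: avg[OF that] ennreal_mult_less_top)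
  have "dyadic_gauge p D (box_average p V) = dyadic_gauge p D (\<lambda>I. ennreal (h I))"
    by (rule dyadic_gauge_cong) (rule h)
  also have "\<dots> \<le> ennreal (117649 * K)"
  proof (rule dyadic_gauge_le)
    show "0 \<le> h I" for I by (simp add: h_def)
    fix E and \<alpha> :: "complex set \<Rightarrow> real"
    assume E: "finite E" "E \<subseteq> D" and \<alpha>: "\<And>I. 0 \<le> \<alpha> I"
      and carl: "\<And>J. J \<in> D \<Longrightarrow> (\<Sum>I | I \<in> E \<and> I \<subseteq> J. \<alpha> I) \<le> arc_len J powr p"
    define c where "c I = sqrt (\<alpha> I / arc_len I powr p)" for I
    have c: "(c I)\<^sup>2 * arc_len I powr p = \<alpha> I" if "I \<in> E" for I
      using \<alpha>[of I] len_pos[of I] E that by (auto simp: c_def)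
    let ?x = "\<lambda>I z. of_real (c I) * test_kernel I z"
    have xm: "?x I \<in> borel_measurable dA" if "I \<in> E" for I
      using that E by (intro borel_measurable_dA_continuous holomorphic_on_imp_continuous_on holomorphic_intros test_kernel_holomorphic) auto
    obtain \<epsilon> :: "complex set \<Rightarrow> real" where \<epsilon>: "\<forall>I. \<epsilon> I = 1 \<or> \<epsilon> I = -1"
      and le: "(\<Sum>I\<in>E. \<integral>\<^sup>+z. ennreal ((cmod (?x I z))\<^sup>2) * ennreal (V z) \<partial>dA)
        \<le> (\<integral>\<^sup>+z. ennreal ((cmod (\<Sum>I\<in>E. of_real (\<epsilon> I) * ?x I z))\<^sup>2) * ennreal (V z) \<partial>dA)"
      using sign_choice[OF E(1), of ?x dA "\<lambda>z. ennreal (V z)", OF xm] by auto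
    define b where "b I = \<epsilon> I * c I" for I
    have b2: "(b I)\<^sup>2 = (c I)\<^sup>2" for I using \<epsilon>[rule_format, of I] by (auto simp: b_def power_mult_distrib)
    have "(\<Sum>I | I \<in> E \<and> I \<subseteq> J. (b I)\<^sup>2 * arc_len I powr p) \<le> arc_len J powr p" if "J \<in> D" for J
    proof -
      have "(\<Sum>I | I \<in> E \<and> I \<subseteq> J. (b I)\<^sup>2 * arc_len I powr p) = (\<Sum>I | I \<in> E \<and> I \<subseteq> J. \<alpha> I)"
        by (intro sum.cong) (auto simp: b2 c)
      then show ?thesis using carl[OF that] by simp
    qed
    from test_function[OF E p this] obtain f where f: "f \<in> Qp_space p" "Qp_norm p f \<le> sqrt (qp_const p)"
      "\<And>z. z \<in> unit_disc \<Longrightarrow> deriv f z = test_sum E b z" by blast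
    have summand: "ennreal (\<alpha> I * h I) \<le> ennreal 117649 * (\<integral>\<^sup>+z. ennreal ((cmod (?x I z))\<^sup>2) * ennreal (V z) \<partial>dA)"
      if I: "I \<in> E" for I
    proof -
      have ID: "I \<in> D" using I E by auto
      have [measurable]: "upper_half_box I \<in> sets dA" by (rule box_measurable[OF ID])
      have [measurable]: "?x I \<in> borel_measurable dA" by (rule xm[OF I])
      have l: "0 < arc_len I" by (rule len_pos[OF ID])
      have "ennreal (\<alpha> I * h I) = ennreal (\<alpha> I) * (ennreal (1 / arc_len I powr (p + 2)) * (\<integral>\<^sup>+z\<in>upper_half_box I. ennreal (V z) \<partial>dA))"
        using \<alpha>[of I] h[OF ID] avg[OF ID] by (simp add: ennreal_mult')
      also have "\<dots> = ennreal (\<alpha> I * (1 / arc_len I powr (p + 2))) * (\<integral>\<^sup>+z\<in>upper_half_box I. ennreal (V z) \<partial>dA)"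
        using \<alpha>[of I] by (subst ennreal_mult) (auto simp: mult.assoc)
      also have "\<alpha> I * (1 / arc_len I powr (p + 2)) = (c I)\<^sup>2 / (arc_len I)\<^sup>2"
        using l by (simp add: c[OF I, symmetric] powr_add powr_numeral)
      also have "ennreal ((c I)\<^sup>2 / (arc_len I)\<^sup>2) * (\<integral>\<^sup>+z\<in>upper_half_box I. ennreal (V z) \<partial>dA)
          = (\<integral>\<^sup>+z. ennreal ((c I)\<^sup>2 / (arc_len I)\<^sup>2) * (ennreal (V z) * indicator (upper_half_box I) z) \<partial>dA)"
        by (rule nn_integral_cmult[symmetric]) measurable
      also have "\<dots> \<le> (\<integral>\<^sup>+z. ennreal 117649 * (ennreal ((cmod (?x I z))\<^sup>2) * ennreal (V z)) \<partial>dA)"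
      proof (rule nn_integral_mono)
        fix z
        show "ennreal ((c I)\<^sup>2 / (arc_len I)\<^sup>2) * (ennreal (V z) * indicator (upper_half_box I) z)
            \<le> ennreal 117649 * (ennreal ((cmod (?x I z))\<^sup>2) * ennreal (V z))"
        proof (cases "z \<in> upper_half_box I")
          case True
          have "(c I)\<^sup>2 / (arc_len I)\<^sup>2 * 1 \<le> (c I)\<^sup>2 / (arc_len I)\<^sup>2 * (117649 * (arc_len I)\<^sup>2 * (cmod (test_kernel I z))\<^sup>2)"
            by (intro mult_left_mono test_kernel_lower ID True) simp
          also have "\<dots> = 117649 * (cmod (?x I z))\<^sup>2"
            using l by (simp add: norm_mult power_mult_distrib)
          finally have "ennreal ((c I)\<^sup>2 / (arc_len I)\<^sup>2) \<le> ennreal (117649 * (cmod (?x I z))\<^sup>2)" by (intro ennreal_leI) simp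
          also have "\<dots> = ennreal 117649 * ennreal ((cmod (?x I z))\<^sup>2)" by (rule ennreal_mult) auto
          finally have "ennreal ((c I)\<^sup>2 / (arc_len I)\<^sup>2) * ennreal (V z) \<le> ennreal 117649 * ennreal ((cmod (?x I z))\<^sup>2) * ennreal (V z)"
            by (rule mult_right_mono) simp
          then show ?thesis using True by (simp add: mult.assoc)
        qed simp
      qed
      also have "\<dots> = ennreal 117649 * (\<integral>\<^sup>+z. ennreal ((cmod (?x I z))\<^sup>2) * ennreal (V z) \<partial>dA)"
        by (rule nn_integral_cmult) measurable
      finally show ?thesis .
    qed
    have "ennreal (\<Sum>I\<in>E. \<alpha> I * h I) = (\<Sum>I\<in>E. ennreal (\<alpha> I * h I))"
      using \<alpha> by (intro sum_ennreal[symmetric]) (simp add: h_def)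
    also have "\<dots> \<le> (\<Sum>I\<in>E. ennreal 117649 * (\<integral>\<^sup>+z. ennreal ((cmod (?x I z))\<^sup>2) * ennreal (V z) \<partial>dA))"
      by (rule sum_mono) (rule summand)
    also have "\<dots> = ennreal 117649 * (\<Sum>I\<in>E. \<integral>\<^sup>+z. ennreal ((cmod (?x I z))\<^sup>2) * ennreal (V z) \<partial>dA)"
      by (simp add: sum_distrib_left)
    also have "\<dots> \<le> ennreal 117649 * (\<integral>\<^sup>+z. ennreal ((cmod (\<Sum>I\<in>E. of_real (\<epsilon> I) * ?x I z))\<^sup>2) * ennreal (V z) \<partial>dA)"
      by (rule mult_left_mono[OF le]) simp
    also have "(\<integral>\<^sup>+z. ennreal ((cmod (\<Sum>I\<in>E. of_real (\<epsilon> I) * ?x I z))\<^sup>2) * ennreal (V z) \<partial>dA)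
        = (\<integral>\<^sup>+z. ennreal ((cmod (deriv f z))\<^sup>2) * ennreal (V z) \<partial>dA)"
      using f(3) by (intro nn_integral_cong) (simp add: test_sum_def b_def mult.assoc)
    also have "ennreal 117649 * \<dots> \<le> ennreal 117649 * ennreal K"
      by (intro mult_left_mono test f) simp
    also have "\<dots> = ennreal (117649 * K)" using K by (intro ennreal_mult[symmetric]) auto
    finally show "(\<Sum>I\<in>E. \<alpha> I * h I) \<le> 117649 * K"
      using K by (subst (asm) ennreal_le_iff) auto
  qed
  finally show ?thesis .
qed

end

section \<open>Compactness\<close>

text \<open>
  Local integrability speaks of the restrictions of \<open>W\<close> to compact sets only; \<open>W\<close> is the pointwise limit of
  its restrictions to an exhaustion of the disc.
\<close>

lemma locally_integrable_measurable:
  assumes "locally_integrable_on_disc W"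
  shows "W \<in> borel_measurable dA"
proof -
  define K where "K n = cball (0::complex) (1 - 1 / real (Suc n))" for n
  have K: "compact (K n)" "K n \<subseteq> unit_disc" for n
  proof -
    show "compact (K n)" by (simp add: K_def)
    have "0 < 1 / real (Suc n)" by simp
    then show "K n \<subseteq> unit_disc" unfolding K_def by (subst cball_subset_ball_iff) (simp del: of_nat_Suc)
  qed
  have "(\<lambda>z. indicator (K n) z *\<^sub>R W z) \<in> borel_measurable dA" for n
  proof -
    have "(\<lambda>z. indicator (K n) z *\<^sub>R W z) \<in> borel_measurable lebesgue"
      using assms K unfolding locally_integrable_on_disc_def set_integrable_def by blast
    then show ?thesis
      by (subst measurable_cong_sets[OF sets_dA refl]) (rule measurable_restrict_space1)
  qed
  moreover have "(\<lambda>n. indicator (K n) z *\<^sub>R W z) \<longlonglongrightarrow> W z" if "z \<in> space dA" for z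
  proof (rule tendsto_eventually)
    have z: "0 < 1 - cmod z" using that by simp
    obtain N where N: "1 / real (Suc N) < 1 - cmod z"
      using reals_Archimedean[OF z] by (auto simp: inverse_eq_divide)
    have "z \<in> K n" if "N \<le> n" for n
    proof -
      have "1 / real (Suc n) \<le> 1 / real (Suc N)" using that by (intro divide_left_mono) auto
      then show ?thesis using N by (auto simp: K_def)
    qed
    then show "\<forall>\<^sub>F n in sequentially. indicator (K n) z *\<^sub>R W z = W z"
      by (intro eventually_sequentiallyI[of N]) auto
  qed
  ultimately show ?thesis by (rule borel_measurable_LIMSEQ_real[rotated])
qed

lemma locally_integrable_finite:
  assumes "locally_integrable_on_disc W" "\<rho> < 1"
  shows "(\<integral>\<^sup>+z\<in>cball 0 \<rho>. ennreal (W z) \<partial>dA) < \<infinity>"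
proof -
  have W: "W \<in> borel_measurable dA" by (rule locally_integrable_measurable[OF assms(1)])
  have int: "set_integrable lebesgue (cball 0 \<rho>) W"
  proof -
    have "cball 0 \<rho> \<subseteq> unit_disc" using assms(2) by auto
    then show ?thesis using assms(1) unfolding locally_integrable_on_disc_def by simp
  qed
  have "(\<lambda>z. ennreal (W z) * indicator (cball 0 \<rho>) z) \<in> borel_measurable dA"
    using W assms(2) by (intro borel_measurable_times_ennreal borel_measurable_indicator sets_dA_borel) auto
  then have "(\<integral>\<^sup>+z\<in>cball 0 \<rho>. ennreal (W z) \<partial>dA) = ennreal (1 / pi) * (\<integral>\<^sup>+z\<in>cball 0 \<rho>. ennreal (W z) \<partial>lebesgue_on unit_disc)"
    unfolding dA_def by (intro nn_integral_scale_measure) simp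
  moreover have "(\<integral>\<^sup>+z\<in>cball 0 \<rho>. ennreal (W z) \<partial>lebesgue_on unit_disc) \<le> (\<integral>\<^sup>+z. ennreal (norm (indicator (cball 0 \<rho>) z *\<^sub>R W z)) \<partial>lebesgue)"
    by (subst nn_integral_restrict_space) (auto intro!: nn_integral_mono ennreal_leI split: split_indicator)
  moreover have "(\<integral>\<^sup>+z. ennreal (norm (indicator (cball 0 \<rho>) z *\<^sub>R W z)) \<partial>lebesgue) < \<infinity>"
    using int unfolding set_integrable_def integrable_iff_bounded by simp
  ultimately show ?thesis by (auto simp: ennreal_mult_less_top intro: le_less_trans)
qed

definition energy :: "(complex \<Rightarrow> real) \<Rightarrow> (complex \<Rightarrow> complex) \<Rightarrow> ennreal" where
  "energy V g = (\<integral>\<^sup>+z. ennreal ((cmod (g z))\<^sup>2) * ennreal (V z) \<partial>dA)"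

lemma weighted_area_energy:
  assumes "W \<in> borel_measurable dA" "g \<in> borel_measurable dA"
  shows "(\<integral>\<^sup>+z. ennreal ((cmod (g z))\<^sup>2) \<partial>weighted_area W) = energy W g"
  unfolding weighted_area_def energy_def using assms
  by (subst nn_integral_density) (auto simp: mult.commute)

lemma borel_measurable_weighted_area: "borel_measurable (weighted_area W) = borel_measurable dA"
  by (rule measurable_cong_sets) (auto simp: weighted_area_def)

lemma L2_space_iff:
  assumes "W \<in> borel_measurable dA"
  shows "g \<in> L2_space (weighted_area W) \<longleftrightarrow> g \<in> borel_measurable dA \<and> energy W g < \<infinity>"
  unfolding L2_space_def using weighted_area_energy[OF assms] by (auto simp: borel_measurable_weighted_area)

lemma L2_norm_energy:
  assumes "W \<in> borel_measurable dA" "g \<in> borel_measurable dA"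
  shows "L2_norm (weighted_area W) g = sqrt (enn2real (energy W g))"
  unfolding L2_norm_def weighted_area_energy[OF assms] ..

lemma sq_norm_diff_le: "ennreal ((cmod (a - b))\<^sup>2) \<le> 2 * ennreal ((cmod a)\<^sup>2) + 2 * ennreal ((cmod b)\<^sup>2)"
proof -
  have "(cmod (a - b))\<^sup>2 \<le> (cmod a + cmod b)\<^sup>2" by (intro power_mono norm_triangle_ineq4) auto
  also have "\<dots> \<le> 2 * (cmod a)\<^sup>2 + 2 * (cmod b)\<^sup>2"
    using sum_squares_bound[of "cmod a" "cmod b"] by (simp add: power2_sum)
  finally have "ennreal ((cmod (a - b))\<^sup>2) \<le> ennreal (2 * (cmod a)\<^sup>2 + 2 * (cmod b)\<^sup>2)" by (rule ennreal_leI)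
  then show ?thesis by (simp add: ennreal_mult)
qed

lemma energy_diff_le:
  assumes [measurable]: "V \<in> borel_measurable dA" "g \<in> borel_measurable dA" "k \<in> borel_measurable dA"
  shows "energy V (\<lambda>z. g z - k z) \<le> 2 * energy V g + 2 * energy V k"
proof -
  have "energy V (\<lambda>z. g z - k z) \<le> (\<integral>\<^sup>+z. 2 * (ennreal ((cmod (g z))\<^sup>2) * ennreal (V z)) + 2 * (ennreal ((cmod (k z))\<^sup>2) * ennreal (V z)) \<partial>dA)"
    unfolding energy_def
  proof (rule nn_integral_mono)
    fix z
    show "ennreal ((cmod (g z - k z))\<^sup>2) * ennreal (V z) \<le> 2 * (ennreal ((cmod (g z))\<^sup>2) * ennreal (V z)) + 2 * (ennreal ((cmod (k z))\<^sup>2) * ennreal (V z))"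
      using mult_right_mono[OF sq_norm_diff_le[of "g z" "k z"], of "ennreal (V z)"] by (simp add: distrib_right mult.assoc)
  qed
  also have "\<dots> = 2 * energy V g + 2 * energy V k"
    unfolding energy_def by (subst nn_integral_add, measurable, subst nn_integral_cmult, measurable, subst nn_integral_cmult, measurable)
  finally show ?thesis .
qed

lemma tail_weight_measurable [measurable (raw)]:
  assumes [measurable]: "W \<in> borel_measurable dA"
  shows "tail_weight W \<rho> \<in> borel_measurable dA"
proof -
  have "{z \<in> space dA. \<rho> < cmod z} \<in> sets dA" by measurable
  then have "(\<lambda>z. indicator {z \<in> space dA. \<rho> < cmod z} z * W z) \<in> borel_measurable dA" by measurable
  then show ?thesis
    by (subst measurable_cong[where g = "\<lambda>z. indicator {z \<in> space dA. \<rho> < cmod z} z * W z"])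
       (auto simp: tail_weight_def split: split_indicator)
qed

lemma energy_split:
  assumes W[measurable]: "W \<in> borel_measurable dA" and g[measurable]: "g \<in> borel_measurable dA" and \<rho>: "\<rho> < 1"
    and b: "\<And>z. cmod z \<le> \<rho> \<Longrightarrow> cmod (g z) \<le> b"
  shows "energy W g \<le> ennreal (b\<^sup>2) * (\<integral>\<^sup>+z\<in>cball 0 \<rho>. ennreal (W z) \<partial>dA) + energy (tail_weight W \<rho>) g"
proof -
  have [measurable]: "cball 0 \<rho> \<in> sets dA" using \<rho> by (intro sets_dA_borel) auto
  have "energy W g \<le> (\<integral>\<^sup>+z. ennreal (b\<^sup>2) * (ennreal (W z) * indicator (cball 0 \<rho>) z) + ennreal ((cmod (g z))\<^sup>2) * ennreal (tail_weight W \<rho> z) \<partial>dA)"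
    unfolding energy_def
  proof (rule nn_integral_mono)
    fix z
    show "ennreal ((cmod (g z))\<^sup>2) * ennreal (W z) \<le> ennreal (b\<^sup>2) * (ennreal (W z) * indicator (cball 0 \<rho>) z) + ennreal ((cmod (g z))\<^sup>2) * ennreal (tail_weight W \<rho> z)"
    proof (cases "cmod z \<le> \<rho>")
      case True
      then have "ennreal ((cmod (g z))\<^sup>2) \<le> ennreal (b\<^sup>2)" using b[OF True] by (intro ennreal_leI power_mono) auto
      then show ?thesis using True by (auto simp: tail_weight_def intro: mult_right_mono)
    next
      case False
      then show ?thesis by (simp add: tail_weight_def)
    qed
  qed
  also have "\<dots> = ennreal (b\<^sup>2) * (\<integral>\<^sup>+z\<in>cball 0 \<rho>. ennreal (W z) \<partial>dA) + energy (tail_weight W \<rho>) g"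
    unfolding energy_def by (subst nn_integral_add, measurable, subst nn_integral_cmult, measurable)
  finally show ?thesis .
qed

lemma energy_tail_tendsto_0:
  assumes W[measurable]: "W \<in> borel_measurable dA" and g[measurable]: "g \<in> borel_measurable dA" and fin: "energy W g < \<infinity>"
    and \<rho>: "\<rho> \<longlonglongrightarrow> 1"
  shows "(\<lambda>n. energy (tail_weight W (\<rho> n)) g) \<longlonglongrightarrow> 0"
proof -
  have "(\<lambda>n. energy (tail_weight W (\<rho> n)) g) \<longlonglongrightarrow> (\<integral>\<^sup>+z. 0 \<partial>dA)"
    unfolding energy_def
  proof (rule nn_integral_dominated_convergence[where w = "\<lambda>z. ennreal ((cmod (g z))\<^sup>2) * ennreal (W z)"])
    show "AE z in dA. (\<lambda>n. ennreal ((cmod (g z))\<^sup>2) * ennreal (tail_weight W (\<rho> n) z)) \<longlonglongrightarrow> 0"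
    proof (rule AE_I2)
      fix z assume "z \<in> space dA"
      then have "cmod z < 1" by simp
      then have "\<forall>\<^sub>F n in sequentially. cmod z < \<rho> n" by (rule order_tendstoD(1)[OF \<rho>])
      then show "(\<lambda>n. ennreal ((cmod (g z))\<^sup>2) * ennreal (tail_weight W (\<rho> n) z)) \<longlonglongrightarrow> 0"
        by (intro tendsto_eventually, elim eventually_mono) (simp add: tail_weight_def)
    qed
    show "AE z in dA. ennreal ((cmod (g z))\<^sup>2) * ennreal (tail_weight W (\<rho> n) z) \<le> ennreal ((cmod (g z))\<^sup>2) * ennreal (W z)" for n
      by (intro AE_I2 mult_left_mono) (auto simp: tail_weight_def split: split_indicator)
    show "(\<integral>\<^sup>+z. ennreal ((cmod (g z))\<^sup>2) * ennreal (W z) \<partial>dA) < \<infinity>" using fin by (simp add: energy_def)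
  qed measurable
  then show ?thesis by simp
qed

lemma Qp_spaceD:
  assumes "f \<in> Qp_space p"
  shows "f holomorphic_on unit_disc" "deriv f holomorphic_on unit_disc"
    "\<And>a. a \<in> unit_disc \<Longrightarrow> (\<integral>\<^sup>+z. ennreal ((cmod (deriv f z))\<^sup>2 * green_disc z a powr p) \<partial>dA) \<le> Qp_seminorm_sq p f"
    "Qp_seminorm_sq p f \<le> ennreal ((Qp_norm p f)\<^sup>2)"
proof -
  show hol: "f holomorphic_on unit_disc" using assms by (simp add: Qp_space_def)
  then show "deriv f holomorphic_on unit_disc" by (rule holomorphic_deriv) simp
  show "(\<integral>\<^sup>+z. ennreal ((cmod (deriv f z))\<^sup>2 * green_disc z a powr p) \<partial>dA) \<le> Qp_seminorm_sq p f" if "a \<in> unit_disc" for a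
    unfolding Qp_seminorm_sq_def by (rule SUP_upper[OF that])
  have "Qp_seminorm_sq p f = ennreal (enn2real (Qp_seminorm_sq p f))"
    using assms by (simp add: Qp_space_def ennreal_enn2real)
  also have "enn2real (Qp_seminorm_sq p f) = (sqrt (enn2real (Qp_seminorm_sq p f)))\<^sup>2" by simp
  also have "ennreal \<dots> \<le> ennreal ((Qp_norm p f)\<^sup>2)"
    unfolding Qp_norm_def by (intro ennreal_leI power_mono) auto
  finally show "Qp_seminorm_sq p f \<le> ennreal ((Qp_norm p f)\<^sup>2)" .
qed


lemma energy_fatou:
  assumes [measurable]: "V \<in> borel_measurable dA" "\<And>n. u n \<in> borel_measurable dA"
    and lim: "\<And>z. z \<in> unit_disc \<Longrightarrow> (\<lambda>n. u n z) \<longlonglongrightarrow> g z"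
    and le: "\<And>n. energy V (u n) \<le> c"
  shows "energy V g \<le> c"
proof -
  have "energy V g = (\<integral>\<^sup>+z. liminf (\<lambda>n. ennreal ((cmod (u n z))\<^sup>2) * ennreal (V z)) \<partial>dA)"
    unfolding energy_def
  proof (rule nn_integral_cong)
    fix z assume "z \<in> space dA"
    then have "(\<lambda>n. ennreal (V z) * ennreal ((cmod (u n z))\<^sup>2)) \<longlonglongrightarrow> ennreal (V z) * ennreal ((cmod (g z))\<^sup>2)"
      using lim[of z] by (intro ennreal_tendsto_cmult tendsto_ennrealI tendsto_intros) auto
    then show "ennreal ((cmod (g z))\<^sup>2) * ennreal (V z) = liminf (\<lambda>n. ennreal ((cmod (u n z))\<^sup>2) * ennreal (V z))"
      by (intro lim_imp_Liminf[symmetric]) (auto simp: mult.commute)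
  qed
  also have "\<dots> \<le> liminf (\<lambda>n. energy V (u n))"
    unfolding energy_def by (rule nn_integral_liminf) measurable
  also have "\<dots> \<le> c"
    using le by (intro Liminf_le[OF sequentially_bot]) (auto intro: always_eventually)
  finally show ?thesis .
qed

abbreviation green_bounded :: "real \<Rightarrow> ennreal \<Rightarrow> (complex \<Rightarrow> complex) \<Rightarrow> bool" where
  "green_bounded p S g \<equiv>
    (\<forall>a\<in>unit_disc. (\<integral>\<^sup>+z. ennreal ((cmod (g z))\<^sup>2 * green_disc z a powr p) \<partial>dA) \<le> S)"

lemma Qp_derivative:
  assumes "f \<in> Qp_space p" "Qp_norm p f \<le> B"
  shows "deriv f holomorphic_on unit_disc" "green_bounded p (ennreal (B\<^sup>2)) (deriv f)"
proof -
  show "deriv f holomorphic_on unit_disc" by (rule Qp_spaceD[OF assms(1)])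
  have "0 \<le> Qp_norm p f" by (simp add: Qp_norm_def)
  then have "ennreal ((Qp_norm p f)\<^sup>2) \<le> ennreal (B\<^sup>2)" using assms(2) by (intro ennreal_leI power_mono)
  then show "green_bounded p (ennreal (B\<^sup>2)) (deriv f)"
    using Qp_spaceD(3,4)[OF assms(1)] by (meson order_trans)
qed

abbreviation (input) tail_gauge :: "real \<Rightarrow> (complex \<Rightarrow> real) \<Rightarrow> real \<Rightarrow> ennreal" where
  "tail_gauge p W \<rho> \<equiv> SUP \<D>\<in>{\<D>. dyadic_system \<D>}. dyadic_gauge p \<D> (box_average p (tail_weight W \<rho>))"

text \<open>
  Any single dyadic system turns a small gauge into a bound on the tail of the embedding. The denominator \<open>C + 1\<close>
  of \<open>\<delta>\<close> covers the case \<open>B = 0\<close>.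
\<close>

lemma gauge_vanishing_tail:
  assumes p: "0 < p" "p \<le> 1" and W: "W \<in> borel_measurable dA"
    and lim: "(tail_gauge p W \<longlongrightarrow> 0) (at_left 1)"
    and \<epsilon>: "0 < \<epsilon>"
  obtains \<rho> where "0 < \<rho>" "\<rho> < 1"
    "\<And>g. g holomorphic_on unit_disc \<Longrightarrow> green_bounded p (ennreal (B\<^sup>2)) g \<Longrightarrow> energy (tail_weight W \<rho>) g \<le> ennreal \<epsilon>"
proof -
  obtain D where D: "dyadic_system D" using dyadic_system_exists by blast
  then obtain G where "whitney_tree D G" by (rule dyadic_system_whitney_tree)
  then interpret whitney_tree D G .
  define C where "C = 64 * 22118400 * B\<^sup>2"
  have C: "0 \<le> C" by (simp add: C_def)
  define \<delta> where "\<delta> = \<epsilon> / (C + 1)"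
  have \<delta>: "0 < \<delta>" "C * \<delta> \<le> \<epsilon>" using C \<epsilon> by (auto simp: \<delta>_def field_simps)
  have "\<forall>\<^sub>F \<rho> in at_left 1. tail_gauge p W \<rho> < ennreal \<delta>"
    using \<delta> by (intro order_tendstoD(2)[OF lim]) simp
  moreover have "\<forall>\<^sub>F \<rho> in at_left (1::real). 0 < \<rho>" by (rule eventually_at_leftI[of 0]) auto
  moreover have "\<forall>\<^sub>F \<rho> in at_left (1::real). \<rho> < 1" by (rule eventually_at_leftI[of 0]) auto
  ultimately have "\<forall>\<^sub>F \<rho> in at_left 1. 0 < \<rho> \<and> \<rho> < 1 \<and>
    tail_gauge p W \<rho> < ennreal \<delta>"
    by eventually_elim auto
  then obtain \<rho> where \<rho>: "0 < \<rho>" "\<rho> < 1" and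
    sup: "tail_gauge p W \<rho> < ennreal \<delta>"
    using eventually_happens'[OF trivial_limit_at_left_real] by blast
  have "dyadic_gauge p D (box_average p (tail_weight W \<rho>)) < ennreal \<delta>"
    using D by (intro le_less_trans[OF SUP_upper sup]) simp
  then obtain l where l: "\<forall>J\<in>D. 0 \<le> l J"
    "\<forall>I\<in>D. box_average p (tail_weight W \<rho>) I \<le> (\<Sum>\<^sub>\<infinity>J\<in>{J \<in> D. I \<subseteq> J}. ennreal (l J))"
    and cost: "(\<Sum>\<^sub>\<infinity>J\<in>D. ennreal (l J * arc_len J powr p)) < ennreal \<delta>"
    unfolding dyadic_gauge_def INF_less_iff by blast
  show thesis
  proof (rule that[OF \<rho>])
    fix g assume g: "g holomorphic_on unit_disc" "green_bounded p (ennreal (B\<^sup>2)) g"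
    have "energy (tail_weight W \<rho>) g \<le> ennreal (64 * 22118400) * ennreal (B\<^sup>2) * (\<Sum>\<^sub>\<infinity>J\<in>D. ennreal (l J * arc_len J powr p))"
      unfolding energy_def
      by (rule weighted_embedding[OF g(1) p]) (use g(2) l W in \<open>auto intro: tail_weight_measurable\<close>)
    also have "\<dots> \<le> ennreal (64 * 22118400) * ennreal (B\<^sup>2) * ennreal \<delta>"
      using cost by (intro mult_left_mono) auto
    also have "\<dots> = ennreal (C * \<delta>)"
    proof -
      have *: "ennreal x * ennreal y * ennreal s = ennreal (x * y * s)" if "0 \<le> x" "0 \<le> y" "0 \<le> s" for x y s
        using that by (simp add: ennreal_mult)
      show ?thesis unfolding C_def by (rule *) (use \<delta> in auto)
    qed
    also have "\<dots> \<le> ennreal \<epsilon>" using \<delta> by (intro ennreal_leI) simp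
    finally show "energy (tail_weight W \<rho>) g \<le> ennreal \<epsilon>" .
  qed
qed

lemma holomorphic_measurable_dA: "g holomorphic_on unit_disc \<Longrightarrow> g \<in> borel_measurable dA"
  by (intro borel_measurable_dA_continuous holomorphic_on_imp_continuous_on)

lemma holomorphic_bounded_cball:
  assumes "g holomorphic_on unit_disc" "\<rho> < 1"
  obtains b where "\<And>z. cmod z \<le> \<rho> \<Longrightarrow> cmod (g z) \<le> b"
proof -
  have "continuous_on (cball 0 \<rho>) g"
    using assms by (intro holomorphic_on_imp_continuous_on holomorphic_on_subset[OF assms(1)]) auto
  then have "bounded (g ` cball 0 \<rho>)" by (intro compact_imp_bounded compact_continuous_image) auto
  then obtain b where "\<forall>y\<in>g ` cball 0 \<rho>. cmod y \<le> b" unfolding bounded_iff by blast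
  then show thesis by (intro that[of b]) auto
qed

lemma L2_space_if_tail_finite:
  assumes loc: "locally_integrable_on_disc W"
    and g: "g holomorphic_on unit_disc" and tail: "\<rho> < 1" "energy (tail_weight W \<rho>) g \<le> ennreal \<epsilon>"
  shows "g \<in> L2_space (weighted_area W)"
proof -
  have W: "W \<in> borel_measurable dA" by (rule locally_integrable_measurable[OF loc])
  have gm: "g \<in> borel_measurable dA" by (rule holomorphic_measurable_dA[OF g])
  obtain b where b: "\<And>z. cmod z \<le> \<rho> \<Longrightarrow> cmod (g z) \<le> b"
    using holomorphic_bounded_cball[OF g tail(1)] by blast
  have "energy W g \<le> ennreal (b\<^sup>2) * (\<integral>\<^sup>+z\<in>cball 0 \<rho>. ennreal (W z) \<partial>dA) + energy (tail_weight W \<rho>) g"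
    by (rule energy_split[OF W gm tail(1) b])
  also have "\<dots> < \<infinity>"
    using locally_integrable_finite[OF loc tail(1)] tail(2)
    by (auto simp: ennreal_mult_less_top intro: le_less_trans)
  finally show ?thesis using gm by (simp add: L2_space_iff[OF W])
qed

text \<open>
  Montel's theorem is applied to the derivatives: the limit \<open>g\<close> only has to be a member of \<open>L\<^sup>2\<close>, and Fatou's lemma gives
  it the same tail bounds as the sequence. The weight is integrable on the inner disc, where convergence is uniform.
\<close>

lemma compact_if_gauge_vanishing:
  assumes p: "0 < p" "p \<le> 1" and loc: "locally_integrable_on_disc W"
    and lim: "(tail_gauge p W \<longlongrightarrow> 0) (at_left 1)"
  shows "compact_mapping (Qp_space p) (Qp_norm p) (L2_space (weighted_area W)) (L2_norm (weighted_area W)) deriv"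
  unfolding compact_mapping_def
proof (intro conjI ballI allI impI)
  have W[measurable]: "W \<in> borel_measurable dA" by (rule locally_integrable_measurable[OF loc])
  note tail = gauge_vanishing_tail[OF p W lim]
  {
    fix f assume f: "f \<in> Qp_space p"
    note der = Qp_derivative[OF f order_refl]
    obtain \<rho> where \<rho>: "0 < \<rho>" "\<rho> < 1"
      "\<And>g. g holomorphic_on unit_disc \<Longrightarrow> green_bounded p (ennreal ((Qp_norm p f)\<^sup>2)) g \<Longrightarrow> energy (tail_weight W \<rho>) g \<le> ennreal 1"
    proof (rule tail[of 1 "Qp_norm p f", OF zero_less_one])
      fix \<rho> assume "0 < \<rho>" "\<rho> < 1" "\<And>g. g holomorphic_on unit_disc \<Longrightarrow> green_bounded p (ennreal ((Qp_norm p f)\<^sup>2)) g \<Longrightarrow> energy (tail_weight W \<rho>) g \<le> ennreal 1"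
      then show thesis by (rule that)
    qed
    show "deriv f \<in> L2_space (weighted_area W)"
      by (rule L2_space_if_tail_finite[OF loc der(1) \<rho>(2) \<rho>(3)[OF der]])
  }
  fix f :: "nat \<Rightarrow> complex \<Rightarrow> complex"
  assume f: "(\<forall>n. f n \<in> Qp_space p) \<and> (\<exists>B. \<forall>n. Qp_norm p (f n) \<le> B)"
  then obtain B where B: "\<And>n. Qp_norm p (f n) \<le> B" by blast
  have der: "deriv (f n) holomorphic_on unit_disc" "green_bounded p (ennreal (B\<^sup>2)) (deriv (f n))" for n
    using Qp_derivative[OF _ B[of n]] f by blast+
  define H where "H = {g. g holomorphic_on unit_disc \<and> green_bounded p (ennreal (B\<^sup>2)) g}"
  obtain D where D: "dyadic_system D" using dyadic_system_exists by blast
  then obtain G where tree: "whitney_tree D G" by (rule dyadic_system_whitney_tree)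
  obtain g r where g: "g holomorphic_on unit_disc" and r: "strict_mono (r :: nat \<Rightarrow> nat)"
    and ptw: "\<And>z. z \<in> unit_disc \<Longrightarrow> (\<lambda>n. deriv (f (r n)) z) \<longlonglongrightarrow> g z"
    and unif: "\<And>K. compact K \<Longrightarrow> K \<subseteq> unit_disc \<Longrightarrow> uniform_limit K ((\<lambda>n. deriv (f n)) \<circ> r) g sequentially"
  proof (rule Montel[of unit_disc H "\<lambda>n. deriv (f n)"])
    show "range (\<lambda>n. deriv (f n)) \<subseteq> H" using der by (auto simp: H_def)
    show "\<exists>b. \<forall>h\<in>H. \<forall>z\<in>K. cmod (h z) \<le> b" if K: "compact K" "K \<subseteq> unit_disc" for K
    proof (cases "K = {}")
      case False
      obtain z0 where z0: "z0 \<in> K" "\<And>z. z \<in> K \<Longrightarrow> cmod z \<le> cmod z0"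
        using continuous_attains_sup[OF K(1) False, of cmod] by (auto intro: continuous_intros)
      have z01: "cmod z0 < 1" using z0 K by auto
      have "cmod (h z) \<le> sqrt (64 * 22118400 * B\<^sup>2 / (1 - cmod z0)\<^sup>2)" if "h \<in> H" "z \<in> K" for h z
      proof (rule real_le_rsqrt)
        have z: "cmod z \<le> cmod z0" by (rule z0(2)[OF that(2)])
        have "(cmod (h z))\<^sup>2 \<le> 64 * 22118400 * B\<^sup>2 / (1 - cmod z)\<^sup>2"
          using that z z01 by (intro whitney_tree.bloch_estimate[OF tree _ p]) (auto simp: H_def)
        also have "\<dots> \<le> 64 * 22118400 * B\<^sup>2 / (1 - cmod z0)\<^sup>2"
          using z z01 by (intro divide_left_mono power_mono mult_pos_pos) (auto simp: zero_less_power)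
        finally show "(cmod (h z))\<^sup>2 \<le> 64 * 22118400 * B\<^sup>2 / (1 - cmod z0)\<^sup>2" .
      qed
      then show ?thesis by blast
    qed simp
  qed (auto simp: H_def)
  have fm[measurable]: "deriv (f n) \<in> borel_measurable dA" for n by (rule holomorphic_measurable_dA[OF der(1)])
  have gm[measurable]: "g \<in> borel_measurable dA" by (rule holomorphic_measurable_dA[OF g])
  have gtail: "energy (tail_weight W \<rho>) g \<le> c" if "\<And>n. energy (tail_weight W \<rho>) (deriv (f (r n))) \<le> c" for \<rho> c
    by (rule energy_fatou[OF tail_weight_measurable[OF W] _ ptw that]) measurable
  have gL2: "g \<in> L2_space (weighted_area W)"
  proof -
    obtain \<rho> where \<rho>: "\<rho> < 1" "\<And>h. h holomorphic_on unit_disc \<Longrightarrow> green_bounded p (ennreal (B\<^sup>2)) h \<Longrightarrow> energy (tail_weight W \<rho>) h \<le> ennreal 1"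
    proof (rule tail[of 1 B, OF zero_less_one])
      fix \<rho> assume "\<rho> < 1" "\<And>g. g holomorphic_on unit_disc \<Longrightarrow> green_bounded p (ennreal (B\<^sup>2)) g \<Longrightarrow> energy (tail_weight W \<rho>) g \<le> ennreal 1"
      then show thesis by (rule that)
    qed
    show ?thesis by (rule L2_space_if_tail_finite[OF loc g \<rho>(1) gtail]) (rule \<rho>(2)[OF der])
  qed
  have conv: "\<forall>\<^sub>F n in sequentially. energy W (\<lambda>z. deriv (f (r n)) z - g z) \<le> ennreal \<epsilon>" if \<epsilon>: "0 < \<epsilon>" for \<epsilon>
  proof -
    obtain \<rho> where \<rho>: "\<rho> < 1" "\<And>h. h holomorphic_on unit_disc \<Longrightarrow> green_bounded p (ennreal (B\<^sup>2)) h \<Longrightarrow> energy (tail_weight W \<rho>) h \<le> ennreal (\<epsilon> / 8)"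
    proof (rule tail[of "\<epsilon> / 8" B])
      fix \<rho> assume "\<rho> < 1" "\<And>g. g holomorphic_on unit_disc \<Longrightarrow> green_bounded p (ennreal (B\<^sup>2)) g \<Longrightarrow> energy (tail_weight W \<rho>) g \<le> ennreal (\<epsilon> / 8)"
      then show thesis by (rule that)
    qed (use \<epsilon> in simp)
    define M where "M = enn2real (\<integral>\<^sup>+z\<in>cball 0 \<rho>. ennreal (W z) \<partial>dA)"
    have M: "(\<integral>\<^sup>+z\<in>cball 0 \<rho>. ennreal (W z) \<partial>dA) = ennreal M" "0 \<le> M"
      unfolding M_def using locally_integrable_finite[OF loc \<rho>(1)] by (auto simp: ennreal_enn2real)
    define b where "b = sqrt (\<epsilon> / (2 * (M + 1)))"
    have b: "0 < b" "b\<^sup>2 * M \<le> \<epsilon> / 2" using \<epsilon> M(2) by (auto simp: b_def field_simps)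
    have "uniform_limit (cball 0 \<rho>) ((\<lambda>n. deriv (f n)) \<circ> r) g sequentially"
      using \<rho>(1) by (intro unif) auto
    then have "\<forall>\<^sub>F n in sequentially. \<forall>z\<in>cball 0 \<rho>. dist (deriv (f (r n)) z) (g z) < b"
      using b(1) by (auto dest!: uniform_limitD)
    then show ?thesis
    proof eventually_elim
      case (elim n)
      have "energy W (\<lambda>z. deriv (f (r n)) z - g z)
          \<le> ennreal (b\<^sup>2) * (\<integral>\<^sup>+z\<in>cball 0 \<rho>. ennreal (W z) \<partial>dA) + energy (tail_weight W \<rho>) (\<lambda>z. deriv (f (r n)) z - g z)"
        using elim by (intro energy_split[OF W _ \<rho>(1)]) (auto simp: dist_norm less_imp_le)
      also have "\<dots> \<le> ennreal (\<epsilon> / 2) + (2 * ennreal (\<epsilon> / 8) + 2 * ennreal (\<epsilon> / 8))"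
      proof (rule add_mono)
        show "ennreal (b\<^sup>2) * (\<integral>\<^sup>+z\<in>cball 0 \<rho>. ennreal (W z) \<partial>dA) \<le> ennreal (\<epsilon> / 2)"
          unfolding M using b M(2) by (subst ennreal_mult[symmetric]) (auto intro: ennreal_leI)
        have "energy (tail_weight W \<rho>) (\<lambda>z. deriv (f (r n)) z - g z)
            \<le> 2 * energy (tail_weight W \<rho>) (deriv (f (r n))) + 2 * energy (tail_weight W \<rho>) g"
          by (intro energy_diff_le tail_weight_measurable W fm gm)
        also have "\<dots> \<le> 2 * ennreal (\<epsilon> / 8) + 2 * ennreal (\<epsilon> / 8)"
          by (intro add_mono mult_left_mono gtail \<rho>(2) der) auto
        finally show "energy (tail_weight W \<rho>) (\<lambda>z. deriv (f (r n)) z - g z) \<le> 2 * ennreal (\<epsilon> / 8) + 2 * ennreal (\<epsilon> / 8)" .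
      qed
      also have "\<dots> = ennreal (\<epsilon> / 2 + (2 * (\<epsilon> / 8) + 2 * (\<epsilon> / 8)))"
      proof -
        have *: "ennreal x + (2 * ennreal y + 2 * ennreal y) = ennreal (x + (2 * y + 2 * y))" if "0 \<le> x" "0 \<le> y" for x y
        proof -
          have "2 * ennreal y = ennreal (2 * y)" using that by (simp add: ennreal_mult)
          then show ?thesis
            by (simp only: ennreal_plus that add_nonneg_nonneg mult_nonneg_nonneg zero_le_numeral)
        qed
        show ?thesis by (rule *) (use \<epsilon> in auto)
      qed
      finally show ?case using \<epsilon> by simp
    qed
  qed
  show "\<exists>r. strict_mono (r :: nat \<Rightarrow> nat) \<and> (\<exists>y\<in>L2_space (weighted_area W). (\<lambda>n. L2_norm (weighted_area W) (deriv (f (r n)) - y)) \<longlonglongrightarrow> 0)"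
  proof (intro exI[of _ r] conjI r bexI[OF _ gL2])
    show "(\<lambda>n. L2_norm (weighted_area W) (deriv (f (r n)) - g)) \<longlonglongrightarrow> 0"
    proof (rule tendstoI)
      fix e :: real assume e: "0 < e"
      then have "0 < (e / 2)\<^sup>2" by simp
      from conv[OF this] show "\<forall>\<^sub>F n in sequentially. dist (L2_norm (weighted_area W) (deriv (f (r n)) - g)) 0 < e"
      proof eventually_elim
        case (elim n)
        have eq: "deriv (f (r n)) - g = (\<lambda>z. deriv (f (r n)) z - g z)" by (simp add: fun_eq_iff)
        have "enn2real (energy W (\<lambda>z. deriv (f (r n)) z - g z)) \<le> (e / 2)\<^sup>2"
          using elim by (intro enn2real_leI) auto
        then have "sqrt (enn2real (energy W (\<lambda>z. deriv (f (r n)) z - g z))) \<le> e / 2"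
          using e by (intro real_le_lsqrt) auto
        then show ?case using e unfolding eq by (subst L2_norm_energy[OF W]) auto
      qed
    qed
  qed
qed

text \<open>
  Otherwise there are functions of the ball with \<open>\<integral> |f\<^sub>n'|\<^sup>2 W > \<epsilon>\<close> over \<open>|z| > \<rho>\<^sub>n\<close> and \<open>\<rho>\<^sub>n \<rightarrow> 1\<close>. Along a subsequence
  \<open>f\<^sub>n'\<close> converges in \<open>L\<^sup>2\<close> to some \<open>y\<close>, whose own tails tend to \<open>0\<close>.
\<close>

lemma compact_uniform_tail:
  assumes W[measurable]: "W \<in> borel_measurable dA"
    and comp: "compact_mapping (Qp_space p) (Qp_norm p) (L2_space (weighted_area W)) (L2_norm (weighted_area W)) deriv"
    and \<epsilon>: "0 < \<epsilon>"
  obtains \<rho>0 where "\<rho>0 < 1"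
    "\<And>f \<rho>. f \<in> Qp_space p \<Longrightarrow> Qp_norm p f \<le> B \<Longrightarrow> \<rho>0 \<le> \<rho> \<Longrightarrow> energy (tail_weight W \<rho>) (deriv f) \<le> ennreal \<epsilon>"
proof (rule ccontr)
  assume neg: "\<not> thesis"
  define R where "R n = 1 - 1 / real (Suc n)" for n
  have R: "R n < 1" for n by (simp add: R_def)
  have "(\<lambda>n. 1 - 1 / real (Suc n)) \<longlonglongrightarrow> 1 - 0"
    by (intro tendsto_diff tendsto_const LIMSEQ_Suc lim_1_over_n)
  then have Rlim: "R \<longlonglongrightarrow> 1" by (simp add: R_def[abs_def])
  have "\<exists>f. f \<in> Qp_space p \<and> Qp_norm p f \<le> B \<and> ennreal \<epsilon> < energy (tail_weight W (R n)) (deriv f)" for n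
  proof (rule ccontr)
    assume none: "\<not> ?thesis"
    have "energy (tail_weight W \<rho>) (deriv f) \<le> ennreal \<epsilon>"
      if f: "f \<in> Qp_space p" "Qp_norm p f \<le> B" and \<rho>: "R n \<le> \<rho>" for f \<rho>
    proof -
      have "energy (tail_weight W \<rho>) (deriv f) \<le> energy (tail_weight W (R n)) (deriv f)"
        unfolding energy_def
      proof (intro nn_integral_mono mult_left_mono)
        fix z
        show "ennreal (tail_weight W \<rho> z) \<le> ennreal (tail_weight W (R n) z)"
          using \<rho> by (auto simp: tail_weight_def split: split_indicator)
      qed simp
      also have "\<dots> \<le> ennreal \<epsilon>" using none f by (auto simp: not_less)
      finally show ?thesis .
    qed
    then show False using neg that[OF R] by blast
  qed
  then obtain f where f: "\<And>n. f n \<in> Qp_space p" "\<And>n. Qp_norm p (f n) \<le> B"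
    "\<And>n. ennreal \<epsilon> < energy (tail_weight W (R n)) (deriv (f n))" by metis
  from comp have "\<forall>x. (\<forall>n. x n \<in> Qp_space p) \<and> (\<exists>B. \<forall>n. Qp_norm p (x n) \<le> B) \<longrightarrow>
      (\<exists>r. strict_mono (r :: nat \<Rightarrow> nat) \<and> (\<exists>y\<in>L2_space (weighted_area W). (\<lambda>n. L2_norm (weighted_area W) (deriv (x (r n)) - y)) \<longlonglongrightarrow> 0))"
    and into: "\<And>x. x \<in> Qp_space p \<Longrightarrow> deriv x \<in> L2_space (weighted_area W)"
    unfolding compact_mapping_def by blast+
  then obtain r y where r: "strict_mono (r :: nat \<Rightarrow> nat)" and y: "y \<in> L2_space (weighted_area W)"
    and conv: "(\<lambda>n. L2_norm (weighted_area W) (deriv (f (r n)) - y)) \<longlonglongrightarrow> 0"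
    using f by blast
  have ym[measurable]: "y \<in> borel_measurable dA" and yfin: "energy W y < \<infinity>" using y by (auto simp: L2_space_iff[OF W])
  have fm[measurable]: "deriv (f n) \<in> borel_measurable dA" and ffin: "energy W (deriv (f n)) < \<infinity>" for n
    using into[OF f(1)[of n]] by (auto simp: L2_space_iff[OF W])
  define e where "e n = energy W (\<lambda>z. deriv (f (r n)) z - y z)" for n
  have efin: "e n < \<infinity>" for n
    unfolding e_def
    by (rule le_less_trans[OF energy_diff_le[OF W fm ym]]) (use ffin[of "r n"] yfin in \<open>auto simp: ennreal_mult_less_top\<close>)
  have e0: "e \<longlonglongrightarrow> 0"
  proof -
    have "L2_norm (weighted_area W) (deriv (f (r n)) - y) = sqrt (enn2real (e n))" for n
    proof -
      have eq: "deriv (f (r n)) - y = (\<lambda>z. deriv (f (r n)) z - y z)" by (simp add: fun_eq_iff)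
      show ?thesis unfolding eq e_def by (rule L2_norm_energy[OF W]) measurable
    qed
    then have "(\<lambda>n. sqrt (enn2real (e n))) \<longlonglongrightarrow> 0" using conv by simp
    then have "(\<lambda>n. ennreal ((sqrt (enn2real (e n)))\<^sup>2)) \<longlonglongrightarrow> ennreal (0\<^sup>2)" by (intro tendsto_ennrealI tendsto_power)
    then show ?thesis using efin by (simp add: ennreal_enn2real)
  qed
  have t0: "(\<lambda>n. energy (tail_weight W (R (r n))) y) \<longlonglongrightarrow> 0"
    by (rule energy_tail_tendsto_0[OF W ym yfin]) (use LIMSEQ_subseq_LIMSEQ[OF Rlim r] in \<open>simp add: o_def\<close>)
  have "(\<lambda>n. 2 * e n + 2 * energy (tail_weight W (R (r n))) y) \<longlonglongrightarrow> 2 * 0 + 2 * 0"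
    by (intro tendsto_add ennreal_tendsto_cmult e0 t0) auto
  then have "\<forall>\<^sub>F n in sequentially. 2 * e n + 2 * energy (tail_weight W (R (r n))) y < ennreal \<epsilon>"
    using \<epsilon> by (intro order_tendstoD(2)[where y = "2 * 0 + 2 * (0::ennreal)"]) auto
  then obtain n where n: "2 * e n + 2 * energy (tail_weight W (R (r n))) y < ennreal \<epsilon>"
    by (auto simp: eventually_sequentially)
  let ?V = "tail_weight W (R (r n))"
  have "energy ?V (deriv (f (r n))) = energy ?V (\<lambda>z. (deriv (f (r n)) z - y z) - (- y z))" by simp
  also have "\<dots> \<le> 2 * energy ?V (\<lambda>z. deriv (f (r n)) z - y z) + 2 * energy ?V (\<lambda>z. - y z)"
    by (intro energy_diff_le tail_weight_measurable W) measurable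
  also have "energy ?V (\<lambda>z. - y z) = energy ?V y" by (simp add: energy_def)
  also have "energy ?V (\<lambda>z. deriv (f (r n)) z - y z) \<le> e n"
    unfolding e_def energy_def by (intro nn_integral_mono mult_left_mono) (auto simp: tail_weight_def split: split_indicator)
  finally have "energy ?V (deriv (f (r n))) \<le> 2 * e n + 2 * energy ?V y" by (simp add: add_right_mono mult_left_mono)
  then show False using n f(3)[of "r n"] by simp
qed

lemma gauge_vanishing_if_compact:
  assumes p: "0 < p" "p \<le> 1" and loc: "locally_integrable_on_disc W"
    and comp: "compact_mapping (Qp_space p) (Qp_norm p) (L2_space (weighted_area W)) (L2_norm (weighted_area W)) deriv"
  shows "(tail_gauge p W \<longlongrightarrow> 0) (at_left 1)"
proof (rule order_tendstoI)
  have W[measurable]: "W \<in> borel_measurable dA" by (rule locally_integrable_measurable[OF loc])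
  fix c :: ennreal assume "0 < c"
  then obtain c' where c': "0 < c'" "c' < c" using dense by blast
  then have "c' < top" by (metis less_top order_less_trans top.not_eq_extremum)
  then obtain t where t: "c' = ennreal t" "0 \<le> t" by (cases c') auto
  then have t0: "0 < t" using c' by (auto simp: ennreal_less_zero_iff)
  (* Compensates the constant of gauge_le_test_functions. *)
  define \<epsilon> where "\<epsilon> = t / 117649"
  have \<epsilon>: "0 < \<epsilon>" using t0 by (simp add: \<epsilon>_def)
  obtain \<rho>0 where \<rho>0: "\<rho>0 < 1"
    "\<And>f \<rho>. f \<in> Qp_space p \<Longrightarrow> Qp_norm p f \<le> sqrt (qp_const p) \<Longrightarrow> \<rho>0 \<le> \<rho> \<Longrightarrow> energy (tail_weight W \<rho>) (deriv f) \<le> ennreal \<epsilon>"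
  proof (rule compact_uniform_tail[OF W comp \<epsilon>, of "sqrt (qp_const p)"])
    fix \<rho>0 assume "\<rho>0 < 1" "\<And>f \<rho>. f \<in> Qp_space p \<Longrightarrow> Qp_norm p f \<le> sqrt (qp_const p) \<Longrightarrow> \<rho>0 \<le> \<rho> \<Longrightarrow> energy (tail_weight W \<rho>) (deriv f) \<le> ennreal \<epsilon>"
    then show thesis by (rule that)
  qed
  have sup: "tail_gauge p W \<rho> \<le> c'" if \<rho>: "\<rho>0 \<le> \<rho>" for \<rho>
  proof (rule SUP_least)
    fix D assume "D \<in> {\<D>. dyadic_system \<D>}"
    then obtain G where "whitney_tree D G" using dyadic_system_whitney_tree by blast
    then interpret whitney_tree D G .
    have "dyadic_gauge p D (box_average p (tail_weight W \<rho>)) \<le> ennreal (117649 * \<epsilon>)"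
    proof (rule gauge_le_test_functions[OF p])
      fix I assume I: "I \<in> D"
      have "(\<integral>\<^sup>+z\<in>upper_half_box I. ennreal (tail_weight W \<rho> z) \<partial>dA) \<le> (\<integral>\<^sup>+z\<in>cball 0 (1 - arc_len I / 2). ennreal (W z) \<partial>dA)"
        using box_norm(2)[OF I] by (intro nn_integral_mono) (fastforce simp: tail_weight_def split: split_indicator intro: less_imp_le)
      also have "\<dots> < \<infinity>" using len_pos[OF I] by (intro locally_integrable_finite[OF loc]) simp
      finally show "(\<integral>\<^sup>+z\<in>upper_half_box I. ennreal (tail_weight W \<rho> z) \<partial>dA) < \<infinity>" .
    qed (use \<epsilon> \<rho>0(2) \<rho> tail_weight_measurable[OF W] in \<open>auto simp: energy_def\<close>)
    then show "dyadic_gauge p D (box_average p (tail_weight W \<rho>)) \<le> c'" by (simp add: \<epsilon>_def t)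
  qed
  show "\<forall>\<^sub>F \<rho> in at_left 1. tail_gauge p W \<rho> < c"
    by (rule eventually_at_leftI[OF _ \<rho>0(1)]) (use c' in \<open>auto intro!: le_less_trans[OF sup]\<close>)
qed simp

theorem theorem5p2:
  fixes p :: real and W :: "complex \<Rightarrow> real"
  assumes "0 < p" and "p \<le> 1"
    and "\<And>z. z \<in> unit_disc \<Longrightarrow> 0 \<le> W z"
    and "locally_integrable_on_disc W"
  shows "compact_mapping (Qp_space p) (Qp_norm p)
           (L2_space (weighted_area W)) (L2_norm (weighted_area W)) deriv
     \<longleftrightarrow>
       ((\<lambda>\<rho>. SUP \<D>\<in>{\<D>. dyadic_system \<D>}. dyadic_gauge p \<D> (box_average p (tail_weight W \<rho>)))
          \<longlongrightarrow> 0) (at_left 1)"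
  using compact_if_gauge_vanishing[OF assms(1,2,4)] gauge_vanishing_if_compact[OF assms(1,2,4)] by blast

end
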